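(* Let $k\ge1$ be an integer. Then any locally compact subset $N$ of a $C^k$ manifold $N'$ that is $C^k$ homogeneous in $N'$ is a $C^k$ submanifold of $N'$.
   Context: A subset $N$ of a $C^k$ manifold $N'$ is $C^k$ homogeneous in $N'$ if for any two points $p,q\in N$ there is a $C^k$ local diffeomorphism of $N'$ sending $p$ to $q$ and preserving $N$; that is, there are neighborhoods $U$ of $p$ and $V$ of $q$ in $N'$ and a $C^k$ diffeomorphism $H\colon U\to V$ with $H(p)=q$ and $H(U\cap N)=V\cap N$. *)

theory Defs
  imports "HOL-Analysis.Analysis"
begin

text \<open>
  Model space: the role of \<open>\<real>\<^sup>n\<close> is played by a linear subspace \<open>E\<close> of a Euclidean space, with
  \<open>n = dim E\<close>. Compared with using a Euclidean type itself, this includes the dimension 0 (types of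
  class \<^class>\<open>euclidean_space\<close> have positive dimension) and makes the dimension an ordinary number.
\<close>

text \<open>
  \<open>ck_on k E U f\<close>: the map \<open>f\<close> is of class \<open>C\<^sup>k\<close> on \<open>U\<close>, for \<open>U\<close> open in \<open>E\<close>. The derivative \<open>f' x\<close>
  within \<open>U\<close> is determined on \<open>E\<close> only, so only its values at vectors of \<open>E\<close> are constrained; since
  \<open>E\<close> is finite-dimensional, \<open>x \<mapsto> f' x\<close> is of class \<open>C\<^sup>k\<close> as an operator-valued map on \<open>U\<close> iff all
  \<open>x \<mapsto> f' x v\<close> with \<open>v \<in> E\<close> are.
\<close>

primrec ck_on ::
  "nat \<Rightarrow> 'e::euclidean_space set \<Rightarrow> 'e set \<Rightarrow> ('e \<Rightarrow> 'f::real_normed_vector) \<Rightarrow> bool" where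
  "ck_on 0 E U f \<longleftrightarrow> continuous_on U f"
| "ck_on (Suc k) E U f \<longleftrightarrow>
     (\<exists>f'. (\<forall>x\<in>U. (f has_derivative f' x) (at x within U)) \<and>
           (\<forall>v\<in>E. ck_on k E U (\<lambda>x. f' x v)))"

type_synonym ('a, 'e) chart = "'a set \<times> ('a \<Rightarrow> 'e)"

definition is_chart :: "'e::euclidean_space set \<Rightarrow> 'a topology \<Rightarrow> ('a, 'e) chart \<Rightarrow> bool" where
  "is_chart E X c \<longleftrightarrow> (case c of (U, \<phi>) \<Rightarrow>
     openin X U \<and> openin (top_of_set E) (\<phi> ` U) \<and>
     homeomorphic_map (subtopology X U) (top_of_set (\<phi> ` U)) \<phi>)"

definition ck_compatible ::
  "nat \<Rightarrow> 'e::euclidean_space set \<Rightarrow> ('a, 'e) chart \<Rightarrow> ('a, 'e) chart \<Rightarrow> bool" where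
  "ck_compatible k E c d \<longleftrightarrow> (case c of (U, \<phi>) \<Rightarrow> case d of (V, \<psi>) \<Rightarrow>
     ck_on k E (\<phi> ` (U \<inter> V)) (\<psi> \<circ> inv_into U \<phi>) \<and>
     ck_on k E (\<psi> ` (U \<inter> V)) (\<phi> \<circ> inv_into V \<psi>))"

text \<open>The atlas \<open>A\<close> need not be maximal; the charts of the manifold are those in \<open>ck_charts k E X A\<close>.\<close>

definition ck_manifold ::
  "nat \<Rightarrow> 'e::euclidean_space set \<Rightarrow> 'a topology \<Rightarrow> ('a, 'e) chart set \<Rightarrow> bool" where
  "ck_manifold k E X A \<longleftrightarrow>
     subspace E \<and> Hausdorff_space X \<and> second_countable X \<and>
     (\<forall>c\<in>A. is_chart E X c) \<and> (\<Union>c\<in>A. fst c) = topspace X \<and>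
     (\<forall>c\<in>A. \<forall>d\<in>A. ck_compatible k E c d)"

definition ck_charts ::
  "nat \<Rightarrow> 'e::euclidean_space set \<Rightarrow> 'a topology \<Rightarrow> ('a, 'e) chart set \<Rightarrow> ('a, 'e) chart set" where
  "ck_charts k E X A = {c. is_chart E X c \<and> (\<forall>d\<in>A. ck_compatible k E c d)}"

definition ck_map ::
  "nat \<Rightarrow> 'e::euclidean_space set \<Rightarrow> 'a topology \<Rightarrow> ('a, 'e) chart set \<Rightarrow> 'a set \<Rightarrow> ('a \<Rightarrow> 'a) \<Rightarrow> bool" where
  "ck_map k E X A W H \<longleftrightarrow>
     continuous_map (subtopology X W) X H \<and>
     (\<forall>(U, \<phi>)\<in>A. \<forall>(V, \<psi>)\<in>A.
        ck_on k E (\<phi> ` {x \<in> W \<inter> U. H x \<in> V}) (\<psi> \<circ> H \<circ> inv_into U \<phi>))"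

definition ck_diffeo ::
  "nat \<Rightarrow> 'e::euclidean_space set \<Rightarrow> 'a topology \<Rightarrow> ('a, 'e) chart set \<Rightarrow>
    'a set \<Rightarrow> 'a set \<Rightarrow> ('a \<Rightarrow> 'a) \<Rightarrow> bool" where
  "ck_diffeo k E X A U V H \<longleftrightarrow>
     openin X U \<and> openin X V \<and> bij_betw H U V \<and>
     ck_map k E X A U H \<and> ck_map k E X A V (inv_into U H)"

definition ck_homogeneous ::
  "nat \<Rightarrow> 'e::euclidean_space set \<Rightarrow> 'a topology \<Rightarrow> ('a, 'e) chart set \<Rightarrow> 'a set \<Rightarrow> bool" where
  "ck_homogeneous k E X A N \<longleftrightarrow>
     (\<forall>p\<in>N. \<forall>q\<in>N. \<exists>U V H. p \<in> U \<and> q \<in> V \<and> ck_diffeo k E X A U V H \<and>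
        H p = q \<and> H ` (U \<inter> N) = V \<inter> N)"

text \<open>
  Embedded submanifolds, all of whose components have the same dimension \<open>m\<close>; they are not required
  to be closed subsets.
\<close>

definition ck_submanifold ::
  "nat \<Rightarrow> 'e::euclidean_space set \<Rightarrow> 'a topology \<Rightarrow> ('a, 'e) chart set \<Rightarrow> 'a set \<Rightarrow> bool" where
  "ck_submanifold k E X A N \<longleftrightarrow>
     N \<subseteq> topspace X \<and>
     (\<exists>m. \<forall>p\<in>N. \<exists>(U, \<phi>) \<in> ck_charts k E X A. \<exists>S.
        p \<in> U \<and> subspace S \<and> S \<subseteq> E \<and> dim S = m \<and> \<phi> ` (U \<inter> N) = \<phi> ` U \<inter> S)"

end

theory Submission
  imports Defs
begin

text \<open>
  The proof compares two tangent cones of a set \<open>M\<close> at a point: \<open>tcone M a\<close>, the limits of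
  \<open>(x\<^sub>n - a) / t\<^sub>n\<close>, and the larger \<open>pcone M a\<close>, the limits of \<open>(x\<^sub>n - y\<^sub>n) / t\<^sub>n\<close> with both
  \<open>x\<^sub>n\<close> and \<open>y\<^sub>n\<close> in \<open>M\<close> converging to \<open>a\<close>. By the Baire category theorem the two cones agree at a
  generic point and \<open>pcone\<close> is lower semicontinuous there; by homogeneity this holds everywhere.
  Since \<open>pcone\<close> is symmetric, a smooth function which has a local maximum on \<open>M\<close> at \<open>a\<close> then has a
  differential vanishing on \<open>pcone M a\<close>, and limits of such differentials vanish on the cone at the
  limit point. Applied to nearest points, this shows that the projection of \<open>M\<close> to the span of its
  cone covers a neighbourhood, so that \<open>M\<close> is locally a Lipschitz graph; applied to maxima of
  penalised coordinates of the graph function, it shows that this function is of class \<open>C\<^sup>1\<close>.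

  Higher smoothness is obtained by applying the same argument to the set of \<open>j\<close>-jets of the graph
  function, which is homogeneous under the action of the local diffeomorphisms on jets. The new point
  is that its cones contain no vertical vectors: otherwise every point near \<open>z\<^sub>0\<close> would have one, so that
  \<open>n * norm (p z - p z\<^sub>0) - \<xi> z\<close> had no minimum inside a small ball, and for \<open>n\<close> to infinity
  the minima on the boundary would contradict the injectivity of the projection \<open>p\<close> on the set.
\<close>

section \<open>Tangent cones\<close>

text \<open>The action of a local diffeomorphism on jets is constructed only along the set of jets
  of the graph function, as an expression in these jets which involves the inverse of a Jacobian
  matrix. Cones are therefore transported by \<open>secant_map\<close>, which asks for continuous
  difference quotients on an arbitrary subset, and not by C^1 maps of open sets. A C^k
  diffeomorphism acts on \<open>j\<close>-jets with \<open>k - j\<close> derivatives to spare. One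
  of them is spent on the difference quotients, so the step from \<open>j\<close> to
  \<open>j + 1\<close> is possible for \<open>j < k\<close> and the induction reaches order
  \<open>k\<close>. For the set itself the projection may be chosen to suit the cone, hence it is
  injective on the cone at the chosen point. For jets the projection is prescribed by the base, and
  a cone that is too large cannot be absorbed by a larger target. This is why vertical vectors need
  their own argument, with lower semicontinuity required of the vertical part of the cone. The
  dimension of the jet space depends on values and not on types, so the cones live in a normed space
  and finite dimension enters as a subspace whose balls are compact.\<close>

definition tcone :: "'z::real_normed_vector set \<Rightarrow> 'z \<Rightarrow> 'z set" where
  "tcone M a = {v. \<exists>x t. (\<forall>n. x n \<in> M \<and> t n > 0) \<and> x \<longlonglongrightarrow> a \<and>
      (\<lambda>n. (x n - a) /\<^sub>R t n) \<longlonglongrightarrow> v}"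

definition pcone :: "'z::real_normed_vector set \<Rightarrow> 'z \<Rightarrow> 'z set" where
  "pcone M a = {v. \<exists>x y t. (\<forall>n. x n \<in> M \<and> y n \<in> M \<and> t n > 0) \<and> x \<longlonglongrightarrow> a \<and> y \<longlonglongrightarrow> a \<and>
      (\<lambda>n. (x n - y n) /\<^sub>R t n) \<longlonglongrightarrow> v}"

text \<open>The form without sequences avoids diagonal sequences when cones at varying points are
  compared, and its negation is the uniform gap on which the Baire argument works.\<close>

lemma tcone_iff:
  "v \<in> tcone M a \<longleftrightarrow> (\<forall>e>0. \<exists>x\<in>M. \<exists>t>0. dist x a < e \<and> dist ((x - a) /\<^sub>R t) v < e)"
    (is "_ \<longleftrightarrow> ?R")
proof
  assume "v \<in> tcone M a"
  then obtain x t where *: "\<forall>n. x n \<in> M \<and> (t n::real) > 0" "x \<longlonglongrightarrow> a" "(\<lambda>n. (x n - a) /\<^sub>R t n) \<longlonglongrightarrow> v"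
    by (auto simp: tcone_def)
  show ?R
  proof (intro allI impI)
    fix e :: real assume "e > 0"
    have "\<forall>\<^sub>F n in sequentially. dist (x n) a < e \<and> dist ((x n - a) /\<^sub>R t n) v < e"
      using *(2,3) \<open>e > 0\<close> by (intro eventually_conj tendstoD) auto
    then obtain n where "dist (x n) a < e \<and> dist ((x n - a) /\<^sub>R t n) v < e"
      using eventually_happens trivial_limit_sequentially by blast
    then show "\<exists>x\<in>M. \<exists>t>0. dist x a < e \<and> dist ((x - a) /\<^sub>R t) v < e"
      using *(1) by blast
  qed
next
  assume R: ?R
  have "\<forall>n. \<exists>x t. x \<in> M \<and> t > 0 \<and> dist x a < inverse (real (Suc n)) \<and>
      dist ((x - a) /\<^sub>R t) v < inverse (real (Suc n))"
  proof
    fix n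
    show "\<exists>x t. x \<in> M \<and> t > 0 \<and> dist x a < inverse (real (Suc n)) \<and>
      dist ((x - a) /\<^sub>R t) v < inverse (real (Suc n))"
      using R[rule_format, of "inverse (real (Suc n))"] by auto
  qed
  then obtain x t where *: "\<And>n. x n \<in> M" "\<And>n. t n > 0"
      "\<And>n. dist (x n) a < inverse (real (Suc n))"
      "\<And>n. dist ((x n - a) /\<^sub>R t n) v < inverse (real (Suc n))"
    by metis
  have "x \<longlonglongrightarrow> a" "(\<lambda>n. (x n - a) /\<^sub>R t n) \<longlonglongrightarrow> v"
    by (rule metric_tendsto_imp_tendsto[OF LIMSEQ_inverse_real_of_nat],
        use * in \<open>force intro!: always_eventually less_imp_le\<close>)+
  with * show "v \<in> tcone M a"
    by (auto simp: tcone_def)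
qed

lemma pcone_iff:
  "v \<in> pcone M a \<longleftrightarrow> (\<forall>e>0. \<exists>x\<in>M. \<exists>y\<in>M. \<exists>t>0. dist x a < e \<and> dist y a < e \<and> dist ((x - y) /\<^sub>R t) v < e)"
    (is "_ \<longleftrightarrow> ?R")
proof
  assume "v \<in> pcone M a"
  then obtain x y t where *: "\<forall>n. x n \<in> M \<and> y n \<in> M \<and> (t n::real) > 0" "x \<longlonglongrightarrow> a" "y \<longlonglongrightarrow> a"
      "(\<lambda>n. (x n - y n) /\<^sub>R t n) \<longlonglongrightarrow> v"
    by (auto simp: pcone_def)
  show ?R
  proof (intro allI impI)
    fix e :: real assume "e > 0"
    have "\<forall>\<^sub>F n in sequentially. dist (x n) a < e \<and> dist (y n) a < e \<and> dist ((x n - y n) /\<^sub>R t n) v < e"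
      using *(2-4) \<open>e > 0\<close> by (intro eventually_conj tendstoD) auto
    then obtain n where "dist (x n) a < e \<and> dist (y n) a < e \<and> dist ((x n - y n) /\<^sub>R t n) v < e"
      using eventually_happens trivial_limit_sequentially by blast
    then show "\<exists>x\<in>M. \<exists>y\<in>M. \<exists>t>0. dist x a < e \<and> dist y a < e \<and> dist ((x - y) /\<^sub>R t) v < e"
      using *(1) by blast
  qed
next
  assume R: ?R
  have "\<forall>n. \<exists>x y t. x \<in> M \<and> y \<in> M \<and> t > 0 \<and> dist x a < inverse (real (Suc n)) \<and>
      dist y a < inverse (real (Suc n)) \<and> dist ((x - y) /\<^sub>R t) v < inverse (real (Suc n))"
  proof
    fix n
    show "\<exists>x y t. x \<in> M \<and> y \<in> M \<and> t > 0 \<and> dist x a < inverse (real (Suc n)) \<and>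
      dist y a < inverse (real (Suc n)) \<and> dist ((x - y) /\<^sub>R t) v < inverse (real (Suc n))"
      using R[rule_format, of "inverse (real (Suc n))"] by (auto simp del: of_nat_Suc)
  qed
  then obtain x y t where *: "\<And>n. x n \<in> M" "\<And>n. y n \<in> M" "\<And>n. t n > 0"
      "\<And>n. dist (x n) a < inverse (real (Suc n))" "\<And>n. dist (y n) a < inverse (real (Suc n))"
      "\<And>n. dist ((x n - y n) /\<^sub>R t n) v < inverse (real (Suc n))"
    by metis
  have "x \<longlonglongrightarrow> a" "y \<longlonglongrightarrow> a" "(\<lambda>n. (x n - y n) /\<^sub>R t n) \<longlonglongrightarrow> v"
    by (rule metric_tendsto_imp_tendsto[OF LIMSEQ_inverse_real_of_nat],
        use * in \<open>force intro!: always_eventually less_imp_le\<close>)+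
  with * show "v \<in> pcone M a"
    unfolding pcone_def by blast
qed

lemma pcone_minus: "v \<in> pcone M a \<Longrightarrow> - v \<in> pcone M a"
  unfolding pcone_def
proof clarify
  fix x y t assume *: "\<forall>n. x n \<in> M \<and> y n \<in> M \<and> 0 < t n" "x \<longlonglongrightarrow> a" "y \<longlonglongrightarrow> a"
    "(\<lambda>n. (x n - y n) /\<^sub>R t n) \<longlonglongrightarrow> v"
  have "(\<lambda>n. (y n - x n) /\<^sub>R t n) \<longlonglongrightarrow> - v"
    using tendsto_minus[OF *(4)] by (simp add: scaleR_right_diff_distrib)
  with * show "\<exists>x y t. (\<forall>n. x n \<in> M \<and> y n \<in> M \<and> 0 < t n) \<and> x \<longlonglongrightarrow> a \<and> y \<longlonglongrightarrow> a \<and>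
      (\<lambda>n. (x n - y n) /\<^sub>R t n) \<longlonglongrightarrow> - v"
    by (intro exI[of _ y] exI[of _ x] exI[of _ t]) auto
qed

text \<open>This half of continuity holds for every set, because both endpoints of a secant may move
  with the base point. The other half, \<open>cone_lsc\<close>, holds only at generic
  points.\<close>

lemma pcone_closed_graph:
  assumes "\<And>n. v n \<in> pcone M (a n)" "a \<longlonglongrightarrow> b" "v \<longlonglongrightarrow> w"
  shows "w \<in> pcone M b"
  unfolding pcone_iff
proof (intro allI impI)
  fix e :: real assume "e > 0"
  have "\<forall>\<^sub>F n in sequentially. dist (a n) b < e/2 \<and> dist (v n) w < e/2"
    using assms \<open>e > 0\<close> by (intro eventually_conj tendstoD) auto
  then obtain n where n: "dist (a n) b < e/2" "dist (v n) w < e/2"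
    using eventually_happens trivial_limit_sequentially by blast
  from assms(1)[of n, unfolded pcone_iff, rule_format, of "e/2"] \<open>e > 0\<close>
  obtain x y t where *: "x \<in> M" "y \<in> M" "t > 0" "dist x (a n) < e/2" "dist y (a n) < e/2"
      "dist ((x - y) /\<^sub>R t) (v n) < e/2"
    by auto
  have "dist x b < e" "dist y b < e" "dist ((x - y) /\<^sub>R t) w < e"
    using n * dist_triangle[of x b "a n"] dist_triangle[of y b "a n"]
      dist_triangle[of "(x - y) /\<^sub>R t" w "v n"] by linarith+
  with * show "\<exists>x\<in>M. \<exists>y\<in>M. \<exists>t>0. dist x b < e \<and> dist y b < e \<and> dist ((x - y) /\<^sub>R t) w < e"
    by blast
qed

lemma pcone_subset_subspace:
  assumes "M \<subseteq> Z" "subspace Z" "closed Z"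
  shows "pcone M a \<subseteq> Z"
proof
  fix v assume "v \<in> pcone M a"
  then obtain x y t where *: "\<forall>n. x n \<in> M \<and> y n \<in> M \<and> 0 < (t n::real)"
    "(\<lambda>n. (x n - y n) /\<^sub>R t n) \<longlonglongrightarrow> v"
    by (auto simp: pcone_def)
  have "(x n - y n) /\<^sub>R t n \<in> Z" for n
    using * assms by (intro subspace_scale subspace_diff) auto
  then show "v \<in> Z"
    by (rule closed_sequentially[OF assms(3) _ *(2)])
qed

lemma pcone_relopen:
  assumes "openin (top_of_set M) S" "a \<in> S"
  shows "pcone S a = pcone M a"
proof
  have "S \<subseteq> M" using assms openin_imp_subset by blast
  then show "pcone S a \<subseteq> pcone M a" unfolding pcone_def by blast
  obtain d where d: "d > 0" "ball a d \<inter> M \<subseteq> S"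
    using assms unfolding openin_contains_ball by blast
  show "pcone M a \<subseteq> pcone S a"
  proof
    fix v assume v: "v \<in> pcone M a"
    show "v \<in> pcone S a"
      unfolding pcone_iff
    proof (intro allI impI)
      fix e :: real assume "e > 0"
      then have "min e d > 0" using d by simp
      with v[unfolded pcone_iff] obtain x y t where "x\<in>M" "y\<in>M" "t>0" "dist x a < min e d" "dist y a < min e d"
          "dist ((x - y) /\<^sub>R t) v < min e d"
        by blast
      with d show "\<exists>x\<in>S. \<exists>y\<in>S. \<exists>t>0. dist x a < e \<and> dist y a < e \<and> dist ((x - y) /\<^sub>R t) v < e"
        by (intro bexI[of _ x] bexI[of _ y] exI[of _ t]) (auto simp: dist_commute)
    qed
  qed
qed

lemma tcone_relopen:
  assumes "openin (top_of_set M) S" "a \<in> S"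
  shows "tcone S a = tcone M a"
proof
  have "S \<subseteq> M" using assms openin_imp_subset by blast
  then show "tcone S a \<subseteq> tcone M a" unfolding tcone_def by blast
  obtain d where d: "d > 0" "ball a d \<inter> M \<subseteq> S"
    using assms unfolding openin_contains_ball by blast
  show "tcone M a \<subseteq> tcone S a"
  proof
    fix v assume v: "v \<in> tcone M a"
    show "v \<in> tcone S a"
      unfolding tcone_iff
    proof (intro allI impI)
      fix e :: real assume "e > 0"
      then have "min e d > 0" using d by simp
      with v[unfolded tcone_iff] obtain x t where "x\<in>M" "t>0" "dist x a < min e d"
          "dist ((x - a) /\<^sub>R t) v < min e d"
        by blast
      with d show "\<exists>x\<in>S. \<exists>t>0. dist x a < e \<and> dist ((x - a) /\<^sub>R t) v < e"
        by (intro bexI[of _ x] exI[of _ t]) (auto simp: dist_commute)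
    qed
  qed
qed

text \<open>Along a sequence that defines \<open>w\<close>, the quadratic error divided by
  \<open>t n\<close> is \<open>C * norm (x n - a)\<close> times a bounded quantity and tends to 0.
  Positive homogeneity suffices for this, and \<open>no_vertical_vector\<close> applies it to a
  function that is not linear.\<close>

lemma tcone_touch:
  fixes \<phi> :: "'z::real_normed_vector \<Rightarrow> real"
  assumes cont: "continuous_on UNIV \<phi>"
    and hom: "\<And>t v. t > 0 \<Longrightarrow> \<phi> (t *\<^sub>R v) = t * \<phi> v"
    and "d > 0"
    and le: "\<And>b. b \<in> M \<Longrightarrow> dist b a < d \<Longrightarrow> \<phi> (b - a) \<le> C * (norm (b - a))\<^sup>2"
    and w: "w \<in> tcone M a"
  shows "\<phi> w \<le> 0"
proof -
  obtain x t where *: "\<forall>n. x n \<in> M \<and> 0 < (t n::real)" "x \<longlonglongrightarrow> a" "(\<lambda>n. (x n - a) /\<^sub>R t n) \<longlonglongrightarrow> w"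
    using w by (auto simp: tcone_def)
  have 1: "(\<lambda>n. \<phi> ((x n - a) /\<^sub>R t n)) \<longlonglongrightarrow> \<phi> w"
    by (rule continuous_on_tendsto_compose[OF cont *(3)]) auto
  have 2: "(\<lambda>n. C * norm (x n - a) * norm ((x n - a) /\<^sub>R t n)) \<longlonglongrightarrow> C * 0 * norm w"
    using *(2,3) by (intro tendsto_intros) (auto simp: tendsto_norm_zero LIM_zero)
  have "\<forall>\<^sub>F n in sequentially. \<phi> ((x n - a) /\<^sub>R t n) \<le> C * norm (x n - a) * norm ((x n - a) /\<^sub>R t n)"
    using tendstoD[OF *(2) \<open>d > 0\<close>]
  proof eventually_elim
    case (elim n)
    have t: "t n > 0" using * by auto
    have "\<phi> ((x n - a) /\<^sub>R t n) = \<phi> (x n - a) / t n"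
      using hom[of "inverse (t n)" "x n - a"] t by (simp add: divide_inverse mult.commute)
    also have "\<dots> \<le> C * (norm (x n - a))\<^sup>2 / t n"
      using le[of "x n"] * elim t by (intro divide_right_mono less_imp_le[OF t]) auto
    also have "\<dots> = C * norm (x n - a) * norm ((x n - a) /\<^sub>R t n)"
      using t by (simp add: power2_eq_square divide_inverse)
    finally show ?case .
  qed
  from tendsto_le[OF _ 2 1 this] show ?thesis by simp
qed

text \<open>The one-sided bound holds for \<open>w\<close> and, by the symmetry of
  \<open>pcone\<close>, for \<open>- w\<close>. A maximum up to a quadratic error thus behaves as at
  an interior point of a manifold.\<close>

lemma pcone_touch:
  assumes "bounded_linear \<phi>" "pcone M a \<subseteq> tcone M a" "d > 0"
    and "\<And>b. b \<in> M \<Longrightarrow> dist b a < d \<Longrightarrow> \<phi> (b - a) \<le> C * (norm (b - a))\<^sup>2"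
    and "w \<in> pcone M a"
  shows "\<phi> w = 0"
proof -
  have c: "continuous_on UNIV \<phi>"
    using assms(1) by (simp add: linear_continuous_on)
  have h: "\<phi> (t *\<^sub>R v) = t * \<phi> v" for t v
    using linear_scale[OF bounded_linear.linear[OF assms(1)]] by simp
  have "\<phi> w \<le> 0" "\<phi> (- w) \<le> 0"
    using assms pcone_minus[OF assms(5)]
    by (auto intro!: tcone_touch[OF c h, of d M a C])
  then show ?thesis
    using linear_neg[OF bounded_linear.linear[OF assms(1)], of w] by simp
qed

section \<open>Difference quotients of maps on arbitrary sets\<close>

text \<open>The operator \<open>A x y\<close> is a difference quotient of \<open>h\<close>; the continuity of \<open>A\<close> at the diagonal
  is Caratheodory's form of strict differentiability.\<close>

definition secant_map ::
  "('z::real_normed_vector \<Rightarrow> 'w::real_normed_vector) \<Rightarrow> ('z \<Rightarrow> 'z \<Rightarrow> 'z \<Rightarrow> 'w) \<Rightarrow> 'z set \<Rightarrow> bool" where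
  "secant_map h A S \<longleftrightarrow> (\<forall>x y. linear (A x y)) \<and> (\<forall>x\<in>S. \<forall>y\<in>S. h x - h y = A x y (x - y)) \<and>
     (\<forall>c\<in>S. \<forall>X Y V v. (\<forall>n. X n \<in> S \<and> Y n \<in> S) \<longrightarrow> X \<longlonglongrightarrow> c \<longrightarrow> Y \<longlonglongrightarrow> c \<longrightarrow> V \<longlonglongrightarrow> v \<longrightarrow>
        (\<lambda>n. A (X n) (Y n) (V n)) \<longlonglongrightarrow> A c c v)"

text \<open>The sequences need to lie in \<open>S\<close> only eventually: the finitely many other
  terms are replaced by \<open>c\<close>.\<close>

lemma secant_map_tendsto:
  assumes "secant_map h A S" "c \<in> S" "\<forall>\<^sub>F n in sequentially. X n \<in> S" "\<forall>\<^sub>F n in sequentially. Y n \<in> S"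
    "X \<longlonglongrightarrow> c" "Y \<longlonglongrightarrow> c" "V \<longlonglongrightarrow> v"
  shows "(\<lambda>n. A (X n) (Y n) (V n)) \<longlonglongrightarrow> A c c v"
proof -
  define X' where "X' n = (if X n \<in> S then X n else c)" for n
  define Y' where "Y' n = (if Y n \<in> S then Y n else c)" for n
  have eX: "\<forall>\<^sub>F n in sequentially. X' n = X n"
    using assms(3) by eventually_elim (simp add: X'_def)
  have eY: "\<forall>\<^sub>F n in sequentially. Y' n = Y n"
    using assms(4) by eventually_elim (simp add: Y'_def)
  have "X' \<longlonglongrightarrow> c" "Y' \<longlonglongrightarrow> c"
    using assms(5,6) tendsto_cong[OF eX] tendsto_cong[OF eY] by auto
  moreover have "\<forall>n. X' n \<in> S \<and> Y' n \<in> S"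
    using assms(2) by (auto simp: X'_def Y'_def)
  ultimately have "(\<lambda>n. A (X' n) (Y' n) (V n)) \<longlonglongrightarrow> A c c v"
    using assms(1,2,7) unfolding secant_map_def by blast
  moreover have "\<forall>\<^sub>F n in sequentially. A (X' n) (Y' n) (V n) = A (X n) (Y n) (V n)"
    using eX eY by eventually_elim simp
  ultimately show ?thesis
    by (rule Lim_transform_eventually)
qed

lemma secant_map_continuous:
  assumes "secant_map h A S" "c \<in> S" "\<And>n. X n \<in> S" "X \<longlonglongrightarrow> c"
  shows "(\<lambda>n. h (X n)) \<longlonglongrightarrow> h c"
proof -
  have l: "linear (A c c)" using assms by (simp add: secant_map_def)
  have "(\<lambda>n. A (X n) c (X n - c)) \<longlonglongrightarrow> A c c 0"
    using assms by (intro secant_map_tendsto[OF assms(1,2)]) (auto simp: LIM_zero)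
  then have "(\<lambda>n. A (X n) c (X n - c)) \<longlonglongrightarrow> 0"
    using linear_0[OF l] by simp
  moreover have "A (X n) c (X n - c) = h (X n) - h c" for n
    using assms by (simp add: secant_map_def)
  ultimately show ?thesis by (simp add: LIM_zero_iff)
qed

lemma secant_map_subset: "secant_map h A S \<Longrightarrow> T \<subseteq> S \<Longrightarrow> secant_map h A T"
  unfolding secant_map_def by (meson subsetD)

text \<open>The identity \<open>h x - h y = A x y (x - y)\<close> is exact, so \<open>A\<close>
  carries the rescaled secants of \<open>S\<close> to those of \<open>S'\<close>, and continuity of
  \<open>A\<close> at the diagonal takes care of the limit.\<close>

lemma secant_map_pcone:
  assumes "secant_map h A S" "c \<in> S" "h ` S \<subseteq> S'" "v \<in> pcone S c"
  shows "A c c v \<in> pcone S' (h c)"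
proof -
  obtain x y t where *: "\<forall>n. x n \<in> S \<and> y n \<in> S \<and> 0 < (t n::real)" "x \<longlonglongrightarrow> c" "y \<longlonglongrightarrow> c"
    "(\<lambda>n. (x n - y n) /\<^sub>R t n) \<longlonglongrightarrow> v"
    using assms(4) by (auto simp: pcone_def)
  have l: "linear (A x y)" for x y using assms by (simp add: secant_map_def)
  have "(\<lambda>n. A (x n) (y n) ((x n - y n) /\<^sub>R t n)) \<longlonglongrightarrow> A c c v"
    using * by (intro secant_map_tendsto[OF assms(1,2)]) auto
  moreover have "A (x n) (y n) ((x n - y n) /\<^sub>R t n) = (h (x n) - h (y n)) /\<^sub>R t n" for n
    using assms(1) * by (simp add: linear_scale[OF l] secant_map_def)
  ultimately have "(\<lambda>n. (h (x n) - h (y n)) /\<^sub>R t n) \<longlonglongrightarrow> A c c v" by simp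
  then show ?thesis
    unfolding pcone_def using * assms secant_map_continuous[OF assms(1,2)]
    by (intro CollectI exI[of _ "\<lambda>n. h (x n)"] exI[of _ "\<lambda>n. h (y n)"] exI[of _ t]) auto
qed

lemma secant_map_tcone:
  assumes "secant_map h A S" "c \<in> S" "h ` S \<subseteq> S'" "v \<in> tcone S c"
  shows "A c c v \<in> tcone S' (h c)"
proof -
  obtain x t where *: "\<forall>n. x n \<in> S \<and> 0 < (t n::real)" "x \<longlonglongrightarrow> c"
    "(\<lambda>n. (x n - c) /\<^sub>R t n) \<longlonglongrightarrow> v"
    using assms(4) by (auto simp: tcone_def)
  have l: "linear (A x y)" for x y using assms by (simp add: secant_map_def)
  have "(\<lambda>n. A (x n) c ((x n - c) /\<^sub>R t n)) \<longlonglongrightarrow> A c c v"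
    using * assms(2) by (intro secant_map_tendsto[OF assms(1,2)]) auto
  moreover have "A (x n) c ((x n - c) /\<^sub>R t n) = (h (x n) - h c) /\<^sub>R t n" for n
    using assms(1,2) * by (simp add: linear_scale[OF l] secant_map_def)
  ultimately have "(\<lambda>n. (h (x n) - h c) /\<^sub>R t n) \<longlonglongrightarrow> A c c v" by simp
  then show ?thesis
    unfolding tcone_def using * assms secant_map_continuous[OF assms(1,2)]
    by (intro CollectI exI[of _ "\<lambda>n. h (x n)"] exI[of _ t]) auto
qed

definition secant_equiv where
  "secant_equiv S S' h h' A A' \<longleftrightarrow>
     (\<forall>x\<in>S. h x \<in> S' \<and> h' (h x) = x) \<and> (\<forall>y\<in>S'. h' y \<in> S \<and> h (h' y) = y) \<and>
     secant_map h A S \<and> secant_map h' A' S'"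

lemma secant_equiv_sym: "secant_equiv S S' h h' A A' \<Longrightarrow> secant_equiv S' S h' h A' A"
  by (auto simp: secant_equiv_def)

text \<open>The two operators are shown to be inverse to each other on the cone only. In other
  directions \<open>A c c\<close> is not determined by \<open>h\<close>, which lives on
  \<open>S\<close>.\<close>

lemma secant_equiv_inverse:
  assumes "secant_equiv S S' h h' A A'" "c \<in> S" "v \<in> pcone S c"
  shows "A' (h c) (h c) (A c c v) = v"
proof -
  have sm: "secant_map h A S" "secant_map h' A' S'" using assms by (auto simp: secant_equiv_def)
  obtain x y t where *: "\<forall>n. x n \<in> S \<and> y n \<in> S \<and> 0 < (t n::real)" "x \<longlonglongrightarrow> c" "y \<longlonglongrightarrow> c"
    "(\<lambda>n. (x n - y n) /\<^sub>R t n) \<longlonglongrightarrow> v"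
    using assms(3) by (auto simp: pcone_def)
  have l: "linear (A x y)" "linear (A' p q)" for x y p q using sm by (auto simp: secant_map_def)
  have 1: "(\<lambda>n. A (x n) (y n) ((x n - y n) /\<^sub>R t n)) \<longlonglongrightarrow> A c c v"
    using * by (intro secant_map_tendsto[OF sm(1) assms(2)]) auto
  have hS: "h x \<in> S'" "h' (h x) = x" if "x \<in> S" for x using that assms(1) by (auto simp: secant_equiv_def)
  have "(\<lambda>n. A' (h (x n)) (h (y n)) (A (x n) (y n) ((x n - y n) /\<^sub>R t n))) \<longlonglongrightarrow> A' (h c) (h c) (A c c v)"
    using * 1 hS assms(2) by (intro secant_map_tendsto[OF sm(2)]) (auto intro!: secant_map_continuous[OF sm(1)])
  moreover have "A' (h (x n)) (h (y n)) (A (x n) (y n) ((x n - y n) /\<^sub>R t n)) = (x n - y n) /\<^sub>R t n" for n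
  proof -
    have "A (x n) (y n) ((x n - y n) /\<^sub>R t n) = (h (x n) - h (y n)) /\<^sub>R t n"
      using sm(1) * by (simp add: linear_scale[OF l(1)] secant_map_def)
    moreover have "A' (h (x n)) (h (y n)) (h (x n) - h (y n)) = h' (h (x n)) - h' (h (y n))"
      using sm(2) hS * unfolding secant_map_def by metis
    ultimately show ?thesis
      using hS * by (simp add: linear_scale[OF l(2)])
  qed
  ultimately show ?thesis
    using *(4) LIMSEQ_unique by fastforce
qed

text \<open>A point of \<open>R n\<close> whose distance to \<open>v\<close> exceeds the infimum by
  less than \<open>1 / (n + 1)\<close> will do; the infimum itself need not be attained.\<close>

lemma tendsto_selection:
  fixes v :: "'z::metric_space"
  assumes "\<And>e. e > 0 \<Longrightarrow> \<forall>\<^sub>F n in sequentially. \<exists>w\<in>R n. dist w v < e"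
  obtains w where "\<forall>\<^sub>F n in sequentially. w n \<in> R n" "w \<longlonglongrightarrow> v"
proof -
  define w where "w n = (SOME w. w \<in> R n \<and> dist w v < infdist v (R n) + inverse (real (Suc n)))" for n
  have w: "w n \<in> R n \<and> dist (w n) v < infdist v (R n) + inverse (real (Suc n))" if ne: "R n \<noteq> {}" for n
  proof -
    have "(INF a\<in>R n. dist v a) < infdist v (R n) + inverse (real (Suc n))"
      using ne by (simp add: infdist_notempty)
    then obtain a where "a \<in> R n" "dist v a < infdist v (R n) + inverse (real (Suc n))"
      using ne by (subst (asm) cINF_less_iff) auto
    then have "\<exists>w. w \<in> R n \<and> dist w v < infdist v (R n) + inverse (real (Suc n))"
      by (auto simp: dist_commute)
    then show ?thesis unfolding w_def by (rule someI_ex)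
  qed
  have "\<forall>\<^sub>F n in sequentially. w n \<in> R n"
    using assms[of 1, simplified] by (rule eventually_mono) (use w in blast)
  moreover have "w \<longlonglongrightarrow> v"
  proof (rule tendstoI)
    fix e :: real assume "e > 0"
    have "\<forall>\<^sub>F n in sequentially. inverse (real (Suc n)) < e/2"
      using \<open>e > 0\<close> by (intro order_tendstoD(2)[OF LIMSEQ_inverse_real_of_nat]) auto
    moreover have "\<forall>\<^sub>F n in sequentially. \<exists>w\<in>R n. dist w v < e/2"
      using assms[of "e/2"] \<open>e > 0\<close> by linarith
    ultimately show "\<forall>\<^sub>F n in sequentially. dist (w n) v < e"
    proof eventually_elim
      case (elim n)
      then obtain u where "u \<in> R n" "dist u v < e/2" by auto
      then have "infdist v (R n) < e/2" "R n \<noteq> {}"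
        using infdist_le[of u "R n" v] by (auto simp: dist_commute)
      with w[of n] elim show ?case by auto
    qed
  qed
  ultimately show ?thesis using that by blast
qed

text \<open>Lower semicontinuity of the part of the cone inside \<open>K\<close>. It does not follow
  from the case \<open>K = UNIV\<close>, since vectors that approximate an element of
  \<open>K\<close> may lie outside \<open>K\<close>; for jets \<open>K\<close> will be the vertical
  subspace.\<close>

definition cone_lsc :: "'z::real_normed_vector set \<Rightarrow> 'z set \<Rightarrow> 'z \<Rightarrow> bool" where
  "cone_lsc M K a \<longleftrightarrow> (\<forall>v\<in>pcone M a \<inter> K. \<forall>e>0. \<exists>d>0. \<forall>c\<in>M. dist c a < d \<longrightarrow> (\<exists>w\<in>pcone M c \<inter> K. dist w v < e))"

lemma cone_lsc_selection:
  assumes "cone_lsc M K a" "\<forall>\<^sub>F n in sequentially. C n \<in> M" "C \<longlonglongrightarrow> a" "v \<in> pcone M a \<inter> K"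
  obtains w where "\<forall>\<^sub>F n in sequentially. w n \<in> pcone M (C n) \<inter> K" "w \<longlonglongrightarrow> v"
proof (rule tendsto_selection[of "\<lambda>n. pcone M (C n) \<inter> K" v])
  fix e :: real assume "e > 0"
  then obtain d where d: "d > 0" "\<forall>c\<in>M. dist c a < d \<longrightarrow> (\<exists>w\<in>pcone M c \<inter> K. dist w v < e)"
    using assms unfolding cone_lsc_def by blast
  show "\<forall>\<^sub>F n in sequentially. \<exists>w\<in>pcone M (C n) \<inter> K. dist w v < e"
    using tendstoD[OF assms(3) d(1)] assms(2) by eventually_elim (use d in auto)
qed (use that in auto)

text \<open>A vector at \<open>h a\<close> is pulled back to \<open>a\<close>, approximated there by
  cone vectors at the points \<open>h' (c n)\<close>, and these are pushed forward again. Continuity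
  of \<open>A\<close> at the diagonal keeps the approximation, and the conditions on
  \<open>A\<close> and \<open>A'\<close> keep it inside \<open>K\<close>.\<close>

lemma secant_equiv_cone_lsc:
  assumes eq: "secant_equiv S S' h h' A A'" and a: "a \<in> S" and S: "openin (top_of_set M) S"
    and S': "openin (top_of_set M') S'"
    and K: "\<And>c v. c \<in> S \<Longrightarrow> v \<in> pcone S c \<inter> K \<Longrightarrow> A c c v \<in> K"
    and K': "\<And>c v. c \<in> S' \<Longrightarrow> v \<in> pcone S' c \<inter> K \<Longrightarrow> A' c c v \<in> K"
    and lsc: "cone_lsc M K a"
  shows "cone_lsc M' K (h a)"
  unfolding cone_lsc_def
proof (intro ballI allI impI, rule ccontr)
  fix v and e :: real assume v: "v \<in> pcone M' (h a) \<inter> K" and "e > 0"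
    and neg: "\<not> (\<exists>d>0. \<forall>c\<in>M'. dist c (h a) < d \<longrightarrow> (\<exists>w\<in>pcone M' c \<inter> K. dist w v < e))"
  have sm: "secant_map h A S" "secant_map h' A' S'" using eq by (auto simp: secant_equiv_def)
  have hS: "h x \<in> S'" "h' (h x) = x" if "x \<in> S" for x using that eq by (auto simp: secant_equiv_def)
  have hS': "h' x \<in> S" "h (h' x) = x" if "x \<in> S'" for x using that eq by (auto simp: secant_equiv_def)
  obtain d0 where d0: "d0 > 0" "ball (h a) d0 \<inter> M' \<subseteq> S'"
    using S' hS(1)[OF a] unfolding openin_contains_ball by blast
  have "\<forall>n. \<exists>c. c \<in> M' \<and> dist c (h a) < min d0 (inverse (real (Suc n))) \<and> \<not> (\<exists>w\<in>pcone M' c \<inter> K. dist w v < e)"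
  proof
    fix n
    have "min d0 (inverse (real (Suc n))) > 0" using d0 by auto
    with neg show "\<exists>c. c \<in> M' \<and> dist c (h a) < min d0 (inverse (real (Suc n))) \<and> \<not> (\<exists>w\<in>pcone M' c \<inter> K. dist w v < e)"
      by blast
  qed
  then obtain c where c: "\<And>n. c n \<in> M'" "\<And>n. dist (c n) (h a) < min d0 (inverse (real (Suc n)))"
      "\<And>n. \<not> (\<exists>w\<in>pcone M' (c n) \<inter> K. dist w v < e)"
    by metis
  have cS: "c n \<in> S'" for n using c(1,2)[of n] d0 by (auto simp: dist_commute)
  have clim: "c \<longlonglongrightarrow> h a"
    by (rule metric_tendsto_imp_tendsto[OF LIMSEQ_inverse_real_of_nat])
       (use c(2) in \<open>force intro!: always_eventually less_imp_le\<close>)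
  define v0 where "v0 = A' (h a) (h a) v"
  have v': "v \<in> pcone S' (h a)" using v pcone_relopen[OF S' hS(1)[OF a]] by auto
  have v0: "v0 \<in> pcone S a"
    using secant_map_pcone[OF sm(2) hS(1)[OF a] _ v', of S] hS hS' a by (auto simp: v0_def)
  have v0K: "v0 \<in> K" using K'[of "h a" v] hS a v v' by (auto simp: v0_def)
  have Av0: "A a a v0 = v"
    using secant_equiv_inverse[OF secant_equiv_sym[OF eq] hS(1)[OF a] v'] hS a by (simp add: v0_def)
  have dlim: "(\<lambda>n. h' (c n)) \<longlonglongrightarrow> a"
    using secant_map_continuous[OF sm(2) hS(1)[OF a] cS clim] hS a by simp
  have hcS: "h' (c n) \<in> S" for n using hS' cS by auto
  have SM: "S \<subseteq> M" using S openin_imp_subset by blast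
  obtain w where w: "\<forall>\<^sub>F n in sequentially. w n \<in> pcone M (h' (c n)) \<inter> K" "w \<longlonglongrightarrow> v0"
    by (rule cone_lsc_selection[OF lsc _ dlim, of v0])
       (use hcS SM v0 v0K pcone_relopen[OF S a] in \<open>auto intro!: always_eventually\<close>)
  have "(\<lambda>n. A (h' (c n)) (h' (c n)) (w n)) \<longlonglongrightarrow> v"
    using secant_map_tendsto[OF sm(1) a _ _ dlim dlim w(2)] hcS Av0 by auto
  then have "\<forall>\<^sub>F n in sequentially. dist (A (h' (c n)) (h' (c n)) (w n)) v < e"
    using \<open>e > 0\<close> by (rule tendstoD)
  with w(1) have "\<forall>\<^sub>F n in sequentially. False"
  proof eventually_elim
    case (elim n)
    have wn: "w n \<in> pcone S (h' (c n))" using elim pcone_relopen[OF S hcS] by auto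
    have "A (h' (c n)) (h' (c n)) (w n) \<in> pcone S' (h (h' (c n)))"
      by (rule secant_map_pcone[OF sm(1) hcS _ wn]) (use hS in auto)
    then have "A (h' (c n)) (h' (c n)) (w n) \<in> pcone M' (c n)"
      using hS' cS pcone_relopen[OF S' cS] by auto
    moreover have "A (h' (c n)) (h' (c n)) (w n) \<in> K"
      using K[OF hcS] wn elim by auto
    ultimately show False using c(3)[of n] elim by blast
  qed
  then show False by simp
qed

lemma secant_equiv_cone_subset:
  assumes eq: "secant_equiv S S' h h' A A'" and a: "a \<in> S" and S: "openin (top_of_set M) S"
    and S': "openin (top_of_set M') S'"
    and sub: "pcone M a \<subseteq> tcone M a"
  shows "pcone M' (h a) \<subseteq> tcone M' (h a)"
proof
  fix v assume v: "v \<in> pcone M' (h a)"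
  have sm: "secant_map h A S" "secant_map h' A' S'" using eq by (auto simp: secant_equiv_def)
  have hS: "h x \<in> S'" "h' (h x) = x" if "x \<in> S" for x using that eq by (auto simp: secant_equiv_def)
  have hS': "h' x \<in> S" "h (h' x) = x" if "x \<in> S'" for x using that eq by (auto simp: secant_equiv_def)
  define v0 where "v0 = A' (h a) (h a) v"
  have v': "v \<in> pcone S' (h a)" using v pcone_relopen[OF S' hS(1)[OF a]] by auto
  have v0: "v0 \<in> pcone S a"
    using secant_map_pcone[OF sm(2) hS(1)[OF a] _ v', of S] hS hS' a by (auto simp: v0_def)
  have Av0: "A a a v0 = v"
    using secant_equiv_inverse[OF secant_equiv_sym[OF eq] hS(1)[OF a] v'] hS a by (simp add: v0_def)
  have "v0 \<in> tcone S a" using v0 sub pcone_relopen[OF S a] tcone_relopen[OF S a] by auto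
  then have "A a a v0 \<in> tcone S' (h a)"
    by (rule secant_map_tcone[OF sm(1) a, rotated]) (use hS in auto)
  then show "v \<in> tcone M' (h a)"
    using Av0 tcone_relopen[OF S' hS(1)[OF a]] by simp
qed

section \<open>Generic points\<close>

text \<open>The set \<open>C i\<close> without its interior is closed with empty interior, so
  countably many such sets do not cover \<open>M\<close>. A point outside all of them is interior to
  every \<open>C i\<close> that contains it.\<close>

lemma Baire_generic_point:
  fixes M :: "'a::metric_space set"
  assumes lc: "locally_compact_space (top_of_set M)" and ne: "M \<noteq> {}" and "countable I"
    and cl: "\<And>i. i \<in> I \<Longrightarrow> closedin (top_of_set M) (C i)"
  obtains z where "z \<in> M" "\<And>i. i \<in> I \<Longrightarrow> z \<in> C i \<Longrightarrow> \<exists>d>0. \<forall>c\<in>M. dist c z < d \<longrightarrow> c \<in> C i"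
proof -
  let ?X = "top_of_set M"
  define G where "G = (\<lambda>i. C i - ?X interior_of C i) ` I"
  have reg: "regular_space ?X"
    by (intro locally_compact_Hausdorff_imp_regular_space lc Hausdorff_space_subtopology Hausdorff_space_euclidean)
  have "?X interior_of \<Union>G = {}"
  proof (rule Baire_category_alt)
    show "countable G" using \<open>countable I\<close> by (auto simp: G_def)
    fix T assume "T \<in> G"
    then obtain i where i: "i \<in> I" "T = C i - ?X interior_of C i" by (auto simp: G_def)
    have "closedin ?X T"
      unfolding i using cl[OF i(1)] by (intro closedin_diff) auto
    moreover have "?X interior_of T = {}"
    proof -
      have "?X interior_of T \<subseteq> T" by (rule interior_of_subset)
      moreover have "?X interior_of T \<subseteq> ?X interior_of C i"
        by (rule interior_of_mono) (auto simp: i)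
      ultimately show ?thesis by (auto simp: i)
    qed
    ultimately show "closedin ?X T \<and> ?X interior_of T = {}" ..
  qed (use lc reg in auto)
  then have "\<not> M \<subseteq> \<Union>G"
    using ne interior_of_maximal[of M "\<Union>G" ?X] by auto
  then obtain z where z: "z \<in> M" "z \<notin> \<Union>G" by auto
  show ?thesis
  proof (rule that[OF z(1)])
    fix i assume i: "i \<in> I" "z \<in> C i"
    then have "z \<in> ?X interior_of C i" using z by (auto simp: G_def)
    then obtain U where U: "openin ?X U" "z \<in> U" "U \<subseteq> C i" by (auto simp: interior_of_def)
    then obtain d where "d > 0" "ball z d \<inter> M \<subseteq> U"
      unfolding openin_contains_ball by blast
    with U show "\<exists>d>0. \<forall>c\<in>M. dist c z < d \<longrightarrow> c \<in> C i"
      by (intro exI[of _ d]) (auto simp: dist_commute subset_iff)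
  qed
qed

text \<open>Compactness of the balls of \<open>Z\<close> stands for finite dimension: later
  \<open>Z\<close> is a span of finitely many vectors in an infinite-dimensional space.\<close>

lemma countable_dense_if_compact_balls:
  fixes Z :: "'z::real_normed_vector set"
  assumes "\<And>r. compact (Z \<inter> cball 0 r)"
  obtains D where "countable D" "\<And>v e. v \<in> Z \<Longrightarrow> e > 0 \<Longrightarrow> \<exists>d\<in>D. dist d v < e"
proof -
  have "\<exists>k. finite k \<and> Z \<inter> cball 0 (real n) \<subseteq> (\<Union>x\<in>k. ball x (inverse (real (Suc m))))" for n m
  proof -
    have "inverse (real (Suc m)) > 0" by simp
    then show ?thesis
      using assms[of "real n"] unfolding compact_eq_totally_bounded by blast
  qed
  then obtain k where k: "\<And>n m. finite (k n m)"
      "\<And>n m. Z \<inter> cball 0 (real n) \<subseteq> (\<Union>x\<in>k n m. ball x (inverse (real (Suc m))))"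
    by metis
  show ?thesis
  proof (rule that[of "\<Union>n m. k n m"])
    show "countable (\<Union>n m. k n m)" using k(1) by (intro countable_UN) (auto intro: countable_finite)
    fix v and e :: real assume v: "v \<in> Z" and e: "e > 0"
    obtain m where m: "inverse (real (Suc m)) < e" using reals_Archimedean[OF e] by auto
    obtain n where "norm v \<le> real n" using real_arch_simple by blast
    with v have "v \<in> Z \<inter> cball 0 (real n)" by simp
    with k(2)[of n m] have "v \<in> (\<Union>x\<in>k n m. ball x (inverse (real (Suc m))))" by blast
    then obtain x where "x \<in> k n m" "dist x v < inverse (real (Suc m))" by (auto simp del: of_nat_Suc)
    with m show "\<exists>d\<in>\<Union>n m. k n m. dist d v < e" by (intro bexI[of _ x]) auto
  qed
qed

lemma closed_if_compact_balls:
  fixes Z :: "'z::real_normed_vector set"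
  assumes "\<And>r. compact (Z \<inter> cball 0 r)"
  shows "closed Z"
  unfolding closed_sequential_limits
proof -
  show "\<forall>x l. (\<forall>n. x n \<in> Z) \<and> x \<longlonglongrightarrow> l \<longrightarrow> l \<in> Z"
  proof clarify
    fix x l assume x: "\<forall>n. x n \<in> Z" "x \<longlonglongrightarrow> l"
    obtain r where "\<forall>n. norm (x n) \<le> r"
      using convergent_imp_Bseq[OF convergentI[OF x(2)]] by (auto simp: Bseq_def)
    then have "\<forall>n. x n \<in> Z \<inter> cball 0 r" using x by auto
    with x(2) compact_imp_closed[OF assms[of r]] have "l \<in> Z \<inter> cball 0 r"
      unfolding closed_sequential_limits by blast
    then show "l \<in> Z" by simp
  qed
qed

lemma compact_balls_subsequence:
  fixes Z :: "'z::real_normed_vector set"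
  assumes "\<And>r. compact (Z \<inter> cball 0 r)" "\<And>n. x n \<in> Z" "\<And>n. norm (x n) \<le> B"
  obtains l r where "l \<in> Z" "strict_mono (r::nat\<Rightarrow>nat)" "(\<lambda>n. x (r n)) \<longlonglongrightarrow> l"
proof -
  have "\<forall>n. x n \<in> Z \<inter> cball 0 B" using assms by auto
  then obtain l r where "l \<in> Z \<inter> cball 0 B" "strict_mono (r::nat\<Rightarrow>nat)" "(x \<circ> r) \<longlonglongrightarrow> l"
    using assms(1)[of B] unfolding compact_def by blast
  then show ?thesis using that by (auto simp: comp_def)
qed

text \<open>Both properties are local constancy statements for countably many closed conditions,
  indexed by a dense set of directions \<open>d\<close> and radii \<open>ir n\<close>. At a generic
  point every such condition that holds persists nearby.\<close>

lemma generic_cone_point: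
  fixes M :: "'z::real_normed_vector set"
  assumes lc: "locally_compact_space (top_of_set M)" and ne: "M \<noteq> {}"
    and MZ: "M \<subseteq> Z" and subZ: "subspace Z" and cZ: "\<And>r. compact (Z \<inter> cball 0 r)"
    and K: "closed K"
  obtains a where "a \<in> M" "pcone M a \<subseteq> tcone M a" "cone_lsc M K a"
proof -
  have clZ: "closed Z" by (rule closed_if_compact_balls[OF cZ])
  have PZ: "pcone M a \<subseteq> Z" for a by (rule pcone_subset_subspace[OF MZ subZ clZ])
  obtain D where D: "countable D" "\<And>v e. v \<in> Z \<Longrightarrow> e > 0 \<Longrightarrow> \<exists>d\<in>D. dist d v < e"
    using countable_dense_if_compact_balls[OF cZ] by blast
  define ir where "ir n = inverse (real (Suc n))" for n
  have ir: "ir n > 0" for n by (simp add: ir_def)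
  have ir_ex: "\<exists>n. ir n < e" if "e > 0" for e using reals_Archimedean[OF that] by (simp add: ir_def)
  \<comment> \<open>At these points the direction \<open>d\<close> is missed by a margin: no secant
    from \<open>z\<close> to a point closer than \<open>ir m\<close> has a positive multiple within
    \<open>ir n\<close> of \<open>d\<close>.\<close>
  define C1 where "C1 = (\<lambda>(d, n, m). M \<inter> - (\<Union>x\<in>M. \<Union>t\<in>{0<..}. {z. dist x z < ir m \<and> dist ((x - z) /\<^sub>R t) d < ir n}))"
  \<comment> \<open>Closed inequality, so that these sets are closed: bounded cone vectors have a
    convergent subsequence, and its limit is a cone vector by
    \<open>pcone_closed_graph\<close>.\<close>
  define C2 where "C2 = (\<lambda>(d, n, m::nat). {z\<in>M. \<exists>v\<in>pcone M z \<inter> K. dist v d \<le> ir n})"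
  define C where "C = (\<lambda>(b, i). if b then C1 i else C2 i)"
  have cl1: "closedin (top_of_set M) (C1 (d, n, m))" for d n m
    unfolding C1_def prod.case
    by (intro closedin_closed_Int closed_Compl open_UN ballI open_Collect_conj open_Collect_less continuous_intros)
  have cl2: "closedin (top_of_set M) (C2 (d, n, m))" for d n m
  proof -
    have "l \<in> C2 (d, n, m)" if x: "\<forall>i. x i \<in> C2 (d, n, m)" "x \<longlonglongrightarrow> l" "l \<in> M" for x l
    proof -
      have "\<forall>i. \<exists>v. v \<in> pcone M (x i) \<inter> K \<and> dist v d \<le> ir n" using x(1) by (auto simp: C2_def)
      then obtain v where v: "\<And>i. v i \<in> pcone M (x i)" "\<And>i. v i \<in> K" "\<And>i. dist (v i) d \<le> ir n" by (metis IntE)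
      have b: "norm (v i) \<le> norm d + ir n" for i
        using v(3)[of i] norm_triangle_sub[of "v i" d] by (simp add: dist_norm)
      obtain w r where w: "w \<in> Z" "strict_mono (r::nat\<Rightarrow>nat)" "(\<lambda>i. v (r i)) \<longlonglongrightarrow> w"
        by (rule compact_balls_subsequence[OF cZ, of v "norm d + ir n"]) (use v PZ b in blast)+
      have "w \<in> pcone M l"
        by (rule pcone_closed_graph[OF v(1)[of "r _"] _ w(3)])
           (use LIMSEQ_subseq_LIMSEQ[OF x(2) w(2)] in \<open>simp add: comp_def\<close>)
      moreover have "w \<in> K" by (rule closed_sequentially[OF K v(2) w(3)])
      moreover have "dist w d \<le> ir n"
        by (rule tendsto_upperbound[OF tendsto_dist[OF w(3) tendsto_const]]) (use v(3) in auto)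
      ultimately show ?thesis using x(3) by (auto simp: C2_def)
    qed
    moreover have "C2 (d, n, m) \<subseteq> M" by (auto simp: C2_def)
    ultimately show ?thesis
      unfolding closedin_limpt islimpt_sequential by (metis DiffD1)
  qed
  have "countable (UNIV \<times> (D \<times> (UNIV \<times> UNIV) :: ('z \<times> nat \<times> nat) set) :: (bool \<times> 'z \<times> nat \<times> nat) set)"
    using D(1) by (intro countable_SIGMA) auto
  then obtain a where a: "a \<in> M" and gen:
    "\<And>i. i \<in> UNIV \<times> (D \<times> (UNIV \<times> UNIV)) \<Longrightarrow> a \<in> C i \<Longrightarrow> \<exists>d>0. \<forall>c\<in>M. dist c a < d \<longrightarrow> c \<in> C i"
    by (rule Baire_generic_point[OF lc ne, where C = C]) (auto simp: C_def cl1 cl2)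
  have gen1: "\<exists>e>0. \<forall>c\<in>M. dist c a < e \<longrightarrow> c \<in> C1 (d, n, m)" if "d \<in> D" "a \<in> C1 (d, n, m)" for d n m
    using gen[of "(True, d, n, m)"] that by (auto simp: C_def)
  have gen2: "\<exists>e>0. \<forall>c\<in>M. dist c a < e \<longrightarrow> c \<in> C2 (d, n, 0)" if "d \<in> D" "a \<in> C2 (d, n, 0)" for d n
    using gen[of "(False, d, n, 0)"] that by (auto simp: C_def)
  show ?thesis
  proof (rule that[OF a])
    show "pcone M a \<subseteq> tcone M a"
    proof (rule subsetI, rule ccontr)
      fix v assume v: "v \<in> pcone M a" "v \<notin> tcone M a"
      then obtain e where e: "e > 0" "\<And>x t. x \<in> M \<Longrightarrow> t > 0 \<Longrightarrow> dist x a < e \<Longrightarrow> dist ((x - a) /\<^sub>R t) v \<ge> e"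
        unfolding tcone_iff by (meson not_less)
      obtain n where n: "ir n < e / 2" using ir_ex[of "e/2"] e by auto
      obtain d where d: "d \<in> D" "dist d v < ir n" using D(2)[of v "ir n"] v PZ ir by blast
      \<comment> \<open>Since \<open>ir n < e / 2\<close> and \<open>d\<close> is within
        \<open>ir n\<close> of \<open>v\<close>, the gap \<open>e\<close> around \<open>v\<close>
        leaves a gap \<open>ir n\<close> around \<open>d\<close>. Genericity spreads it to all base
        points near \<open>a\<close>, while \<open>v\<close> being in \<open>pcone M a\<close>
        provides a secant starting at such a point \<open>y\<close> and violating it.\<close>
      have "a \<in> C1 (d, n, n)"
      proof -
        have False if "x \<in> M" "t > 0" "dist x a < ir n" "dist ((x - a) /\<^sub>R t) d < ir n" for x t
          using e(2)[OF that(1,2)] that(3,4) n d(2) e(1) dist_triangle[of "(x - a) /\<^sub>R t" v d] by simp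
        then show ?thesis using a by (auto simp: C1_def)
      qed
      from gen1[OF d(1) this] obtain r where r: "r > 0" "\<forall>c\<in>M. dist c a < r \<longrightarrow> c \<in> C1 (d, n, n)" by auto
      \<comment> \<open>The second bound makes \<open>x\<close> and \<open>y\<close> closer than
        \<open>ir n\<close> to each other, the third keeps the secant within \<open>ir n\<close> of
        \<open>d\<close>.\<close>
      define s where "s = min r (min (ir n / 2) (ir n - dist d v))"
      have "s > 0" using r d(2) ir[of n] by (auto simp: s_def)
      with v(1)[unfolded pcone_iff] obtain x y t where xy: "x \<in> M" "y \<in> M" "t > 0" "dist x a < s" "dist y a < s"
          "dist ((x - y) /\<^sub>R t) v < s" by blast
      have "y \<in> C1 (d, n, n)" using xy r by (auto simp: s_def)
      moreover have "dist x y < ir n"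
        using xy dist_triangle[of x y a] by (simp add: s_def dist_commute)
      moreover have "dist ((x - y) /\<^sub>R t) d < ir n"
        using xy(6) dist_triangle[of "(x - y) /\<^sub>R t" d v] by (simp add: s_def dist_commute)
      ultimately show False using xy by (auto simp: C1_def)
    qed
    show "cone_lsc M K a"
      unfolding cone_lsc_def
    proof (intro ballI allI impI)
      fix v and e :: real assume v: "v \<in> pcone M a \<inter> K" and e: "e > 0"
      obtain n where n: "ir n < e / 2" using ir_ex[of "e/2"] e by auto
      obtain d where d: "d \<in> D" "dist d v < ir n" using D(2)[of v "ir n"] v PZ ir by blast
      have "a \<in> C2 (d, n, 0)" using a v d by (force simp: C2_def dist_commute)
      from gen2[OF d(1) this] obtain r where r: "r > 0" "\<forall>c\<in>M. dist c a < r \<longrightarrow> c \<in> C2 (d, n, 0)" by auto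
      show "\<exists>d>0. \<forall>c\<in>M. dist c a < d \<longrightarrow> (\<exists>w\<in>pcone M c \<inter> K. dist w v < e)"
      proof (intro exI[of _ r] conjI ballI impI)
        fix c assume "c \<in> M" "dist c a < r"
        with r obtain w where "w \<in> pcone M c \<inter> K" "dist w d \<le> ir n" by (auto simp: C2_def)
        with d n show "\<exists>w\<in>pcone M c \<inter> K. dist w v < e"
          using dist_triangle[of w v d] by (intro bexI[of _ w]) auto
      qed (use r in auto)
    qed
  qed
qed

text \<open>Homogeneity in the weakest form that transports both cone properties. The last two
  conditions are what \<open>cone_lsc\<close> relative to \<open>K\<close> requires.\<close>

definition secant_homogeneous :: "'z::real_normed_vector set \<Rightarrow> 'z set \<Rightarrow> bool" where
  "secant_homogeneous M K \<longleftrightarrow> (\<forall>a\<in>M. \<forall>b\<in>M. \<exists>S S' h h' A A'.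
     openin (top_of_set M) S \<and> openin (top_of_set M) S' \<and> a \<in> S \<and> h a = b \<and>
     secant_equiv S S' h h' A A' \<and>
     (\<forall>c\<in>S. \<forall>v\<in>pcone S c \<inter> K. A c c v \<in> K) \<and> (\<forall>c\<in>S'. \<forall>v\<in>pcone S' c \<inter> K. A' c c v \<in> K))"

lemma secant_homogeneous_cones:
  fixes M :: "'z::real_normed_vector set"
  assumes lc: "locally_compact_space (top_of_set M)"
    and MZ: "M \<subseteq> Z" and subZ: "subspace Z" and cZ: "\<And>r. compact (Z \<inter> cball 0 r)"
    and K: "closed K" and hom: "secant_homogeneous M K" and b: "b \<in> M"
  shows "pcone M b \<subseteq> tcone M b" "cone_lsc M K b"
proof -
  obtain a where a: "a \<in> M" "pcone M a \<subseteq> tcone M a" "cone_lsc M K a"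
    using generic_cone_point[OF lc _ MZ subZ cZ K] b by blast
  obtain S S' h h' A A' where *: "openin (top_of_set M) S" "openin (top_of_set M) S'" "a \<in> S" "h a = b"
     "secant_equiv S S' h h' A A'"
     "\<forall>c\<in>S. \<forall>v\<in>pcone S c \<inter> K. A c c v \<in> K" "\<forall>c\<in>S'. \<forall>v\<in>pcone S' c \<inter> K. A' c c v \<in> K"
    using hom[unfolded secant_homogeneous_def, rule_format, OF a(1) b] by blast
  show "pcone M b \<subseteq> tcone M b"
    using secant_equiv_cone_subset[OF *(5,3,1,2) a(2)] *(4) by simp
  show "cone_lsc M K b"
    using secant_equiv_cone_lsc[OF *(5,3,1,2) _ _ a(3)] *(4,6,7) by blast
qed

section \<open>Lipschitz graphs\<close>

lemma tendsto_dist_le_inverse: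
  fixes x :: "nat \<Rightarrow> 'a::metric_space"
  assumes "\<And>n. dist (x n) a \<le> C * inverse (real (Suc n))"
  shows "x \<longlonglongrightarrow> a"
proof -
  have "(\<lambda>n. C * inverse (real (Suc n))) \<longlonglongrightarrow> 0"
    by (rule tendsto_mult_right_zero[OF LIMSEQ_inverse_real_of_nat])
  then have "(\<lambda>n. dist (x n) a) \<longlonglongrightarrow> 0"
    by (rule Lim_null_comparison[rotated]) (use assms in \<open>simp add: always_eventually del: of_nat_Suc\<close>)
  then show ?thesis by (rule tendsto_dist_iff[THEN iffD2])
qed

text \<open>If no constant works, normalised secants of pairs converging to \<open>z\<close>
  accumulate at a unit vector of \<open>pcone M z\<close> that is killed by
  \<open>p\<close>.\<close>

lemma pcone_lipschitz:
  fixes M :: "'z::real_normed_vector set" and p :: "'z \<Rightarrow> 'w::real_normed_vector"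
  assumes MZ: "M \<subseteq> Z" and subZ: "subspace Z" and cZ: "\<And>r. compact (Z \<inter> cball 0 r)"
    and p: "bounded_linear p" and ker: "\<And>v. v \<in> pcone M z \<Longrightarrow> p v = 0 \<Longrightarrow> v = 0"
  obtains r C where "r > 0" "C > 0"
    "\<And>a b. a \<in> M \<Longrightarrow> b \<in> M \<Longrightarrow> dist a z < r \<Longrightarrow> dist b z < r \<Longrightarrow> norm (a - b) \<le> C * norm (p (a - b))"
proof (rule ccontr)
  assume neg: "\<not> thesis"
  have "\<forall>n. \<exists>a b. a \<in> M \<and> b \<in> M \<and> dist a z < inverse (real (Suc n)) \<and> dist b z < inverse (real (Suc n)) \<and>
      norm (a - b) > real (Suc n) * norm (p (a - b))"
  proof (rule allI, rule ccontr)
    fix n assume "\<not> (\<exists>a b. a \<in> M \<and> b \<in> M \<and> dist a z < inverse (real (Suc n)) \<and> dist b z < inverse (real (Suc n)) \<and>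
      norm (a - b) > real (Suc n) * norm (p (a - b)))"
    then show False
      using neg that[of "inverse (real (Suc n))" "real (Suc n)"] by (metis inverse_positive_iff_positive not_less of_nat_0_less_iff zero_less_Suc)
  qed
  then obtain a b where ab: "\<And>n. a n \<in> M" "\<And>n. b n \<in> M" "\<And>n. dist (a n) z < inverse (real (Suc n))"
      "\<And>n. dist (b n) z < inverse (real (Suc n))" "\<And>n. norm (a n - b n) > real (Suc n) * norm (p (a n - b n))"
    by metis
  have lim: "a \<longlonglongrightarrow> z" "b \<longlonglongrightarrow> z"
    by (rule metric_tendsto_imp_tendsto[OF LIMSEQ_inverse_real_of_nat],
        use ab in \<open>force intro!: always_eventually less_imp_le\<close>)+
  define q where "q n = (a n - b n) /\<^sub>R norm (a n - b n)" for n
  have pos: "norm (a n - b n) > 0" for n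
    using le_less_trans[OF _ ab(5)[of n], of 0] by simp
  have nq: "norm (q n) = 1" for n using pos[of n] by (simp add: q_def)
  have qZ: "q n \<in> Z" for n
    unfolding q_def using ab MZ subZ by (intro subspace_scale subspace_diff) auto
  obtain v r where v: "v \<in> Z" "strict_mono (r::nat\<Rightarrow>nat)" "(\<lambda>n. q (r n)) \<longlonglongrightarrow> v"
    by (rule compact_balls_subsequence[OF cZ, of q 1]) (use qZ nq in auto)
  have "v \<in> pcone M z"
    unfolding pcone_def using ab pos v(3) LIMSEQ_subseq_LIMSEQ[OF lim(1) v(2)] LIMSEQ_subseq_LIMSEQ[OF lim(2) v(2)]
    by (intro CollectI exI[of _ "a \<circ> r"] exI[of _ "b \<circ> r"] exI[of _ "\<lambda>n. norm (a (r n) - b (r n))"])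
       (auto simp: q_def)
  moreover have "norm v = 1"
    using LIMSEQ_unique[OF tendsto_norm[OF v(3)]] nq by simp
  moreover have "p v = 0"
  proof -
    have "norm (p (q n)) \<le> inverse (real (Suc n))" for n
    proof -
      have "norm (p (q n)) = norm (p (a n - b n)) / norm (a n - b n)"
        by (simp add: q_def linear_scale[OF bounded_linear.linear[OF p]] divide_inverse mult.commute)
      also have "\<dots> \<le> inverse (real (Suc n))"
        using ab(5)[of n] pos[of n] by (simp add: field_simps del: of_nat_Suc)
      finally show ?thesis .
    qed
    then have "(\<lambda>n. p (q n)) \<longlonglongrightarrow> 0"
      by (intro Lim_null_comparison[OF _ LIMSEQ_inverse_real_of_nat] always_eventually) auto
    from LIMSEQ_subseq_LIMSEQ[OF this v(2)] have "(\<lambda>n. p (q (r n))) \<longlonglongrightarrow> 0" by (simp add: comp_def)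
    with bounded_linear.tendsto[OF p v(3)] show ?thesis by (rule LIMSEQ_unique)
  qed
  ultimately show False using ker[of v] by simp
qed

lemma locally_compact_cball:
  fixes M :: "'a::metric_space set"
  assumes "locally_compact_space (top_of_set M)" "y \<in> M"
  obtains r where "r > 0" "\<And>s. s \<le> r \<Longrightarrow> compact (M \<inter> cball y s)"
proof -
  obtain U K where UK: "openin (top_of_set M) U" "compactin (top_of_set M) K" "y \<in> U" "U \<subseteq> K"
    using assms unfolding locally_compact_space_def by auto
  obtain d where d: "d > 0" "ball y d \<inter> M \<subseteq> U"
    using UK unfolding openin_contains_ball by blast
  have K: "compact K" "K \<subseteq> M" using UK(2) by (auto simp: compactin_subtopology)
  show ?thesis
  proof (rule that[of "d/2"])
    fix s assume "s \<le> d/2"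
    then have "M \<inter> cball y s = K \<inter> cball y s" using d UK(4) K(2) by force
    then show "compact (M \<inter> cball y s)" using K(1) by (simp add: compact_Int_closed)
  qed (use d in auto)
qed

section \<open>Orthogonal projections onto subspaces\<close>

definition orthonormal :: "'e::euclidean_space set \<Rightarrow> bool" where
  "orthonormal B \<longleftrightarrow> finite B \<and> pairwise orthogonal B \<and> (\<forall>b\<in>B. norm b = 1)"

definition proj :: "'e::euclidean_space set \<Rightarrow> 'e \<Rightarrow> 'e" where
  "proj B x = (\<Sum>b\<in>B. (x \<bullet> b) *\<^sub>R b)"

lemma bounded_linear_proj [bounded_linear]: "bounded_linear (proj B)"
  unfolding proj_def
  by (intro bounded_linear_sum bounded_linear_scaleR_const bounded_linear_inner_left)

lemma proj_in_span: "proj B x \<in> span B"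
  unfolding proj_def by (intro span_sum span_scale span_base)

lemma orthonormal_inner: "orthonormal B \<Longrightarrow> b \<in> B \<Longrightarrow> c \<in> B \<Longrightarrow> b \<bullet> c = (if b = c then 1 else 0)"
  by (auto simp: orthonormal_def pairwise_def orthogonal_def norm_eq_1)

lemma proj_inner_basis:
  assumes "orthonormal B" "b \<in> B" shows "proj B x \<bullet> b = x \<bullet> b"
proof -
  have "proj B x \<bullet> b = (\<Sum>c\<in>B. (x \<bullet> c) * (if c = b then 1 else 0))"
    unfolding proj_def inner_sum_left using assms by (intro sum.cong) (auto simp: orthonormal_inner)
  also have "\<dots> = x \<bullet> b" using assms by (simp add: orthonormal_def if_distrib[of "(*) _"] cong: if_cong)
  finally show ?thesis .
qed

lemma proj_inner:
  assumes "orthonormal B" "v \<in> span B" shows "proj B x \<bullet> v = x \<bullet> v"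
  using assms(2)
proof (induction rule: span_induct_alt)
  case (step c b v)
  then show ?case using proj_inner_basis[OF assms(1)] by (simp add: inner_add_right)
qed simp

lemma proj_span:
  assumes "orthonormal B" "v \<in> span B" shows "proj B v = v"
proof -
  have "proj B v - v \<in> span B" using assms proj_in_span by (intro span_diff)
  then have "(proj B v - v) \<bullet> (proj B v - v) = 0"
    using proj_inner[OF assms(1), of "proj B v - v" v] by (simp add: inner_diff_left)
  then show ?thesis by simp
qed

lemma norm_proj_le:
  assumes "orthonormal B" shows "norm (proj B x) \<le> norm x"
proof -
  have "(norm (proj B x))\<^sup>2 = x \<bullet> proj B x"
    using proj_inner[OF assms proj_in_span, of x x] by (simp add: power2_norm_eq_inner)
  also have "\<dots> \<le> norm x * norm (proj B x)" by (rule norm_cauchy_schwarz)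
  finally show ?thesis
    by (cases "proj B x = 0") (auto simp: power2_eq_square)
qed

lemma orthonormal_basis_obtain:
  fixes V :: "'e::euclidean_space set"
  assumes "subspace V"
  obtains B where "orthonormal B" "span B = V" "card B = dim V" "B \<subseteq> V"
proof -
  obtain B where "B \<subseteq> V" "pairwise orthogonal B" "\<And>x. x \<in> B \<Longrightarrow> norm x = 1"
     "independent B" "card B = dim V" "span B = V"
    using orthonormal_basis_subspace[OF assms] by blast
  with that[of B] show ?thesis by (auto simp: orthonormal_def independent_imp_finite)
qed

lemma compact_Int_cball_subspace:
  fixes V :: "'e::euclidean_space set"
  assumes "subspace V" shows "compact (V \<inter> cball x r)"
  using closed_subspace[OF assms] by (metis Int_commute compact_cball compact_Int_closed)

text \<open>Injectivity of the projection with a Lipschitz inverse comes from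
  \<open>pcone_lipschitz\<close>, as \<open>proj B\<close> is the identity on the cone at
  \<open>y\<close>. Surjectivity is the main point: a limit of unit normals at nearest points would
  be a unit vector of \<open>span B\<close> orthogonal to the cone that spans it.\<close>

lemma lipschitz_patch:
  fixes M :: "'e::euclidean_space set"
  assumes lc: "locally_compact_space (top_of_set M)"
    and PT: "\<And>a. a \<in> M \<Longrightarrow> pcone M a \<subseteq> tcone M a"
    and y: "y \<in> M" and lsc: "cone_lsc M UNIV y"
    and B: "orthonormal B" "span B = span (pcone M y)"
  obtains U \<rho> F C where "open U" "y \<in> U" "\<rho> > 0" "C > 0"
    "\<And>x. x \<in> span B \<inter> ball (proj B y) \<rho> \<Longrightarrow> F x \<in> M \<inter> U \<and> proj B (F x) = x"
    "\<And>z. z \<in> M \<inter> U \<Longrightarrow> proj B z \<in> ball (proj B y) \<rho> \<and> F (proj B z) = z"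
    "\<And>x x'. x \<in> span B \<inter> ball (proj B y) \<rho> \<Longrightarrow> x' \<in> span B \<inter> ball (proj B y) \<rho> \<Longrightarrow>
       norm (F x - F x') \<le> C * norm (x - x')"
proof -
  let ?p = "proj B" and ?V = "span B"
  have pd: "?p (a - b) = ?p a - ?p b" for a b
    by (rule linear_diff[OF bounded_linear.linear[OF bounded_linear_proj]])
  have PV: "pcone M y \<subseteq> ?V" using B(2) span_superset by auto
  obtain r C where r: "r > 0" "C > 0" and lip:
    "\<And>a b. a \<in> M \<Longrightarrow> b \<in> M \<Longrightarrow> dist a y < r \<Longrightarrow> dist b y < r \<Longrightarrow> norm (a - b) \<le> C * norm (?p (a - b))"
  proof (rule pcone_lipschitz[of M UNIV ?p y])
    fix v assume "v \<in> pcone M y" "?p v = 0"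
    then show "v = 0" using proj_span[OF B(1), of v] PV by auto
  qed (auto intro: bounded_linear_proj)
  obtain s0 where s0: "s0 > 0" "\<And>s. s \<le> s0 \<Longrightarrow> compact (M \<inter> cball y s)"
    using locally_compact_cball[OF lc y] by metis
  define s where "s = min s0 (r/2)"
  have s: "s > 0" "s < r" "compact (M \<inter> cball y s)" using s0 r by (auto simp: s_def)
  let ?Q = "?p ` (M \<inter> cball y s)"
  \<comment> \<open>The bound \<open>s / C\<close> later forces the preimages of points of the
    smaller ball into the open ball of radius \<open>s\<close>, where \<open>N\<close> is controlled
    on all sides.\<close>
  have "\<exists>\<rho>>0. \<rho> \<le> s / C \<and> ?V \<inter> ball (?p y) \<rho> \<subseteq> ?Q"
  proof (rule ccontr)
    assume neg: "\<not> ?thesis"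
    have "\<forall>n. \<exists>x. x \<in> ?V \<and> dist x (?p y) < inverse (real (Suc n)) \<and> x \<notin> ?Q"
    proof
      fix n
      have "min (inverse (real (Suc n))) (s / C) > 0" using s r by simp
      with neg have "\<not> ?V \<inter> ball (?p y) (min (inverse (real (Suc n))) (s / C)) \<subseteq> ?Q" by auto
      then show "\<exists>x. x \<in> ?V \<and> dist x (?p y) < inverse (real (Suc n)) \<and> x \<notin> ?Q"
        by (auto simp: dist_commute)
    qed
    then obtain x where x: "\<And>n. x n \<in> ?V" "\<And>n. dist (x n) (?p y) < inverse (real (Suc n))" "\<And>n. x n \<notin> ?Q"
      by metis
    have "y \<in> M \<inter> cball y s" using y s by simp
    moreover have "continuous_on (M \<inter> cball y s) (\<lambda>a. dist (x n) (?p a))" for n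
      by (intro continuous_intros linear_continuous_on bounded_linear_proj)
    ultimately have "\<exists>a\<in>M \<inter> cball y s. \<forall>b\<in>M \<inter> cball y s. dist (x n) (?p a) \<le> dist (x n) (?p b)" for n
      using continuous_attains_inf[OF s(3), of "\<lambda>a. dist (x n) (?p a)"] by blast
    then obtain a where a: "\<And>n. a n \<in> M" "\<And>n. a n \<in> cball y s"
       "\<And>n b. b \<in> M \<Longrightarrow> b \<in> cball y s \<Longrightarrow> dist (x n) (?p (a n)) \<le> dist (x n) (?p b)"
      by (metis IntD1 IntD2 IntI)
    have xa: "dist (x n) (?p (a n)) < inverse (real (Suc n))" for n
      using a(3)[of y n] x(2)[of n] y s by (auto simp del: of_nat_Suc)
    \<comment> \<open>Both \<open>x n\<close> and \<open>proj B (a n)\<close> are close to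
      \<open>proj B y\<close>, so the Lipschitz bound pulls the nearest points to \<open>y\<close>.
      They are eventually interior to the ball, where \<open>pcone_touch\<close> applies.\<close>
    have "dist (a n) y \<le> (2 * C) * inverse (real (Suc n))" for n
    proof -
      have "norm (a n - y) \<le> C * norm (?p (a n - y))"
        using a(1,2)[of n] y s r by (intro lip) (auto simp: dist_commute)
      also have "norm (?p (a n - y)) \<le> 2 * inverse (real (Suc n))"
        using xa[of n] x(2)[of n] dist_triangle[of "?p (a n)" "?p y" "x n"]
        by (simp add: pd dist_norm[symmetric] dist_commute)
      finally show ?thesis using r(2) by (simp add: dist_norm mult.commute mult.left_commute)
    qed
    then have alim: "a \<longlonglongrightarrow> y" by (rule tendsto_dist_le_inverse)
    define D where "D n = x n - ?p (a n)" for n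
    have D0: "D n \<noteq> 0" for n using x(3)[of n] a(1,2) by (auto simp: D_def)
    have DV: "D n \<in> ?V" for n using x(1) proj_in_span by (auto simp: D_def intro!: span_diff)
    define g where "g n = D n /\<^sub>R norm (D n)" for n
    have gV: "g n \<in> ?V" and gn: "norm (g n) = 1" for n using DV D0 by (auto simp: g_def intro: span_scale)
    have "\<forall>\<^sub>F n in sequentially. dist (a n) y < s" using alim s(1) by (rule tendstoD)
    then have gperp: "\<forall>\<^sub>F n in sequentially. \<forall>w\<in>pcone M (a n). g n \<bullet> w = 0"
    proof eventually_elim
      case (elim n)
      show ?case
      proof
        fix w assume w: "w \<in> pcone M (a n)"
        show "g n \<bullet> w = 0"
        proof (rule pcone_touch[where \<phi> = "\<lambda>w. g n \<bullet> w", OF _ PT[OF a(1)] _ _ w])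
          show "bounded_linear (\<lambda>w. g n \<bullet> w)" by (rule bounded_linear_inner_right)
          show "0 < s - dist (a n) y" using elim by simp
          fix b assume b: "b \<in> M" "dist b (a n) < s - dist (a n) y"
          have "b \<in> cball y s" using b dist_triangle[of b y "a n"] by (simp add: dist_commute)
          then have le: "norm (D n) \<le> norm (D n - ?p (b - a n))"
            using a(3)[OF b(1), of n] by (simp add: D_def dist_norm pd)
          \<comment> \<open>Expanding the square turns the minimality of the distance into a linear
            upper bound with a quadratic error. The resulting constant
            \<open>1 / (2 * norm (D n))\<close> may blow up with \<open>n\<close>, but for each
            fixed \<open>n\<close> it yields exact orthogonality.\<close>
          have "(norm (D n))\<^sup>2 \<le> (norm (D n - ?p (b - a n)))\<^sup>2"
            by (rule power_mono[OF le]) simp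
          then have "2 * (D n \<bullet> ?p (b - a n)) \<le> (norm (?p (b - a n)))\<^sup>2"
            by (simp add: power2_norm_eq_inner inner_diff_left inner_diff_right inner_commute)
          also have "\<dots> \<le> (norm (b - a n))\<^sup>2"
            by (intro power_mono norm_proj_le B) simp
          finally have "D n \<bullet> (b - a n) \<le> (norm (b - a n))\<^sup>2 / 2"
            using proj_inner[OF B(1) DV, of "b - a n"] by (simp add: inner_commute)
          moreover have "inverse N * t \<le> 1 / (2 * N) * s" if "t \<le> s / 2" "N > 0" for N t s :: real
            using that by (simp add: field_simps)
          ultimately have "inverse (norm (D n)) * (D n \<bullet> (b - a n)) \<le> 1 / (2 * norm (D n)) * (norm (b - a n))\<^sup>2"
            using D0[of n] by simp
          then show "g n \<bullet> (b - a n) \<le> 1 / (2 * norm (D n)) * (norm (b - a n))\<^sup>2"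
            by (simp only: g_def inner_scaleR_left)
        qed
      qed
    qed
    obtain l q where l: "l \<in> ?V" "strict_mono (q::nat\<Rightarrow>nat)" "(\<lambda>n. g (q n)) \<longlonglongrightarrow> l"
      by (rule compact_balls_subsequence[of ?V g 1]) (use gV gn compact_Int_cball_subspace[OF subspace_span] in auto)
    have ln: "norm l = 1"
      using LIMSEQ_unique[OF tendsto_norm[OF l(3)]] gn by simp
    have lperp: "l \<bullet> w = 0" if w: "w \<in> pcone M y" for w
    proof -
      have alq: "(\<lambda>n. a (q n)) \<longlonglongrightarrow> y" using LIMSEQ_subseq_LIMSEQ[OF alim l(2)] by (simp add: comp_def)
      obtain w' where w': "\<forall>\<^sub>F n in sequentially. w' n \<in> pcone M (a (q n)) \<inter> UNIV" "w' \<longlonglongrightarrow> w"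
        by (rule cone_lsc_selection[OF lsc _ alq, of w]) (use a(1) w in auto)
      have "\<forall>\<^sub>F n in sequentially. g (q n) \<bullet> w' n = 0"
        using w'(1) eventually_compose_filterlim[OF gperp filterlim_subseq[OF l(2)]]
        by eventually_elim auto
      then have "(\<lambda>n. g (q n) \<bullet> w' n) \<longlonglongrightarrow> 0" by (rule tendsto_eventually)
      with tendsto_inner[OF l(3) w'(2)] show ?thesis by (rule LIMSEQ_unique)
    qed
    have "l \<bullet> w = 0" if "w \<in> span (pcone M y)" for w
      using that by (induction rule: span_induct_alt) (auto simp: inner_add_right lperp)
    then have "l \<bullet> l = 0" using l(1) B(2) by auto
    with ln show False by simp
  qed
  then obtain \<rho> where \<rho>: "\<rho> > 0" "\<rho> \<le> s / C" "?V \<inter> ball (?p y) \<rho> \<subseteq> ?Q" by blast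
  define F where "F x = (SOME a. a \<in> M \<inter> cball y s \<and> ?p a = x)" for x
  have F: "F x \<in> M \<and> F x \<in> cball y s \<and> ?p (F x) = x" if "x \<in> ?V \<inter> ball (?p y) \<rho>" for x
  proof -
    have "\<exists>a. a \<in> M \<inter> cball y s \<and> ?p a = x" using that \<rho>(3) by blast
    from someI_ex[OF this] show ?thesis unfolding F_def by auto
  qed
  have Flip: "norm (F x - F x') \<le> C * norm (x - x')"
    if "x \<in> ?V \<inter> ball (?p y) \<rho>" "x' \<in> ?V \<inter> ball (?p y) \<rho>" for x x'
    using lip[of "F x" "F x'"] F[OF that(1)] F[OF that(2)] s by (simp add: pd dist_commute)
  have Fball: "F x \<in> ball y s" if "x \<in> ?V \<inter> ball (?p y) \<rho>" for x
  proof -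
    have "norm (F x - y) \<le> C * norm (?p (F x - y))"
      using F[OF that] y s r by (intro lip) (auto simp: dist_commute)
    also have "\<dots> < C * \<rho>" using F[OF that] that r(2) by (simp add: pd dist_norm norm_minus_commute)
    also have "\<dots> \<le> s" using \<rho>(2) r(2) by (simp add: field_simps)
    finally show ?thesis by (simp add: dist_norm norm_minus_commute)
  qed
  \<comment> \<open>The second factor ensures that the projection of \<open>M \<inter> U\<close>
    stays in the ball on which \<open>F\<close> is controlled.\<close>
  define U where "U = ball y s \<inter> ?p -` ball (?p y) \<rho>"
  show ?thesis
  proof (rule that[of U \<rho> C F])
    show "open U" unfolding U_def
      by (intro open_Int open_ball open_vimage linear_continuous_on bounded_linear_proj)
    show "y \<in> U" using s \<rho> by (auto simp: U_def)
    show "F x \<in> M \<inter> U \<and> proj B (F x) = x" if "x \<in> ?V \<inter> ball (?p y) \<rho>" for x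
      using F[OF that] Fball[OF that] that by (auto simp: U_def)
    show "proj B z \<in> ball (proj B y) \<rho> \<and> F (proj B z) = z" if "z \<in> M \<inter> U" for z
    proof -
      have 1: "?p z \<in> ?V \<inter> ball (?p y) \<rho>" using that proj_in_span by (auto simp: U_def)
      have "norm (z - F (?p z)) \<le> C * norm (?p (z - F (?p z)))"
        using F[OF 1] that s by (intro lip) (auto simp: U_def dist_commute)
      then show ?thesis using F[OF 1] 1 by (simp add: pd)
    qed
  qed (use \<rho> r Flip in auto)
qed

section \<open>Strict differentiability and vertical vectors\<close>

text \<open>A gradient \<open>\<eta>\<close> with \<open>\<xi> w = \<eta> \<bullet> p w\<close> on
  the cone at \<open>u x\<close> is found as a limit of gradients of quadratic penalties at nearby
  maxima. Strictness then follows because every limit of difference quotients of \<open>u\<close>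
  lies in that cone.\<close>

lemma strict_derivative_of_section:
  fixes M :: "'z::real_normed_vector set" and u :: "'e::euclidean_space \<Rightarrow> 'z" and p :: "'z \<Rightarrow> 'e"
  assumes MZ: "M \<subseteq> Z" and subZ: "subspace Z" and cZ: "\<And>r. compact (Z \<inter> cball 0 r)"
    and PT: "\<And>a. a \<in> M \<Longrightarrow> pcone M a \<subseteq> tcone M a"
    and p: "bounded_linear p" and V: "subspace V" and W: "openin (top_of_set V) W"
    and u: "\<And>x. x \<in> W \<Longrightarrow> u x \<in> M \<and> p (u x) = x" and uW: "openin (top_of_set M) (u ` W)"
    and x: "x \<in> W" and lsc: "cone_lsc M UNIV (u x)"
    and ker: "\<And>v. v \<in> pcone M (u x) \<Longrightarrow> p v = 0 \<Longrightarrow> v = 0"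
    and ucont: "continuous_on W u"
    and \<xi>: "bounded_linear \<xi>"
  obtains \<eta> where "\<eta> \<in> V"
    "\<And>e. e > 0 \<Longrightarrow> \<exists>d>0. \<forall>x'\<in>W. \<forall>x''\<in>W. dist x' x < d \<longrightarrow> dist x'' x < d \<longrightarrow>
        \<bar>\<xi> (u x' - u x'') - \<eta> \<bullet> (x' - x'')\<bar> \<le> e * norm (x' - x'')"
proof -
  have WV: "W \<subseteq> V" using W openin_imp_subset by blast
  have lin: "linear p" "linear \<xi>" using p \<xi> by (auto intro: bounded_linear.linear)
  obtain r C where r: "r > 0" "C > 0" and lipM:
    "\<And>a b. a \<in> M \<Longrightarrow> b \<in> M \<Longrightarrow> dist a (u x) < r \<Longrightarrow> dist b (u x) < r \<Longrightarrow> norm (a - b) \<le> C * norm (p (a - b))"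
    using pcone_lipschitz[OF MZ subZ cZ p ker] by metis
  obtain d1 where d1: "d1 > 0" "\<And>x'. x' \<in> W \<Longrightarrow> dist x' x < d1 \<Longrightarrow> dist (u x') (u x) < r"
    using ucont x r(1) unfolding continuous_on_iff by blast
  obtain d2 where d2: "d2 > 0" "ball x d2 \<inter> V \<subseteq> W"
    using W x unfolding openin_contains_ball by blast
  define \<delta> where "\<delta> = min d1 d2"
  have \<delta>: "\<delta> > 0" using d1 d2 by (simp add: \<delta>_def)
  have \<delta>W: "x' \<in> W" if "x' \<in> V" "dist x' x < \<delta>" for x'
    using that d2 by (auto simp: \<delta>_def dist_commute)
  have lip: "norm (u x' - u x'') \<le> C * norm (x' - x'')" if "x' \<in> W" "x'' \<in> W" "dist x' x < \<delta>" "dist x'' x < \<delta>" for x' x''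
    using lipM[of "u x'" "u x''"] u that d1(2)[of x'] d1(2)[of x''] by (auto simp: linear_diff[OF lin(1)] \<delta>_def)
  obtain L where L: "L > 0" "\<And>v. \<bar>\<xi> v\<bar> \<le> norm v * L"
    using bounded_linear.pos_bounded[OF \<xi>] by auto
  obtain P where P: "P > 0" "\<And>v. norm (p v) \<le> norm v * P"
    using bounded_linear.pos_bounded[OF p] by auto
  let ?K = "V \<inter> cball x (\<delta>/2)"
  have KW: "x' \<in> W" "dist x' x < \<delta>" if "x' \<in> ?K" for x'
    using that \<delta> by (auto intro!: \<delta>W simp: dist_commute)
  \<comment> \<open>The maximum of \<open>\<xi> \<circ> u\<close> with a penalty of growing weight.
    The penalty drives the maximisers to \<open>x\<close>, where nothing is known about
    differentiability.\<close>
  have "\<forall>n. \<exists>z. z \<in> ?K \<and> (\<forall>x'\<in>?K. \<xi> (u x') - real (Suc n) * (norm (x' - x))\<^sup>2 \<le> \<xi> (u z) - real (Suc n) * (norm (z - x))\<^sup>2)"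
  proof
    fix n
    have "compact ?K" by (rule compact_Int_cball_subspace[OF V])
    moreover have "x \<in> ?K" using x WV \<delta> by auto
    moreover have "continuous_on ?K (\<lambda>x'. \<xi> (u x') - real (Suc n) * (norm (x' - x))\<^sup>2)"
      using KW(1) by (intro continuous_intros bounded_linear.continuous_on[OF \<xi>] continuous_on_subset[OF ucont]) auto
    ultimately show "\<exists>z. z \<in> ?K \<and> (\<forall>x'\<in>?K. \<xi> (u x') - real (Suc n) * (norm (x' - x))\<^sup>2 \<le> \<xi> (u z) - real (Suc n) * (norm (z - x))\<^sup>2)"
      using continuous_attains_sup[of ?K] by blast
  qed
  then obtain z where z: "\<And>n. z n \<in> ?K"
    "\<And>n x'. x' \<in> ?K \<Longrightarrow> \<xi> (u x') - real (Suc n) * (norm (x' - x))\<^sup>2 \<le> \<xi> (u (z n)) - real (Suc n) * (norm (z n - x))\<^sup>2"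
    by metis
  \<comment> \<open>The maximum beats the value at \<open>x\<close>, and
    \<open>\<xi> \<circ> u\<close> has Lipschitz constant \<open>C * L\<close>; one factor
    \<open>norm (z n - x)\<close> cancels.\<close>
  have zb: "real (Suc n) * norm (z n - x) \<le> C * L" for n
  proof (cases "z n = x")
    case False
    have "real (Suc n) * (norm (z n - x))\<^sup>2 \<le> \<xi> (u (z n)) - \<xi> (u x)"
      using z(2)[of x n] x WV \<delta> by auto
    also have "\<dots> \<le> norm (u (z n) - u x) * L"
      using L(2)[of "u (z n) - u x"] by (simp add: linear_diff[OF lin(2)])
    also have "\<dots> \<le> (C * norm (z n - x)) * L"
      using KW[OF z(1)[of n]] x \<delta> L by (intro mult_right_mono lip) auto
    finally have "norm (z n - x) * (real (Suc n) * norm (z n - x)) \<le> norm (z n - x) * (C * L)"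
      by (simp add: power2_eq_square mult_ac)
    then show ?thesis using False by (simp del: of_nat_Suc)
  qed (use r L in simp)
  have "dist (z n) x \<le> (C * L) * inverse (real (Suc n))" for n
    using zb[of n] by (simp add: field_simps dist_norm del: of_nat_Suc)
  then have zlim: "z \<longlonglongrightarrow> x" by (rule tendsto_dist_le_inverse)
  \<comment> \<open>The gradient of the penalty at \<open>z n\<close>, bounded by the previous
    estimate.\<close>
  define h where "h n = (2 * real (Suc n)) *\<^sub>R (z n - x)" for n
  have hV: "h n \<in> V" for n using z(1) x WV V by (auto simp: h_def intro!: subspace_scale subspace_diff)
  have hb: "norm (h n) \<le> 2 * (C * L)" for n
    using zb[of n] by (simp add: h_def mult.assoc del: of_nat_Suc)
  obtain \<eta> q where \<eta>: "\<eta> \<in> V" "strict_mono (q::nat\<Rightarrow>nat)" "(\<lambda>n. h (q n)) \<longlonglongrightarrow> \<eta>"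
    by (rule compact_balls_subsequence[of V h "2 * (C * L)"]) (use hV hb compact_Int_cball_subspace[OF V] in auto)
  have touch: "\<forall>\<^sub>F n in sequentially. \<forall>w\<in>pcone M (u (z n)). \<xi> w = h n \<bullet> p w"
  proof -
    have "\<forall>\<^sub>F n in sequentially. dist (z n) x < \<delta>/2" using zlim \<delta> by (intro tendstoD) auto
    then show ?thesis
    proof eventually_elim
      case (elim n)
      have znW: "z n \<in> W" using KW z(1) by auto
      obtain d3 where d3: "d3 > 0" "ball (u (z n)) d3 \<inter> M \<subseteq> u ` W"
        using uW znW unfolding openin_contains_ball by blast
      \<comment> \<open>The first bound keeps nearby points of \<open>M\<close> on the section, the
        second keeps their projections in \<open>?K\<close>, where \<open>z n\<close> is
        maximal.\<close>
      let ?d = "min d3 ((\<delta>/2 - dist (z n) x) / P)"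
      show ?case
      proof
        fix w assume w: "w \<in> pcone M (u (z n))"
        have "\<xi> w - h n \<bullet> p w = 0"
        proof (rule pcone_touch[where \<phi> = "\<lambda>v. \<xi> v - h n \<bullet> p v", OF _ PT _ _ w])
          show "bounded_linear (\<lambda>v. \<xi> v - h n \<bullet> p v)"
            by (intro bounded_linear_sub \<xi> bounded_linear_compose[OF bounded_linear_inner_right] p)
          show "u (z n) \<in> M" using u znW by auto
          show "0 < ?d" using d3 elim P by simp
          fix b assume b: "b \<in> M" "dist b (u (z n)) < ?d"
          then have "b \<in> u ` W" using d3 by (auto simp: dist_commute)
          then obtain x' where x': "x' \<in> W" "b = u x'" by auto
          have e: "p (b - u (z n)) = x' - z n" using u x' znW by (simp add: linear_diff[OF lin(1)])
          have "norm (x' - z n) \<le> norm (b - u (z n)) * P" using P(2)[of "b - u (z n)"] e by simp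
          also have "\<dots> \<le> \<delta>/2 - dist (z n) x"
            using b P(1) by (simp add: dist_norm field_simps)
          finally have "dist x x' \<le> \<delta>/2"
            using dist_triangle[of x' x "z n"] by (simp add: dist_norm norm_minus_commute)
          then have "x' \<in> ?K" using x' WV by auto
          from z(2)[OF this, of n]
          have 1: "\<xi> (b - u (z n)) \<le> real (Suc n) * ((norm (x' - x))\<^sup>2 - (norm (z n - x))\<^sup>2)"
            by (simp add: x' linear_diff[OF lin(2)] algebra_simps)
          have 2: "(norm (x' - x))\<^sup>2 - (norm (z n - x))\<^sup>2 = 2 * ((z n - x) \<bullet> (x' - z n)) + (norm (x' - z n))\<^sup>2"
            by (simp add: power2_norm_eq_inner inner_diff_left inner_diff_right inner_commute)
          have "\<xi> (b - u (z n)) - h n \<bullet> p (b - u (z n)) \<le> real (Suc n) * (norm (x' - z n))\<^sup>2"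
            using 1 unfolding 2 e h_def by (simp add: algebra_simps)
          also have "\<dots> \<le> real (Suc n) * (norm (b - u (z n)) * P)\<^sup>2"
            using P(2)[of "b - u (z n)"] e by (intro mult_left_mono power_mono) auto
          finally show "\<xi> (b - u (z n)) - h n \<bullet> p (b - u (z n)) \<le> real (Suc n) * P\<^sup>2 * (norm (b - u (z n)))\<^sup>2"
            by (simp add: power_mult_distrib mult_ac)
        qed
        then show "\<xi> w = h n \<bullet> p w" by simp
      qed
    qed
  qed
  have eqP: "\<xi> w = \<eta> \<bullet> p w" if w: "w \<in> pcone M (u x)" for w
  proof -
    have "(\<lambda>n. u (z n)) \<longlonglongrightarrow> u x"
      using ucont x KW(1)[OF z(1)] zlim unfolding continuous_on_sequentially comp_def by blast
    then have lim: "(\<lambda>n. u (z (q n))) \<longlonglongrightarrow> u x" using LIMSEQ_subseq_LIMSEQ[OF _ \<eta>(2)] by (fastforce simp: comp_def)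
    have ev: "\<forall>\<^sub>F n in sequentially. u (z (q n)) \<in> M" using KW(1)[OF z(1)] u by (intro always_eventually) auto
    obtain w' where w': "\<forall>\<^sub>F n in sequentially. w' n \<in> pcone M (u (z (q n))) \<inter> UNIV" "w' \<longlonglongrightarrow> w"
      using cone_lsc_selection[OF lsc ev lim, of w] w by auto
    have "\<forall>\<^sub>F n in sequentially. \<xi> (w' n) - h (q n) \<bullet> p (w' n) = 0"
      using w'(1) eventually_compose_filterlim[OF touch filterlim_subseq[OF \<eta>(2)]]
      by eventually_elim auto
    then have "(\<lambda>n. \<xi> (w' n) - h (q n) \<bullet> p (w' n)) \<longlonglongrightarrow> 0" by (rule tendsto_eventually)
    moreover have "(\<lambda>n. \<xi> (w' n) - h (q n) \<bullet> p (w' n)) \<longlonglongrightarrow> \<xi> w - \<eta> \<bullet> p w"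
      by (intro tendsto_intros bounded_linear.tendsto[OF \<xi>] bounded_linear.tendsto[OF p] w'(2) \<eta>(3))
    ultimately show ?thesis using LIMSEQ_unique by fastforce
  qed
  show ?thesis
  proof (rule that[OF \<eta>(1)], rule ccontr)
    fix e :: real assume e: "e > 0"
      and neg: "\<not> (\<exists>d>0. \<forall>x'\<in>W. \<forall>x''\<in>W. dist x' x < d \<longrightarrow> dist x'' x < d \<longrightarrow>
        \<bar>\<xi> (u x' - u x'') - \<eta> \<bullet> (x' - x'')\<bar> \<le> e * norm (x' - x''))"
    have "\<forall>n. \<exists>x' x''. x' \<in> W \<and> x'' \<in> W \<and> dist x' x < min \<delta> (inverse (real (Suc n))) \<and>
        dist x'' x < min \<delta> (inverse (real (Suc n))) \<and> \<not> \<bar>\<xi> (u x' - u x'') - \<eta> \<bullet> (x' - x'')\<bar> \<le> e * norm (x' - x'')"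
    proof
      fix n
      have "min \<delta> (inverse (real (Suc n))) > 0" using \<delta> by simp
      with neg show "\<exists>x' x''. x' \<in> W \<and> x'' \<in> W \<and> dist x' x < min \<delta> (inverse (real (Suc n))) \<and>
        dist x'' x < min \<delta> (inverse (real (Suc n))) \<and> \<not> \<bar>\<xi> (u x' - u x'') - \<eta> \<bullet> (x' - x'')\<bar> \<le> e * norm (x' - x'')"
        by blast
    qed
    then obtain a b where ab: "\<And>n. a n \<in> W" "\<And>n. b n \<in> W" "\<And>n. dist (a n) x < min \<delta> (inverse (real (Suc n)))"
        "\<And>n. dist (b n) x < min \<delta> (inverse (real (Suc n)))"
        "\<And>n. \<not> \<bar>\<xi> (u (a n) - u (b n)) - \<eta> \<bullet> (a n - b n)\<bar> \<le> e * norm (a n - b n)"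
      by metis
    have lim: "a \<longlonglongrightarrow> x" "b \<longlonglongrightarrow> x"
      by (rule metric_tendsto_imp_tendsto[OF LIMSEQ_inverse_real_of_nat],
          use ab in \<open>force intro!: always_eventually less_imp_le\<close>)+
    have ulim: "(\<lambda>n. u (a n)) \<longlonglongrightarrow> u x" "(\<lambda>n. u (b n)) \<longlonglongrightarrow> u x"
      using ucont x ab(1,2) lim unfolding continuous_on_sequentially comp_def by blast+
    have ne: "a n \<noteq> b n" for n using ab(5)[of n] by (auto simp: linear_0[OF lin(2)])
    define Q where "Q n = (u (a n) - u (b n)) /\<^sub>R norm (a n - b n)" for n
    have QZ: "Q n \<in> Z" for n
      unfolding Q_def using ab u MZ subZ by (intro subspace_scale subspace_diff) auto
    have Qb: "norm (Q n) \<le> C" for n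
    proof -
      have "norm (u (a n) - u (b n)) \<le> C * norm (a n - b n)"
        using ab[of n] by (intro lip) auto
      moreover have "norm (Q n) = norm (u (a n) - u (b n)) / norm (a n - b n)"
        by (simp add: Q_def divide_inverse mult.commute)
      ultimately show ?thesis using ne[of n] by (simp add: pos_divide_le_eq)
    qed
    obtain w s where w: "w \<in> Z" "strict_mono (s::nat\<Rightarrow>nat)" "(\<lambda>n. Q (s n)) \<longlonglongrightarrow> w"
      by (rule compact_balls_subsequence[OF cZ, of Q C]) (use QZ Qb in auto)
    \<comment> \<open>Violating pairs produce bounded secants over both of whose endpoints there is
      control; their limit is a cone vector, on which \<open>\<xi>\<close> and
      \<open>\<eta> \<bullet> p\<close> agree.\<close>
    have "w \<in> pcone M (u x)"
      unfolding pcone_def using ab u ne w(3) LIMSEQ_subseq_LIMSEQ[OF ulim(1) w(2)] LIMSEQ_subseq_LIMSEQ[OF ulim(2) w(2)]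
      by (intro CollectI exI[of _ "\<lambda>n. u (a (s n))"] exI[of _ "\<lambda>n. u (b (s n))"] exI[of _ "\<lambda>n. norm (a (s n) - b (s n))"])
         (auto simp: Q_def comp_def)
    then have "\<xi> w = \<eta> \<bullet> p w" by (rule eqP)
    moreover have "e \<le> \<bar>\<xi> w - \<eta> \<bullet> p w\<bar>"
    proof (rule tendsto_lowerbound[OF _ always_eventually])
      show "(\<lambda>n. \<bar>\<xi> (Q (s n)) - \<eta> \<bullet> p (Q (s n))\<bar>) \<longlonglongrightarrow> \<bar>\<xi> w - \<eta> \<bullet> p w\<bar>"
        by (intro tendsto_intros bounded_linear.tendsto[OF \<xi>] bounded_linear.tendsto[OF p] w(3))
      show "\<forall>n. e \<le> \<bar>\<xi> (Q (s n)) - \<eta> \<bullet> p (Q (s n))\<bar>"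
      proof
        fix n
        let ?m = "s n"
        have pos: "norm (a ?m - b ?m) > 0" using ne by simp
        have "p (Q ?m) = (a ?m - b ?m) /\<^sub>R norm (a ?m - b ?m)"
          using u ab by (simp add: Q_def linear_scale[OF lin(1)] linear_diff[OF lin(1)])
        then have "\<eta> \<bullet> p (Q ?m) = (\<eta> \<bullet> (a ?m - b ?m)) / norm (a ?m - b ?m)"
          by (simp only: inner_scaleR_right divide_inverse mult.commute)
        moreover have "\<xi> (Q ?m) = \<xi> (u (a ?m) - u (b ?m)) / norm (a ?m - b ?m)"
          unfolding Q_def linear_scale[OF lin(2)] by (simp add: divide_inverse mult.commute)
        ultimately have "\<xi> (Q ?m) - \<eta> \<bullet> p (Q ?m) = (\<xi> (u (a ?m) - u (b ?m)) - \<eta> \<bullet> (a ?m - b ?m)) / norm (a ?m - b ?m)"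
          by (simp only: diff_divide_distrib)
        then have "\<bar>\<xi> (Q ?m) - \<eta> \<bullet> p (Q ?m)\<bar> = \<bar>\<xi> (u (a ?m) - u (b ?m)) - \<eta> \<bullet> (a ?m - b ?m)\<bar> / norm (a ?m - b ?m)"
          by simp
        also have "\<dots> \<ge> e" using ab(5)[of ?m] pos by (simp add: field_simps)
        finally show "e \<le> \<bar>\<xi> (Q ?m) - \<eta> \<bullet> p (Q ?m)\<bar>" .
      qed
    qed simp
    ultimately show False using e by simp
  qed
qed

text \<open>It suffices to exclude \<open>\<xi> e > 0\<close> for every \<open>\<xi>\<close>, since
  \<open>- \<xi>\<close> may be taken as well. Injectivity of \<open>p\<close> is used only towards
  the base point \<open>z0\<close>.\<close>

lemma no_vertical_vector:
  fixes M :: "'z::real_normed_vector set" and p :: "'z \<Rightarrow> 'w::real_normed_vector"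
  assumes lc: "locally_compact_space (top_of_set M)" and MZ: "M \<subseteq> Z"
    and PT: "\<And>a. a \<in> M \<Longrightarrow> pcone M a \<subseteq> tcone M a"
    and p: "bounded_linear p" and inj: "\<And>z. z \<in> M \<Longrightarrow> p z = p z0 \<Longrightarrow> z = z0"
    and z0: "z0 \<in> M" and lsc: "cone_lsc M {v. p v = 0} z0"
    and \<xi>: "bounded_linear \<xi>" and e: "e \<in> pcone M z0" "p e = 0"
  shows "\<xi> e = (0::real)"
proof -
  have nonpos: "\<xi> e \<le> 0" if \<xi>: "bounded_linear \<xi>" for \<xi> :: "'z \<Rightarrow> real"
  proof (rule ccontr)
    assume "\<not> \<xi> e \<le> 0"
    then have m: "\<xi> e > 0" by simp
    have lin: "linear p" "linear \<xi>" using p \<xi> by (auto intro: bounded_linear.linear)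
    obtain L where L: "L > 0" "\<And>v. \<bar>\<xi> v\<bar> \<le> norm v * L"
      using bounded_linear.pos_bounded[OF \<xi>] by auto
    \<comment> \<open>A vector closer than this to \<open>e\<close> still has a positive value under
      \<open>\<xi>\<close>, which is bounded by \<open>L\<close>.\<close>
    have "\<xi> e / L > 0" using m L by simp
    then obtain d where d: "d > 0" "\<And>c. c \<in> M \<Longrightarrow> dist c z0 < d \<Longrightarrow> \<exists>w\<in>pcone M c \<inter> {v. p v = 0}. dist w e < \<xi> e / L"
      using lsc e unfolding cone_lsc_def by blast
    have vert: "\<exists>w\<in>pcone M c. p w = 0 \<and> \<xi> w > 0" if c: "c \<in> M" "dist c z0 < d" for c
    proof -
      obtain w where w: "w \<in> pcone M c" "p w = 0" "dist w e < \<xi> e / L" using d(2)[OF c] by auto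
      have "\<xi> e - \<xi> w \<le> norm (e - w) * L" using L(2)[of "e - w"] by (simp add: linear_diff[OF lin(2)])
      also have "\<dots> < \<xi> e" using w(3) L(1) by (simp add: dist_norm norm_minus_commute field_simps)
      finally show ?thesis using w by auto
    qed
    obtain s0 where s0: "s0 > 0" "\<And>s. s \<le> s0 \<Longrightarrow> compact (M \<inter> cball z0 s)"
      using locally_compact_cball[OF lc z0] by metis
    define s where "s = min s0 (d/2)"
    have s: "s > 0" "s < d" "compact (M \<inter> cball z0 s)" using s0 d by (auto simp: s_def)
    let ?K = "M \<inter> cball z0 s"
    define f where "f n z = real n * norm (p (z - z0)) - \<xi> z" for n z
    have "\<forall>n. \<exists>z. z \<in> ?K \<and> (\<forall>b\<in>?K. f n z \<le> f n b)"
    proof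
      fix n
      have "continuous_on ?K (f n)"
        unfolding f_def by (intro continuous_intros bounded_linear.continuous_on[OF \<xi>] bounded_linear.continuous_on[OF p])
      moreover have "z0 \<in> ?K" using z0 s by auto
      ultimately show "\<exists>z. z \<in> ?K \<and> (\<forall>b\<in>?K. f n z \<le> f n b)"
        using continuous_attains_inf[OF s(3), of "f n"] by blast
    qed
    then obtain z where z: "\<And>n. z n \<in> ?K" "\<And>n b. b \<in> ?K \<Longrightarrow> f n (z n) \<le> f n b" by metis
    have bd: "dist (z n) z0 = s" for n
    proof (rule ccontr)
      assume "dist (z n) z0 \<noteq> s"
      then have lt: "dist (z n) z0 < s" using z(1)[of n] by (auto simp: dist_commute)
      have zM: "z n \<in> M" using z(1) by auto
      obtain w where w: "w \<in> pcone M (z n)" "p w = 0" "\<xi> w > 0"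
        using vert[OF zM] lt s by auto
      \<comment> \<open>At a minimum inside the ball the touching lemma applies with error constant
        0 to \<open>\<xi>\<close> minus a multiple of the seminorm \<open>norm (p v)\<close>. A
        vertical \<open>w\<close> does not feel the seminorm, so \<open>\<xi> w > 0\<close> is
        contradicted.\<close>
      have "\<xi> w - real n * norm (p w) \<le> 0"
      proof (rule tcone_touch[where \<phi> = "\<lambda>v. \<xi> v - real n * norm (p v)" and C = 0 and M = M and a = "z n"])
        show "continuous_on UNIV (\<lambda>v. \<xi> v - real n * norm (p v))"
          by (intro continuous_intros bounded_linear.continuous_on[OF \<xi>] bounded_linear.continuous_on[OF p])
        show "\<xi> (t *\<^sub>R v) - real n * norm (p (t *\<^sub>R v)) = t * (\<xi> v - real n * norm (p v))" if "t > 0" for t v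
          using that by (simp add: linear_scale[OF lin(1)] linear_scale[OF lin(2)] algebra_simps)
        show "0 < s - dist (z n) z0" using lt by simp
        show "w \<in> tcone M (z n)" using PT[OF zM] w by auto
        fix b assume b: "b \<in> M" "dist b (z n) < s - dist (z n) z0"
        then have "b \<in> ?K" using dist_triangle[of b z0 "z n"] by (auto simp: dist_commute)
        from z(2)[OF this, of n] have "\<xi> (b - z n) \<le> real n * (norm (p (b - z0)) - norm (p (z n - z0)))"
          by (simp add: f_def linear_diff[OF lin(2)] algebra_simps)
        also have "\<dots> \<le> real n * norm (p (b - z n))"
          using norm_triangle_ineq2[of "p (b - z0)" "p (z n - z0)"]
          by (intro mult_left_mono) (auto simp: linear_diff[OF lin(1)])
        finally show "\<xi> (b - z n) - real n * norm (p (b - z n)) \<le> 0 * (norm (b - z n))\<^sup>2" by simp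
      qed
      with w show False by simp
    qed
    obtain l r where l: "l \<in> ?K" "strict_mono (r::nat\<Rightarrow>nat)" "(z \<circ> r) \<longlonglongrightarrow> l"
      using s(3) z(1) unfolding compact_def by meson
    have dl: "dist l z0 = s"
      using LIMSEQ_unique[OF tendsto_dist[OF l(3) tendsto_const, of z0]] bd by (simp add: comp_def)
    have "norm (p (z n - z0)) * real n \<le> s * L" for n
    proof -
      have "f n (z n) \<le> f n z0" using z(2)[of z0 n] z0 s by auto
      then have "real n * norm (p (z n - z0)) \<le> \<xi> (z n - z0)"
        by (simp add: f_def linear_0[OF lin(1)] linear_diff[OF lin(2)])
      also have "\<dots> \<le> norm (z n - z0) * L" using L(2)[of "z n - z0"] by simp
      also have "norm (z n - z0) = s" using bd[of n] by (simp add: dist_norm)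
      finally show ?thesis by (simp add: mult.commute)
    qed
    \<comment> \<open>Comparison with the value 0 at the centre-based part of \<open>f\<close>
      bounds the projected distance by a multiple of \<open>1 / n\<close>; the shift of the index
      avoids \<open>n = 0\<close>. A limit of the minima then lies over \<open>p z0\<close> at
      distance \<open>s\<close> from \<open>z0\<close>.\<close>
    from this[of "Suc _"] have "dist (p (z (Suc n) - z0)) 0 \<le> (s * L) * inverse (real (Suc n))" for n
      by (simp add: field_simps del: of_nat_Suc)
    then have "(\<lambda>n. p (z (Suc n) - z0)) \<longlonglongrightarrow> 0" by (rule tendsto_dist_le_inverse)
    then have "(\<lambda>n. p (z n - z0)) \<longlonglongrightarrow> 0"
      by (rule LIMSEQ_imp_Suc)
    from LIMSEQ_subseq_LIMSEQ[OF this l(2)] have "(\<lambda>n. p (z (r n) - z0)) \<longlonglongrightarrow> 0" by (simp add: comp_def)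
    moreover have "(\<lambda>n. p (z (r n) - z0)) \<longlonglongrightarrow> p (l - z0)"
      using l(3) by (intro bounded_linear.tendsto[OF p] tendsto_intros) (simp add: comp_def)
    ultimately have "p (l - z0) = 0" by (metis LIMSEQ_unique)
    then have "l = z0" using inj[of l] l(1) by (simp add: linear_diff[OF lin(1)])
    with dl s show False by simp
  qed
  have "\<xi> e \<le> 0" by (rule nonpos[OF \<xi>])
  moreover have "- \<xi> e \<le> 0" by (rule nonpos[OF bounded_linear_minus[OF \<xi>]])
  ultimately show ?thesis by simp
qed

section \<open>Calculus of \<open>C\<^sup>k\<close> maps\<close>

lemma ck_on_SucI:
  assumes "\<And>x. x \<in> U \<Longrightarrow> (f has_derivative f' x) (at x within U)"
    "\<And>v. v \<in> E \<Longrightarrow> ck_on k E U (\<lambda>x. f' x v)"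
  shows "ck_on (Suc k) E U f"
  using assms by auto

lemma ck_on_SucE:
  assumes "ck_on (Suc k) E U f"
  obtains f' where "\<And>x. x \<in> U \<Longrightarrow> (f has_derivative f' x) (at x within U)"
    "\<And>v. v \<in> E \<Longrightarrow> ck_on k E U (\<lambda>x. f' x v)"
  using assms by auto

lemma ck_on_Suc_imp: "ck_on (Suc k) E U f \<Longrightarrow> ck_on k E U f"
proof (induction k arbitrary: f)
  case 0
  then show ?case by (auto intro: has_derivative_continuous_on)
next
  case (Suc k)
  obtain f' where f': "\<And>x. x \<in> U \<Longrightarrow> (f has_derivative f' x) (at x within U)"
    "\<And>v. v \<in> E \<Longrightarrow> ck_on (Suc k) E U (\<lambda>x. f' x v)"
    using ck_on_SucE[OF Suc.prems] by metis
  show ?case by (rule ck_on_SucI[OF f'(1) Suc.IH[OF f'(2)]])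
qed

lemma ck_on_le:
  assumes "ck_on k E U f" "j \<le> k" shows "ck_on j E U f"
  using assms(2,1) by (induction rule: inc_induct) (auto intro: ck_on_Suc_imp simp del: ck_on.simps)

lemma ck_on_subset:
  assumes "ck_on k E U f" "U' \<subseteq> U" "E' \<subseteq> E" shows "ck_on k E' U' f"
  using assms(1)
proof (induction k arbitrary: f)
  case 0
  then show ?case using assms continuous_on_subset by auto
next
  case (Suc k)
  obtain f' where f': "\<And>x. x \<in> U \<Longrightarrow> (f has_derivative f' x) (at x within U)"
    "\<And>v. v \<in> E \<Longrightarrow> ck_on k E U (\<lambda>x. f' x v)"
    using ck_on_SucE[OF Suc.prems] by metis
  show ?case
    by (rule ck_on_SucI[of _ _ f'])
       (use f' assms Suc.IH has_derivative_subset in blast)+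
qed

lemma ck_on_cong:
  assumes "ck_on k E U f" "\<And>x. x \<in> U \<Longrightarrow> f x = g x" shows "ck_on k E U g"
proof (cases k)
  case 0
  then show ?thesis using assms continuous_on_cong[of U U f g] by auto
next
  case (Suc m)
  obtain f' where f': "\<And>x. x \<in> U \<Longrightarrow> (f has_derivative f' x) (at x within U)"
    "\<And>v. v \<in> E \<Longrightarrow> ck_on m E U (\<lambda>x. f' x v)"
    using ck_on_SucE[OF assms(1)[unfolded Suc]] by metis
  show ?thesis
    unfolding Suc
    by (rule ck_on_SucI[OF _ f'(2)], rule has_derivative_transform[OF _ _ f'(1)]) (auto simp: assms(2))
qed

lemma ck_on_const: "ck_on k E U (\<lambda>_. c)"
  by (induction k arbitrary: c) (auto intro!: exI[of _ "\<lambda>_ _. 0"])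

lemma ck_on_linear:
  assumes "bounded_linear L" shows "ck_on k E U L"
proof (cases k)
  case 0
  then show ?thesis using assms by (auto intro: linear_continuous_on)
next
  case (Suc m)
  show ?thesis unfolding Suc
    by (rule ck_on_SucI[of U L "\<lambda>_. L"]) (auto intro: bounded_linear_imp_has_derivative assms ck_on_const)
qed

lemma ck_on_add:
  assumes "ck_on k E U f" "ck_on k E U g" shows "ck_on k E U (\<lambda>x. f x + g x)"
  using assms
proof (induction k arbitrary: f g)
  case 0
  then show ?case by (auto intro: continuous_on_add)
next
  case (Suc k)
  obtain f' where f': "\<And>x. x \<in> U \<Longrightarrow> (f has_derivative f' x) (at x within U)"
    "\<And>v. v \<in> E \<Longrightarrow> ck_on k E U (\<lambda>x. f' x v)"
    using ck_on_SucE[OF Suc.prems(1)] by metis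
  obtain g' where g': "\<And>x. x \<in> U \<Longrightarrow> (g has_derivative g' x) (at x within U)"
    "\<And>v. v \<in> E \<Longrightarrow> ck_on k E U (\<lambda>x. g' x v)"
    using ck_on_SucE[OF Suc.prems(2)] by metis
  show ?case
    by (rule ck_on_SucI[OF has_derivative_add[OF f'(1) g'(1)] Suc.IH[OF f'(2) g'(2)]])
qed

lemma ck_on_bounded_linear:
  assumes "bounded_linear L" "ck_on k E U f" shows "ck_on k E U (\<lambda>x. L (f x))"
  using assms(2)
proof (induction k arbitrary: f)
  case 0
  then show ?case using bounded_linear.continuous_on[OF assms(1)] by auto
next
  case (Suc k)
  obtain f' where f': "\<And>x. x \<in> U \<Longrightarrow> (f has_derivative f' x) (at x within U)"
    "\<And>v. v \<in> E \<Longrightarrow> ck_on k E U (\<lambda>x. f' x v)"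
    using ck_on_SucE[OF Suc.prems(1)] by metis
  show ?case
    by (rule ck_on_SucI[OF bounded_linear.has_derivative[OF assms(1) f'(1)] Suc.IH[OF f'(2)]])
qed

lemma ck_on_diff:
  assumes "ck_on k E U f" "ck_on k E U g" shows "ck_on k E U (\<lambda>x. f x - g x)"
  using ck_on_add[OF assms(1) ck_on_bounded_linear[OF bounded_linear_minus[OF bounded_linear_ident] assms(2)]] by simp

lemma ck_on_sum:
  assumes "\<And>i. i \<in> I \<Longrightarrow> ck_on k E U (f i)" shows "ck_on k E U (\<lambda>x. \<Sum>i\<in>I. f i x)"
  using assms by (induction I rule: infinite_finite_induct) (auto intro: ck_on_add ck_on_const)

lemma ck_on_scaleR:
  fixes f :: "'e::euclidean_space \<Rightarrow> real"
  assumes "ck_on k E U f" "ck_on k E U g" shows "ck_on k E U (\<lambda>x. f x *\<^sub>R g x)"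
  using assms
proof (induction k arbitrary: f g)
  case 0
  then show ?case by (auto intro: continuous_on_scaleR)
next
  case (Suc k)
  obtain f' where f': "\<And>x. x \<in> U \<Longrightarrow> (f has_derivative f' x) (at x within U)"
    "\<And>v. v \<in> E \<Longrightarrow> ck_on k E U (\<lambda>x. f' x v)"
    using ck_on_SucE[OF Suc.prems(1)] by metis
  obtain g' where g': "\<And>x. x \<in> U \<Longrightarrow> (g has_derivative g' x) (at x within U)"
    "\<And>v. v \<in> E \<Longrightarrow> ck_on k E U (\<lambda>x. g' x v)"
    using ck_on_SucE[OF Suc.prems(2)] by metis
  have fg: "ck_on k E U f" "ck_on k E U g" using Suc.prems by (auto intro: ck_on_Suc_imp simp del: ck_on.simps)
  show ?case
    by (rule ck_on_SucI[OF has_derivative_scaleR[OF f'(1) g'(1)]])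
       (auto intro!: ck_on_add Suc.IH fg f' g')
qed

lemma linear_Basis_expand:
  fixes v :: "'e::euclidean_space"
  assumes "linear L" shows "L v = (\<Sum>b\<in>Basis. (v \<bullet> b) *\<^sub>R L b)"
  by (subst euclidean_representation[of v, symmetric])
     (simp add: linear_sum[OF assms] linear_scale[OF assms])

lemma ck_on_compose:
  fixes f :: "'e::euclidean_space \<Rightarrow> 'd::euclidean_space" and g :: "'d \<Rightarrow> 'f::real_normed_vector"
  assumes "ck_on k UNIV V g" "ck_on k UNIV U f" "f ` U \<subseteq> V"
  shows "ck_on k UNIV U (\<lambda>x. g (f x))"
  using assms
proof (induction k arbitrary: g)
  case 0
  then show ?case using continuous_on_compose2 by auto
next
  case (Suc k)
  obtain g' where g': "\<And>x. x \<in> V \<Longrightarrow> (g has_derivative g' x) (at x within V)"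
    "\<And>v. ck_on k UNIV V (\<lambda>x. g' x v)"
    using ck_on_SucE[OF Suc.prems(1)] by (metis UNIV_I)
  obtain f' where f': "\<And>x. x \<in> U \<Longrightarrow> (f has_derivative f' x) (at x within U)"
    "\<And>v. ck_on k UNIV U (\<lambda>x. f' x v)"
    using ck_on_SucE[OF Suc.prems(2)] by (metis UNIV_I)
  have fk: "ck_on k UNIV U f" using Suc.prems(2) by (rule ck_on_Suc_imp)
  show ?case
  proof (rule ck_on_SucI[of _ _ "\<lambda>x v. g' (f x) (f' x v)"])
    fix x assume x: "x \<in> U"
    have "(g has_derivative g' (f x)) (at (f x) within f ` U)"
      by (rule has_derivative_subset[OF g'(1)]) (use x assms(3) in auto)
    then show "((\<lambda>x. g (f x)) has_derivative (\<lambda>v. g' (f x) (f' x v))) (at x within U)"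
      using diff_chain_within[OF f'(1)[OF x]] by (simp add: comp_def)
  next
    fix v :: 'e
    have "ck_on k UNIV U (\<lambda>x. \<Sum>b\<in>Basis. (f' x v \<bullet> b) *\<^sub>R g' (f x) b)"
      by (intro ck_on_sum ck_on_scaleR ck_on_bounded_linear[OF bounded_linear_inner_left] f' Suc.IH g' fk assms(3))
    then show "ck_on k UNIV U (\<lambda>x. g' (f x) (f' x v))"
    proof (rule ck_on_cong)
      fix x assume "x \<in> U"
      then have "linear (g' (f x))" using g'(1) assms(3) has_derivative_linear by blast
      from linear_Basis_expand[OF this] show "(\<Sum>b\<in>Basis. (f' x v \<bullet> b) *\<^sub>R g' (f x) b) = g' (f x) (f' x v)"
        by metis
    qed
  qed
qed

text \<open>Precomposition with the projection turns functions on open subsets of \<open>E\<close>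
  into functions on open subsets of the whole space, where derivatives are unique and compositions
  need no bookkeeping of \<open>E\<close>.\<close>

lemma ck_on_extend:
  fixes f :: "'e::euclidean_space \<Rightarrow> 'f::real_normed_vector"
  assumes B: "orthonormal B" "span B = E" and "ck_on k E U f"
  shows "ck_on k UNIV (proj B -` U) (\<lambda>x. f (proj B x))"
  using assms(3)
proof (induction k arbitrary: f)
  case 0
  have "continuous_on (proj B -` U) (proj B)" by (intro linear_continuous_on bounded_linear_proj)
  then show ?case using 0 continuous_on_compose2[of U f "proj B -` U" "proj B"] by auto
next
  case (Suc k)
  obtain f' where f': "\<And>x. x \<in> U \<Longrightarrow> (f has_derivative f' x) (at x within U)"
    "\<And>v. v \<in> E \<Longrightarrow> ck_on k E U (\<lambda>x. f' x v)"
    using ck_on_SucE[OF Suc.prems(1)] by metis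
  show ?case
  proof (rule ck_on_SucI[of _ _ "\<lambda>x v. f' (proj B x) (proj B v)"])
    fix x assume x: "x \<in> proj B -` U"
    have 1: "(proj B has_derivative proj B) (at x within proj B -` U)"
      by (rule bounded_linear_imp_has_derivative[OF bounded_linear_proj])
    have 2: "(f has_derivative f' (proj B x)) (at (proj B x) within proj B ` (proj B -` U))"
      by (rule has_derivative_subset[OF f'(1)]) (use x in auto)
    show "((\<lambda>x. f (proj B x)) has_derivative (\<lambda>v. f' (proj B x) (proj B v))) (at x within proj B -` U)"
      using diff_chain_within[OF 1 2] by (simp add: comp_def)
  next
    fix v :: 'e
    show "ck_on k UNIV (proj B -` U) (\<lambda>x. f' (proj B x) (proj B v))"
      by (rule Suc.IH[OF f'(2)]) (use B proj_in_span in blast)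
  qed
qed

lemma ck_on_imp_continuous_on: "ck_on k E U f \<Longrightarrow> continuous_on U f"
  using ck_on_le[of k E U f 0] by simp

text \<open>The mean value inequality for \<open>H - H' c\<close> on a small ball. Continuity is
  given one vector at a time, and finite dimension makes it uniform in the operator norm.\<close>

lemma strict_derivative_if_C1:
  fixes H :: "'e::euclidean_space \<Rightarrow> 'f::real_normed_vector"
  assumes "open U" and H': "\<And>x. x \<in> U \<Longrightarrow> (H has_derivative H' x) (at x within U)"
    and cont: "\<And>v. continuous_on U (\<lambda>x. H' x v)" and c: "c \<in> U" and e: "e > 0"
  obtains d where "d > 0" "ball c d \<subseteq> U"
    "\<And>x y z. x \<in> ball c d \<Longrightarrow> y \<in> ball c d \<Longrightarrow> z \<in> ball c d \<Longrightarrow> norm (H x - H y - H' z (x - y)) \<le> e * norm (x - y)"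
proof -
  \<comment> \<open>Summing over the basis gives \<open>e / 2\<close> for the operator norm; the
    other \<open>e / 2\<close> pays for replacing \<open>H' c\<close> by
    \<open>H' z\<close>.\<close>
  define e' where "e' = e / (2 * real DIM('e))"
  have e': "e' > 0" using e by (simp add: e'_def)
  obtain d0 where d0: "d0 > 0" "ball c d0 \<subseteq> U" using \<open>open U\<close> c openE by blast
  have "\<exists>d>0. \<forall>x\<in>U. dist x c < d \<longrightarrow> dist (H' x b) (H' c b) < e'" for b
    using cont[of b] c e' unfolding continuous_on_iff by blast
  then obtain r where r: "\<And>b. r b > 0" "\<And>b x. x \<in> U \<Longrightarrow> dist x c < r b \<Longrightarrow> dist (H' x b) (H' c b) < e'"
    by metis
  define d where "d = min d0 (Min (r ` Basis))"
  have d: "d > 0" using r(1) d0 by (auto simp: d_def)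
  have dU: "ball c d \<subseteq> U" using d0 by (auto simp: d_def)
  have dr: "d \<le> r b" if "b \<in> Basis" for b using that by (auto simp: d_def min.coboundedI2)
  have lin: "linear (H' x)" if "x \<in> U" for x using H'[OF that] by (rule has_derivative_linear)
  have bd: "norm (H' x v - H' c v) \<le> (e/2) * norm v" if x: "x \<in> ball c d" for x v
  proof -
    have xU: "x \<in> U" using x dU by auto
    have "H' x v - H' c v = (\<Sum>b\<in>Basis. (v \<bullet> b) *\<^sub>R (H' x b - H' c b))"
      unfolding linear_Basis_expand[OF lin[OF xU], of v] linear_Basis_expand[OF lin[OF c], of v]
      by (simp add: sum_subtractf scaleR_diff_right)
    also have "norm \<dots> \<le> (\<Sum>b\<in>(Basis::'e set). norm v * e')"
    proof (rule sum_norm_le)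
      fix b :: 'e assume b: "b \<in> Basis"
      have "norm (H' x b - H' c b) \<le> e'"
        using r(2)[OF xU, of b] dr[OF b] x by (auto simp: dist_norm norm_minus_commute[of c x])
      then show "norm ((v \<bullet> b) *\<^sub>R (H' x b - H' c b)) \<le> norm v * e'"
        using Basis_le_norm[OF b, of v] by (auto intro!: mult_mono)
    qed
    also have "\<dots> = (e/2) * norm v" by (simp add: e'_def)
    finally show ?thesis .
  qed
  show ?thesis
  proof (rule that[OF d dU])
    fix x y z assume xyz: "x \<in> ball c d" "y \<in> ball c d" "z \<in> ball c d"
    have blc: "bounded_linear (H' c)" using H'[OF c] by (rule has_derivative_bounded_linear)
    have "norm ((H x - H' c x) - (H y - H' c y)) \<le> (e/2) * norm (x - y)"
    proof (rule differentiable_bound[where f = "\<lambda>x. H x - H' c x" and f' = "\<lambda>x v. H' x v - H' c v" and S = "ball c d"])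
      fix w assume w: "w \<in> ball c d"
      show "((\<lambda>x. H x - H' c x) has_derivative (\<lambda>v. H' w v - H' c v)) (at w within ball c d)"
        by (intro has_derivative_diff has_derivative_subset[OF H' dU] bounded_linear_imp_has_derivative[OF blc])
           (use w dU in auto)
      show "onorm (\<lambda>v. H' w v - H' c v) \<le> e/2"
        by (rule onorm_bound) (use e bd[OF w] in auto)
    qed (use xyz in auto)
    then have 1: "norm (H x - H y - H' c (x - y)) \<le> (e/2) * norm (x - y)"
      by (simp add: linear_diff[OF lin[OF c]] algebra_simps)
    have "norm (H x - H y - H' z (x - y)) \<le> norm (H x - H y - H' c (x - y)) + norm (H' z (x - y) - H' c (x - y))"
      using norm_triangle_ineq4[of "H x - H y - H' c (x - y)" "H' z (x - y) - H' c (x - y)"] by simp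
    also have "\<dots> \<le> (e/2) * norm (x - y) + (e/2) * norm (x - y)"
      by (intro add_mono 1 bd xyz)
    finally show "norm (H x - H y - H' z (x - y)) \<le> e * norm (x - y)" by simp
  qed
qed

text \<open>The derivative is corrected by a rank one operator that makes the secant identity exact.
  Its norm is at most the remainder divided by the distance, which tends to 0 at the diagonal by
  strict differentiability.\<close>

lemma C1_secant_map:
  fixes H :: "'e::euclidean_space \<Rightarrow> 'f::real_normed_vector"
  assumes "open U" "ck_on (Suc k) UNIV U H"
  obtains A where "secant_map H A U"
proof -
  obtain H' where H': "\<And>x. x \<in> U \<Longrightarrow> (H has_derivative H' x) (at x within U)"
    and "\<And>v. ck_on k UNIV U (\<lambda>x. H' x v)"
    using ck_on_SucE[OF assms(2)] by (metis UNIV_I)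
  then have cont: "\<And>v. continuous_on U (\<lambda>x. H' x v)" by (blast intro: ck_on_imp_continuous_on)
  \<comment> \<open>\<open>secant_map\<close> asks for linear operators at all arguments, hence the
    value 0 outside \<open>U\<close>.\<close>
  define K where "K x = (if x \<in> U then H' x else (\<lambda>_. 0))" for x
  have linK: "linear (K x)" for x
    using H'[THEN has_derivative_linear] by (auto simp: K_def linear_iff)
  \<comment> \<open>On the diagonal the quotient is \<open>0 / 0 = 0\<close>, so that
    \<open>A b b\<close> is the derivative \<open>K b\<close>.\<close>
  define A where "A a b v = K b v + (((a - b) \<bullet> v) / (norm (a - b))\<^sup>2) *\<^sub>R (H a - H b - K b (a - b))" for a b v
  have "secant_map H A U"
    unfolding secant_map_def
  proof (intro conjI allI ballI impI)
    show "linear (A x y)" for x y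
      unfolding A_def
      by (intro linear_compose_add linK linear_compose_scale_right linearI)
         (auto simp: inner_add_right add_divide_distrib scaleR_add_left)
    show "H x - H y = A x y (x - y)" if "x \<in> U" "y \<in> U" for x y
      by (cases "x = y") (auto simp: A_def power2_norm_eq_inner linear_0[OF linK])
    fix c X Y V v
    assume c: "c \<in> U" and XY: "\<forall>n. X n \<in> U \<and> Y n \<in> U" "X \<longlonglongrightarrow> c" "Y \<longlonglongrightarrow> c" "V \<longlonglongrightarrow> (v::'e)"
    have "(\<lambda>n. \<Sum>b\<in>Basis. (V n \<bullet> b) *\<^sub>R K (Y n) b) \<longlonglongrightarrow> (\<Sum>b\<in>Basis. (v \<bullet> b) *\<^sub>R K c b)"
    proof (intro tendsto_intros XY)
      fix b :: 'e
      have "(\<lambda>n. H' (Y n) b) \<longlonglongrightarrow> H' c b"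
        using cont[of b] c XY unfolding continuous_on_sequentially comp_def by blast
      then show "(\<lambda>n. K (Y n) b) \<longlonglongrightarrow> K c b" using c XY by (simp add: K_def)
    qed
    then have 1: "(\<lambda>n. K (Y n) (V n)) \<longlonglongrightarrow> K c v"
      by (simp add: linear_Basis_expand[OF linK, symmetric])
    have 2: "(\<lambda>n. (((X n - Y n) \<bullet> V n) / (norm (X n - Y n))\<^sup>2) *\<^sub>R (H (X n) - H (Y n) - K (Y n) (X n - Y n))) \<longlonglongrightarrow> 0"
    proof (rule tendstoI)
      fix e :: real assume e: "e > 0"
      define M where "M = norm v + 1"
      have M: "M > 0" by (simp add: M_def add_nonneg_pos)
      have "e / (2 * M) > 0" using e M by simp
      then obtain d where d: "d > 0" "ball c d \<subseteq> U"
        "\<And>x y z. x \<in> ball c d \<Longrightarrow> y \<in> ball c d \<Longrightarrow> z \<in> ball c d \<Longrightarrow> norm (H x - H y - H' z (x - y)) \<le> e / (2 * M) * norm (x - y)"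
        using strict_derivative_if_C1[OF assms(1) H' cont c] by metis
      have "\<forall>\<^sub>F n in sequentially. norm (V n) < M"
        using tendsto_norm[OF XY(4)] by (rule order_tendstoD) (simp add: M_def)
      with tendstoD[OF XY(2) d(1)] tendstoD[OF XY(3) d(1)]
      show "\<forall>\<^sub>F n in sequentially. dist ((((X n - Y n) \<bullet> V n) / (norm (X n - Y n))\<^sup>2) *\<^sub>R (H (X n) - H (Y n) - K (Y n) (X n - Y n))) 0 < e"
      proof eventually_elim
        case (elim n)
        let ?D = "norm (X n - Y n)"
        have R: "norm (H (X n) - H (Y n) - K (Y n) (X n - Y n)) \<le> e / (2 * M) * ?D"
          using d(3)[of "X n" "Y n" "Y n"] elim XY(1) by (auto simp: K_def dist_commute)
        show ?case
        proof (cases "X n = Y n")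
          case False
          then have D: "?D > 0" by simp
          have "\<bar>(X n - Y n) \<bullet> V n\<bar> \<le> ?D * M"
            using Cauchy_Schwarz_ineq2[of "X n - Y n" "V n"] elim(3) D
            by (meson dual_order.trans less_imp_le mult_left_mono norm_ge_zero)
          then have "\<bar>(X n - Y n) \<bullet> V n\<bar> * norm (H (X n) - H (Y n) - K (Y n) (X n - Y n)) \<le> (?D * M) * (e / (2 * M) * ?D)"
            using R M by (intro mult_mono) auto
          also have "\<dots> = (e / 2) * ?D\<^sup>2" using M by (simp add: power2_eq_square)
          finally have "\<bar>(X n - Y n) \<bullet> V n\<bar> * norm (H (X n) - H (Y n) - K (Y n) (X n - Y n)) / ?D\<^sup>2 \<le> e / 2"
            using D by (simp add: pos_divide_le_eq)
          also have "\<dots> < e" using e by simp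
          finally show ?thesis by (simp add: abs_divide)
        qed (use e in simp)
      qed
    qed
    show "(\<lambda>n. A (X n) (Y n) (V n)) \<longlonglongrightarrow> A c c v"
      using tendsto_add[OF 1 2] by (simp add: A_def)
  qed
  then show ?thesis by (rule that)
qed

section \<open>Functions depending smoothly on jets\<close>

text \<open>This is total differentiability, with a derivative that vanishes on the orthogonal
  complement of \<open>span B\<close> when \<open>B\<close> is orthonormal, as befits functions that
  factor through \<open>proj B\<close>.\<close>

definition has_partials :: "'e::euclidean_space set \<Rightarrow> 'e set \<Rightarrow> ('e \<Rightarrow> 'f::real_normed_vector) \<Rightarrow> ('e \<Rightarrow> 'e \<Rightarrow> 'f) \<Rightarrow> bool" where
  "has_partials B S w w' \<longleftrightarrow> (\<forall>x\<in>S. (w has_derivative (\<lambda>v. \<Sum>b\<in>B. (v \<bullet> b) *\<^sub>R w' b x)) (at x))"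

text \<open>\<open>J [b\<^sub>1, \<dots>, b\<^sub>i]\<close> is the iterated partial derivative of \<open>J []\<close> in the directions
  \<open>b\<^sub>i, \<dots>, b\<^sub>1\<close>. Functions on an open subset of the subspace \<open>span B\<close> are represented by
  functions on its preimage under the orthogonal projection which factor through the projection.\<close>

definition jet_family :: "'e::euclidean_space set \<Rightarrow> 'e set \<Rightarrow> ('e list \<Rightarrow> 'e \<Rightarrow> 'e) \<Rightarrow> nat \<Rightarrow> bool" where
  "jet_family B W J j \<longleftrightarrow>
     (\<forall>l\<in>lists B. length l \<le> j \<longrightarrow> continuous_on W (J l) \<and> (\<forall>x\<in>W. J l x = J l (proj B x))) \<and>
     (\<forall>l\<in>lists B. length l < j \<longrightarrow> has_partials B W (J l) (\<lambda>b. J (b # l)))"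

text \<open>The functions \<open>tame B J S i s\<close> are expressions in jets of order at most \<open>i\<close> and \<open>C\<^sup>s\<close> functions
  of \<open>J []\<close>, so that a partial derivative raises \<open>i\<close> and lowers \<open>s\<close> by one. Rule \<open>inv\<close> admits the
  entries of the inverse \<open>C\<close> of a matrix \<open>A\<close> of tame functions.\<close>

inductive tame :: "'e::euclidean_space set \<Rightarrow> ('e list \<Rightarrow> 'e \<Rightarrow> 'e) \<Rightarrow> 'e set \<Rightarrow> nat \<Rightarrow> nat \<Rightarrow> ('e \<Rightarrow> real) \<Rightarrow> bool"
  for B J S where
  comp: "ck_on s UNIV U \<Phi> \<Longrightarrow> open U \<Longrightarrow> J [] ` S \<subseteq> U \<Longrightarrow> tame B J S i s (\<lambda>x. \<Phi> (J [] x))"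
| jet: "l \<in> lists B \<Longrightarrow> length l \<le> i \<Longrightarrow> c \<in> Basis \<Longrightarrow> tame B J S i s (\<lambda>x. J l x \<bullet> c)"
| add: "tame B J S i s f \<Longrightarrow> tame B J S i s g \<Longrightarrow> tame B J S i s (\<lambda>x. f x + g x)"
| mult: "tame B J S i s f \<Longrightarrow> tame B J S i s g \<Longrightarrow> tame B J S i s (\<lambda>x. f x * g x)"
| inv: "(\<And>a b. a \<in> B \<Longrightarrow> b \<in> B \<Longrightarrow> tame B J S i s (A a b)) \<Longrightarrow>
    (\<And>a b. a \<in> B \<Longrightarrow> b \<in> B \<Longrightarrow> continuous_on S (C a b)) \<Longrightarrow>
    (\<And>x a b. x \<in> S \<Longrightarrow> a \<in> B \<Longrightarrow> b \<in> B \<Longrightarrow> (\<Sum>c\<in>B. A a c x * C c b x) = (if a = b then 1 else 0)) \<Longrightarrow>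
    (\<And>x a b. x \<in> S \<Longrightarrow> a \<in> B \<Longrightarrow> b \<in> B \<Longrightarrow> (\<Sum>c\<in>B. C a c x * A c b x) = (if a = b then 1 else 0)) \<Longrightarrow>
    p \<in> B \<Longrightarrow> q \<in> B \<Longrightarrow> tame B J S i s (C p q)"
| cong: "tame B J S i s f \<Longrightarrow> (\<And>x. x \<in> S \<Longrightarrow> g x = f x) \<Longrightarrow> tame B J S i s g"

lemma tame_mono:
  assumes "tame B J S i s w" "i \<le> i'" "s' \<le> s"
  shows "tame B J S i' s' w"
  using assms
proof (induction arbitrary: i' s' rule: tame.induct)
  case (comp s U \<Phi> i)
  show ?case by (rule tame.comp[where U = U and \<Phi> = \<Phi>]) (use comp ck_on_le in blast)+
next
  case (jet l i c s)
  then show ?case by (intro tame.jet) auto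
next
  case (inv i s A C p q)
  show ?case by (rule tame.inv[where A = A]) (use inv.IH inv.hyps inv.prems in auto)
qed (auto intro: tame.add tame.mult tame.cong)

lemma tame_const: "tame B J S i s (\<lambda>_. r)"
  using tame.comp[OF ck_on_const open_UNIV subset_UNIV] by metis

lemma tame_sum:
  assumes "\<And>k. k \<in> K \<Longrightarrow> tame B J S i s (f k)" shows "tame B J S i s (\<lambda>x. \<Sum>k\<in>K. f k x)"
  using assms by (induction K rule: infinite_finite_induct) (auto intro: tame.add tame_const)

lemma tame_uminus: "tame B J S i s f \<Longrightarrow> tame B J S i s (\<lambda>x. - f x)"
  using tame.mult[OF tame_const[of B J S i s "-1"], of f] by simp

lemma jet_family_continuous_on:
  "jet_family B W J j \<Longrightarrow> l \<in> lists B \<Longrightarrow> length l \<le> j \<Longrightarrow> S \<subseteq> W \<Longrightarrow> continuous_on S (J l)"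
  unfolding jet_family_def using continuous_on_subset by blast

lemma jet_family_has_derivative:
  "jet_family B W J j \<Longrightarrow> l \<in> lists B \<Longrightarrow> length l < j \<Longrightarrow> x \<in> W \<Longrightarrow>
    (J l has_derivative (\<lambda>v. \<Sum>b\<in>B. (v \<bullet> b) *\<^sub>R J (b # l) x)) (at x)"
  unfolding jet_family_def has_partials_def by blast

lemma tame_continuous_on:
  assumes "tame B J S i s w" "jet_family B W J j" "i \<le> j" "S \<subseteq> W"
  shows "continuous_on S w"
  using assms
proof (induction rule: tame.induct)
  case (comp s U \<Phi> i)
  have "continuous_on S (J [])" using comp(4,6) by (auto intro: jet_family_continuous_on)
  then show ?case using continuous_on_compose2[OF ck_on_imp_continuous_on[OF comp(1)] _ comp(3)] by blast
next
  case (jet l i c s)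
  then have "continuous_on S (J l)" by (auto intro: jet_family_continuous_on)
  then show ?case by (intro continuous_intros)
next
  case (cong i s f g)
  then show ?case using continuous_on_cong[of S S g f] by auto
qed (auto intro: continuous_intros)

text \<open>The factor \<open>f y - f x\<close> is of first order, so replacing \<open>c y\<close>
  by \<open>c x\<close> costs only a term of higher order. No differentiability of \<open>c\<close>
  is required.\<close>

lemma has_derivative_mult_vanishing:
  fixes f c :: "'e::real_normed_vector \<Rightarrow> real"
  assumes c: "isCont c x" and f: "(f has_derivative f') (at x)"
  shows "((\<lambda>y. c y * (f y - f x)) has_derivative (\<lambda>v. c x * f' v)) (at x)"
proof -
  have blf: "bounded_linear f'" using f by (rule has_derivative_bounded_linear)
  obtain K where K: "K > 0" "\<And>v. norm (f' v) \<le> norm v * K"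
    using bounded_linear.pos_bounded[OF blf] by blast
  obtain d1 where d1: "d1 > 0" "\<And>y. norm (y - x) < d1 \<Longrightarrow> norm (f y - f x - f' (y - x)) \<le> 1 * norm (y - x)"
    using f unfolding has_derivative_at_alt by (metis zero_less_one)
  have g: "((\<lambda>y. (c y - c x) * (f y - f x)) has_derivative (\<lambda>v. 0)) (at x)"
    unfolding has_derivative_at_alt
  proof (intro conjI allI impI)
    fix e :: real assume e: "e > 0"
    have "e / (1 + K) > 0" using e K by simp
    then obtain d2 where d2: "d2 > 0" "\<And>y. dist y x < d2 \<Longrightarrow> dist (c y) (c x) < e / (1 + K)"
      using c unfolding continuous_at_eps_delta by blast
    show "\<exists>d>0. \<forall>y. norm (y - x) < d \<longrightarrow> norm ((c y - c x) * (f y - f x) - (c x - c x) * (f x - f x) - 0) \<le> e * norm (y - x)"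
    proof (intro exI[of _ "min d1 d2"] conjI allI impI)
      fix y assume y: "norm (y - x) < min d1 d2"
      have "norm (f y - f x) \<le> norm (f y - f x - f' (y - x)) + norm (f' (y - x))"
        using norm_triangle_ineq[of "f y - f x - f' (y - x)" "f' (y - x)"] by simp
      also have "\<dots> \<le> (1 + K) * norm (y - x)"
        using d1(2)[of y] K(2)[of "y - x"] y by (simp add: algebra_simps)
      finally have 1: "norm (f y - f x) \<le> (1 + K) * norm (y - x)" .
      have "norm (c y - c x) \<le> e / (1 + K)" using d2(2)[of y] y by (simp add: dist_norm less_imp_le)
      then have "norm ((c y - c x) * (f y - f x)) \<le> e / (1 + K) * ((1 + K) * norm (y - x))"
        unfolding norm_mult using 1 e K by (intro mult_mono) auto
      then show "norm ((c y - c x) * (f y - f x) - (c x - c x) * (f x - f x) - 0) \<le> e * norm (y - x)"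
        using K by simp
    qed (use d1 d2 in simp)
  qed simp
  have "((\<lambda>y. c x * (f y - f x)) has_derivative (\<lambda>v. c x * f' v)) (at x)"
    using f by (auto intro!: derivative_eq_intros)
  from has_derivative_add[OF this g] show ?thesis by (simp add: algebra_simps)
qed

text \<open>The resolvent identity, from a left inverse \<open>C\<close> of \<open>A\<close> and a
  right inverse \<open>C'\<close> of \<open>A'\<close>.\<close>

lemma matrix_inverse_diff:
  fixes A A' C C' :: "'i \<Rightarrow> 'i \<Rightarrow> 'a::comm_ring_1"
  assumes "finite B" and p: "p \<in> B" and q: "q \<in> B"
    and "\<And>a b. a \<in> B \<Longrightarrow> b \<in> B \<Longrightarrow> (\<Sum>c\<in>B. C a c * A c b) = (if a = b then 1 else 0)"
    and "\<And>a b. a \<in> B \<Longrightarrow> b \<in> B \<Longrightarrow> (\<Sum>c\<in>B. A' a c * C' c b) = (if a = b then 1 else 0)"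
  shows "C p q - C' p q = - (\<Sum>c\<in>B. \<Sum>e\<in>B. C p c * (A c e - A' c e) * C' e q)"
proof -
  have "(\<Sum>c\<in>B. \<Sum>e\<in>B. C p c * A c e * C' e q) = (\<Sum>e\<in>B. (\<Sum>c\<in>B. C p c * A c e) * C' e q)"
    by (subst sum.swap) (simp add: sum_distrib_right)
  also have "\<dots> = (\<Sum>e\<in>B. if p = e then C' e q else 0)"
    using assms(4)[OF p] by (intro sum.cong) auto
  also have "\<dots> = C' p q" using assms(1) p by simp
  finally have 1: "(\<Sum>c\<in>B. \<Sum>e\<in>B. C p c * A c e * C' e q) = C' p q" .
  have "(\<Sum>c\<in>B. \<Sum>e\<in>B. C p c * A' c e * C' e q) = (\<Sum>c\<in>B. C p c * (\<Sum>e\<in>B. A' c e * C' e q))"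
    by (simp add: sum_distrib_left mult.assoc)
  also have "\<dots> = (\<Sum>c\<in>B. if c = q then C p c else 0)"
    using assms(5)[OF _ q] by (intro sum.cong) auto
  also have "\<dots> = C p q" using assms(1) q by simp
  finally have 2: "(\<Sum>c\<in>B. \<Sum>e\<in>B. C p c * A' c e * C' e q) = C p q" .
  have "(\<Sum>c\<in>B. \<Sum>e\<in>B. C p c * (A c e - A' c e) * C' e q) = C' p q - C p q"
    unfolding 1[symmetric] 2[symmetric] by (simp add: algebra_simps sum_subtractf)
  then show ?thesis by simp
qed

text \<open>Induction over the expressions. For inverse matrices only continuity is known in
  advance; the resolvent identity bootstraps it to differentiability.\<close>

lemma tame_has_partials:
  assumes "tame B J S i s w" and jet: "jet_family B W J j" and B: "finite B" and S: "open S" "S \<subseteq> W"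
    and "s = Suc r" "i < j"
  shows "\<exists>w'. has_partials B S w w' \<and> (\<forall>b\<in>B. tame B J S (Suc i) r (w' b))"
  using assms(1,6,7)
proof (induction rule: tame.induct)
  case (comp s U \<Phi> i)
  obtain \<Phi>' where \<Phi>': "\<And>x. x \<in> U \<Longrightarrow> (\<Phi> has_derivative \<Phi>' x) (at x within U)"
    "\<And>v. ck_on r UNIV U (\<lambda>x. \<Phi>' x v)"
    using ck_on_SucE[OF comp(1)[unfolded comp(4)]] by (metis UNIV_I)
  define w' where "w' b x = (\<Sum>c\<in>Basis. (J [b] x \<bullet> c) * \<Phi>' (J [] x) c)" for b x
  have "has_partials B S (\<lambda>x. \<Phi> (J [] x)) w'"
    unfolding has_partials_def
  proof
    fix x assume x: "x \<in> S"
    have FU: "J [] x \<in> U" using comp(3) x by auto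
    have l: "linear (\<Phi>' (J [] x))" using \<Phi>'(1)[OF FU] by (rule has_derivative_linear)
    have 1: "(J [] has_derivative (\<lambda>v. \<Sum>b\<in>B. (v \<bullet> b) *\<^sub>R J [b] x)) (at x)"
      by (rule jet_family_has_derivative[OF jet]) (use comp(5) x S(2) in auto)
    have 2: "(\<Phi> has_derivative \<Phi>' (J [] x)) (at (J [] x))"
      using \<Phi>'(1)[OF FU] at_within_open[OF FU comp(2)] by simp
    have "((\<lambda>x. \<Phi> (J [] x)) has_derivative (\<lambda>v. \<Phi>' (J [] x) (\<Sum>b\<in>B. (v \<bullet> b) *\<^sub>R J [b] x))) (at x)"
      using diff_chain_at[OF 1 2] by (simp add: comp_def)
    moreover have "\<Phi>' (J [] x) (J [b] x) = w' b x" for b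
      using linear_Basis_expand[OF l, of "J [b] x"] by (simp add: w'_def)
    then have "\<Phi>' (J [] x) (\<Sum>b\<in>B. (v \<bullet> b) *\<^sub>R J [b] x) = (\<Sum>b\<in>B. (v \<bullet> b) *\<^sub>R w' b x)" for v
      unfolding linear_sum[OF l] linear_scale[OF l] by simp
    ultimately show "((\<lambda>x. \<Phi> (J [] x)) has_derivative (\<lambda>v. \<Sum>b\<in>B. (v \<bullet> b) *\<^sub>R w' b x)) (at x)" by simp
  qed
  moreover have "tame B J S (Suc i) r (w' b)" if "b \<in> B" for b
  proof -
    have "tame B J S (Suc i) r (\<lambda>x. \<Phi>' (J [] x) c)" for c
      by (rule tame.comp[where U = U and \<Phi> = "\<lambda>z. \<Phi>' z c"]) (use \<Phi>'(2) comp(2,3) in auto)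
    then show ?thesis
      unfolding w'_def using that by (intro tame_sum tame.mult tame.jet) auto
  qed
  ultimately show ?case by (auto intro!: exI[of _ w'])
next
  case (jet l i c s)
  have "has_partials B S (\<lambda>x. J l x \<bullet> c) (\<lambda>b x. J (b # l) x \<bullet> c)"
    unfolding has_partials_def
  proof
    fix x assume x: "x \<in> S"
    have "(J l has_derivative (\<lambda>v. \<Sum>b\<in>B. (v \<bullet> b) *\<^sub>R J (b # l) x)) (at x)"
      by (rule jet_family_has_derivative[OF assms(2)]) (use jet x S(2) in auto)
    from bounded_linear.has_derivative[OF bounded_linear_inner_left this]
    show "((\<lambda>x. J l x \<bullet> c) has_derivative (\<lambda>v. \<Sum>b\<in>B. (v \<bullet> b) *\<^sub>R (J (b # l) x \<bullet> c))) (at x)"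
      by (simp add: inner_sum_left)
  qed
  moreover have "tame B J S (Suc i) r (\<lambda>x. J (b # l) x \<bullet> c)" if "b \<in> B" for b
    using that jet by (intro tame.jet) auto
  ultimately show ?case by (auto intro!: exI[of _ "\<lambda>b x. J (b # l) x \<bullet> c"])
next
  case (add i s f g)
  obtain f' g' where *: "has_partials B S f f'" "has_partials B S g g'"
    "\<forall>b\<in>B. tame B J S (Suc i) r (f' b)" "\<forall>b\<in>B. tame B J S (Suc i) r (g' b)" using add by blast
  have "has_partials B S (\<lambda>x. f x + g x) (\<lambda>b x. f' b x + g' b x)"
    unfolding has_partials_def
  proof
    fix x assume x: "x \<in> S"
    have "((\<lambda>x. f x + g x) has_derivative (\<lambda>v. (\<Sum>b\<in>B. (v \<bullet> b) *\<^sub>R f' b x) + (\<Sum>b\<in>B. (v \<bullet> b) *\<^sub>R g' b x))) (at x)"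
      using * x unfolding has_partials_def by (intro has_derivative_add) auto
    then show "((\<lambda>x. f x + g x) has_derivative (\<lambda>v. \<Sum>b\<in>B. (v \<bullet> b) *\<^sub>R (f' b x + g' b x))) (at x)"
      by (simp add: sum.distrib distrib_left)
  qed
  then show ?case using * by (auto intro!: exI[of _ "\<lambda>b x. f' b x + g' b x"] tame.add)
next
  case (mult i s f g)
  obtain f' g' where *: "has_partials B S f f'" "has_partials B S g g'"
    "\<forall>b\<in>B. tame B J S (Suc i) r (f' b)" "\<forall>b\<in>B. tame B J S (Suc i) r (g' b)" using mult by blast
  \<comment> \<open>The undifferentiated factors in the product rule are moved to the new pair of
    orders.\<close>
  have m: "tame B J S (Suc i) r f" "tame B J S (Suc i) r g"
    using mult by (auto intro: tame_mono)
  have "has_partials B S (\<lambda>x. f x * g x) (\<lambda>b x. f x * g' b x + f' b x * g x)"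
    unfolding has_partials_def
  proof
    fix x assume x: "x \<in> S"
    have "((\<lambda>x. f x * g x) has_derivative (\<lambda>v. f x * (\<Sum>b\<in>B. (v \<bullet> b) *\<^sub>R g' b x) + (\<Sum>b\<in>B. (v \<bullet> b) *\<^sub>R f' b x) * g x)) (at x)"
      using * x unfolding has_partials_def by (intro has_derivative_mult) auto
    then show "((\<lambda>x. f x * g x) has_derivative (\<lambda>v. \<Sum>b\<in>B. (v \<bullet> b) *\<^sub>R (f x * g' b x + f' b x * g x))) (at x)"
      by (simp add: sum_distrib_left sum_distrib_right sum.distrib algebra_simps)
  qed
  then show ?case using * m
    by (intro exI[of _ "\<lambda>b x. f x * g' b x + f' b x * g x"]) (auto intro!: tame.add tame.mult)
next
  case (cong i s f g)
  obtain f' where *: "has_partials B S f f'" "\<forall>b\<in>B. tame B J S (Suc i) r (f' b)" using cong by blast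
  have "has_partials B S g f'"
    unfolding has_partials_def
  proof
    fix x assume x: "x \<in> S"
    show "(g has_derivative (\<lambda>v. \<Sum>b\<in>B. (v \<bullet> b) *\<^sub>R f' b x)) (at x)"
      by (rule has_derivative_transform_within_open[OF _ S(1) x]) (use * x cong in \<open>auto simp: has_partials_def\<close>)
  qed
  with * show ?case by (auto intro!: exI[of _ f'])
next
  case (inv i s A C p q)
  have "\<forall>a b. \<exists>w'. a \<in> B \<longrightarrow> b \<in> B \<longrightarrow> has_partials B S (A a b) w' \<and> (\<forall>d\<in>B. tame B J S (Suc i) r (w' d))"
    using inv.IH inv.prems by blast
  then obtain A' where A': "\<And>a b. a \<in> B \<Longrightarrow> b \<in> B \<Longrightarrow> has_partials B S (A a b) (A' a b)"
    "\<And>a b d. a \<in> B \<Longrightarrow> b \<in> B \<Longrightarrow> d \<in> B \<Longrightarrow> tame B J S (Suc i) r (A' a b d)"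
    by metis
  define w' where "w' d x = - (\<Sum>c\<in>B. \<Sum>e\<in>B. C p c x * A' c e d x * C e q x)" for d x
  have C: "tame B J S (Suc i) r (C a b)" if "a \<in> B" "b \<in> B" for a b
    by (rule tame.inv[OF tame_mono[OF inv.hyps(1)] inv.hyps(2-4)]) (use that inv.prems in auto)
  have "has_partials B S (C p q) w'"
    unfolding has_partials_def
  proof
    fix x assume x: "x \<in> S"
    have iC: "isCont (C a b) x" if "a \<in> B" "b \<in> B" for a b
      using inv.hyps(2)[OF that] x S(1) by (simp add: continuous_on_eq_continuous_at)
    have dA: "(A c e has_derivative (\<lambda>v. \<Sum>d\<in>B. (v \<bullet> d) *\<^sub>R A' c e d x)) (at x)" if "c \<in> B" "e \<in> B" for c e
      using A'(1)[OF that] x by (auto simp: has_partials_def)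
    \<comment> \<open>The expression equals \<open>C p q y\<close> by the resolvent identity. The
      factor \<open>C p c y\<close> is merely continuous, but it multiplies a difference that
      vanishes at \<open>x\<close>.\<close>
    have D: "((\<lambda>y. C p q x - (\<Sum>c\<in>B. \<Sum>e\<in>B. C p c y * (A c e y - A c e x) * C e q x)) has_derivative
      (\<lambda>v. 0 - (\<Sum>c\<in>B. \<Sum>e\<in>B. C p c x * (\<Sum>d\<in>B. (v \<bullet> d) *\<^sub>R A' c e d x) * C e q x))) (at x)"
      by (intro has_derivative_diff has_derivative_const has_derivative_sum has_derivative_mult_left
          has_derivative_mult_vanishing iC dA inv.hyps(5))
    have e: "0 - (\<Sum>c\<in>B. \<Sum>e\<in>B. C p c x * (\<Sum>d\<in>B. (v \<bullet> d) *\<^sub>R A' c e d x) * C e q x)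
        = (\<Sum>d\<in>B. (v \<bullet> d) *\<^sub>R w' d x)" for v
    proof -
      have "(\<Sum>c\<in>B. \<Sum>e\<in>B. C p c x * (\<Sum>d\<in>B. (v \<bullet> d) *\<^sub>R A' c e d x) * C e q x)
        = (\<Sum>c\<in>B. \<Sum>e\<in>B. \<Sum>d\<in>B. (v \<bullet> d) * (C p c x * A' c e d x * C e q x))"
        by (simp add: sum_distrib_left sum_distrib_right mult_ac)
      also have "\<dots> = (\<Sum>c\<in>B. \<Sum>d\<in>B. \<Sum>e\<in>B. (v \<bullet> d) * (C p c x * A' c e d x * C e q x))"
        by (intro sum.cong refl sum.swap)
      also have "\<dots> = (\<Sum>d\<in>B. \<Sum>c\<in>B. \<Sum>e\<in>B. (v \<bullet> d) * (C p c x * A' c e d x * C e q x))"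
        by (rule sum.swap)
      finally show ?thesis by (simp add: w'_def sum_distrib_left sum_negf)
    qed
    show "(C p q has_derivative (\<lambda>v. \<Sum>d\<in>B. (v \<bullet> d) *\<^sub>R w' d x)) (at x)"
    proof (rule has_derivative_transform_within_open[OF D[unfolded e] S(1) x])
      fix y assume y: "y \<in> S"
      have "C p q y - C p q x = - (\<Sum>c\<in>B. \<Sum>e\<in>B. C p c y * (A c e y - A c e x) * C e q x)"
        by (rule matrix_inverse_diff[where C = "\<lambda>a b. C a b y" and C' = "\<lambda>a b. C a b x" and A = "\<lambda>a b. A a b y" and A' = "\<lambda>a b. A a b x"])
           (use B inv.hyps x y in auto)
      then show "C p q x - (\<Sum>c\<in>B. \<Sum>e\<in>B. C p c y * (A c e y - A c e x) * C e q x) = C p q y" by simp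
    qed
  qed
  moreover have "tame B J S (Suc i) r (w' d)" if "d \<in> B" for d
    unfolding w'_def using that A'(2) C inv.hyps(5,6)
    by (intro tame_uminus tame_sum tame.mult) auto
  ultimately show ?case by (auto intro!: exI[of _ w'])
qed

section \<open>Difference quotients in jet coordinates\<close>

definition jet_index :: "'e::euclidean_space set \<Rightarrow> nat \<Rightarrow> ('e list \<times> 'e) set" where
  "jet_index B j = {l \<in> lists B. length l \<le> j} \<times> Basis"

definition jet_coord :: "('e list \<Rightarrow> 'e::euclidean_space \<Rightarrow> 'e) \<Rightarrow> 'e list \<times> 'e \<Rightarrow> 'e \<Rightarrow> real" where
  "jet_coord J k x = J (fst k) x \<bullet> snd k"

text \<open>The analogue of \<open>secant_map\<close> for a function on the set of jets, in
  coordinates: increments of \<open>w\<close> are combinations of increments of jet coordinates,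
  with coefficients that are continuous at the diagonal.\<close>

definition jet_secant where
  "jet_secant B J j S w a \<longleftrightarrow>
     (\<forall>x\<in>S. \<forall>y\<in>S. w x - w y = (\<Sum>k\<in>jet_index B j. a k x y * (jet_coord J k x - jet_coord J k y))) \<and>
     (\<forall>k\<in>jet_index B j. \<forall>c\<in>S. \<forall>X Y. (\<forall>n::nat. X n \<in> S \<and> Y n \<in> S) \<longrightarrow> X \<longlonglongrightarrow> c \<longrightarrow> Y \<longlonglongrightarrow> c \<longrightarrow>
        (\<lambda>n. a k (X n) (Y n) :: real) \<longlonglongrightarrow> a k c c)"

lemma finite_jet_index: "finite B \<Longrightarrow> finite (jet_index B j)"
  unfolding jet_index_def using finite_lists_length_le[of B j]
  by (auto simp: lists_eq_set Collect_conj_eq)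

text \<open>The coefficients follow the expression: \<open>C1_secant_map\<close> for the smooth
  functions, where one derivative is needed and hence \<open>s \<noteq> 0\<close>, the product rule
  for products and the resolvent identity for inverses.\<close>

lemma tame_jet_secant:
  assumes "tame B J S i s w" and jet: "jet_family B W J j" and B: "finite B" and S: "S \<subseteq> W"
    and "i \<le> j" "s \<noteq> 0"
  shows "\<exists>a. jet_secant B J j S w a"
  using assms(1,5,6)
proof (induction rule: tame.induct)
  case (comp s U \<Phi> i)
  obtain r where r: "s = Suc r" using comp by (cases s) auto
  obtain A where A: "secant_map \<Phi> A U" using C1_secant_map[OF comp(2) comp(1)[unfolded r]] by blast
  have cont: "continuous_on S (J [])" using jet S by (auto intro: jet_family_continuous_on)
  define a where "a = (\<lambda>(l :: 'a list, c) x y. if l = [] then A (J [] x) (J [] y) c else 0)"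
  have "\<Phi> (J [] x) - \<Phi> (J [] y) = (\<Sum>k\<in>jet_index B j. a k x y * (jet_coord J k x - jet_coord J k y))"
    if xy: "x \<in> S" "y \<in> S" for x y
  proof -
    have l: "linear (A (J [] x) (J [] y))" using A by (simp add: secant_map_def)
    have "J [] x \<in> U" "J [] y \<in> U" using xy comp(3) by auto
    then have "\<Phi> (J [] x) - \<Phi> (J [] y) = A (J [] x) (J [] y) (J [] x - J [] y)"
      using A unfolding secant_map_def by blast
    also have "\<dots> = (\<Sum>c\<in>Basis. ((J [] x - J [] y) \<bullet> c) * A (J [] x) (J [] y) c)"
      by (subst linear_Basis_expand[OF l]) simp
    also have "\<dots> = (\<Sum>k\<in>Pair [] ` Basis. a k x y * (jet_coord J k x - jet_coord J k y))"
      by (subst sum.reindex) (auto simp: inj_on_def a_def jet_coord_def inner_diff_left mult.commute)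
    also have "\<dots> = (\<Sum>k\<in>jet_index B j. a k x y * (jet_coord J k x - jet_coord J k y))"
      by (rule sum.mono_neutral_left[OF finite_jet_index[OF B]]) (auto simp: jet_index_def a_def)
    finally show ?thesis .
  qed
  moreover have "(\<lambda>n. a k (X n) (Y n)) \<longlonglongrightarrow> a k c c"
    if "c \<in> S" "\<forall>n. X n \<in> S \<and> Y n \<in> S" "X \<longlonglongrightarrow> c" "Y \<longlonglongrightarrow> c" for k c X Y
  proof -
    obtain l d where k: "k = (l, d)" by fastforce
    have "(\<lambda>n. A (J [] (X n)) (J [] (Y n)) d) \<longlonglongrightarrow> A (J [] c) (J [] c) d"
    proof (rule secant_map_tendsto[OF A])
      show "(\<lambda>n. J [] (X n)) \<longlonglongrightarrow> J [] c" "(\<lambda>n. J [] (Y n)) \<longlonglongrightarrow> J [] c"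
        using cont that unfolding continuous_on_sequentially comp_def by blast+
    qed (use that comp(3) in \<open>auto intro!: always_eventually\<close>)
    then show ?thesis by (simp add: k a_def)
  qed
  ultimately show ?case unfolding jet_secant_def by (intro exI[of _ a]) simp
next
  case (jet l i c s)
  define a :: "'a list \<times> 'a \<Rightarrow> 'a \<Rightarrow> 'a \<Rightarrow> real" where "a = (\<lambda>k x y. if k = (l, c) then 1 else 0)"
  have k: "(l, c) \<in> jet_index B j" using jet by (auto simp: jet_index_def)
  have "J l x \<bullet> c - J l y \<bullet> c = (\<Sum>k\<in>jet_index B j. a k x y * (jet_coord J k x - jet_coord J k y))" for x y
  proof -
    have "(\<Sum>k\<in>jet_index B j. a k x y * (jet_coord J k x - jet_coord J k y)) =
        (\<Sum>k\<in>jet_index B j. if k = (l, c) then J l x \<bullet> c - J l y \<bullet> c else 0)"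
      by (intro sum.cong) (auto simp: a_def jet_coord_def)
    also have "\<dots> = J l x \<bullet> c - J l y \<bullet> c" using k finite_jet_index[OF B] by simp
    finally show ?thesis by simp
  qed
  then show ?case unfolding jet_secant_def by (intro exI[of _ a]) (auto simp: a_def)
next
  case (add i s f g)
  obtain a b where ab: "jet_secant B J j S f a" "jet_secant B J j S g b" using add by blast
  show ?case
    unfolding jet_secant_def
  proof (intro exI[of _ "\<lambda>k x y. a k x y + b k x y"] conjI ballI allI impI)
    fix x y assume "x \<in> S" "y \<in> S"
    then have "f x - f y = (\<Sum>k\<in>jet_index B j. a k x y * (jet_coord J k x - jet_coord J k y))"
      "g x - g y = (\<Sum>k\<in>jet_index B j. b k x y * (jet_coord J k x - jet_coord J k y))"
      using ab by (auto simp: jet_secant_def)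
    then show "f x + g x - (f y + g y) = (\<Sum>k\<in>jet_index B j. (a k x y + b k x y) * (jet_coord J k x - jet_coord J k y))"
      by (simp add: distrib_right sum.distrib)
  qed (use ab in \<open>auto simp: jet_secant_def intro!: tendsto_add\<close>)
next
  case (mult i s f g)
  obtain a b where ab: "jet_secant B J j S f a" "jet_secant B J j S g b" using mult by blast
  have cf: "continuous_on S f" "continuous_on S g"
    using mult tame_continuous_on[OF _ assms(2) _ S] by auto
  show ?case
    unfolding jet_secant_def
  proof (intro exI[of _ "\<lambda>k x y. f x * b k x y + a k x y * g y"] conjI ballI allI impI)
    fix x y assume xy: "x \<in> S" "y \<in> S"
    have "f x * g x - f y * g y = f x * (g x - g y) + (f x - f y) * g y" by (simp add: algebra_simps)
    also have "\<dots> = f x * (\<Sum>k\<in>jet_index B j. b k x y * (jet_coord J k x - jet_coord J k y)) +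
        (\<Sum>k\<in>jet_index B j. a k x y * (jet_coord J k x - jet_coord J k y)) * g y"
      using ab xy by (auto simp: jet_secant_def)
    also have "\<dots> = (\<Sum>k\<in>jet_index B j. (f x * b k x y + a k x y * g y) * (jet_coord J k x - jet_coord J k y))"
      unfolding sum_distrib_left sum_distrib_right sum.distrib[symmetric] by (intro sum.cong refl) (simp add: algebra_simps)
    finally show "f x * g x - f y * g y = (\<Sum>k\<in>jet_index B j. (f x * b k x y + a k x y * g y) * (jet_coord J k x - jet_coord J k y))" .
  next
    fix k c X Y assume *: "k \<in> jet_index B j" "c \<in> S" "\<forall>n::nat. X n \<in> S \<and> Y n \<in> S" "X \<longlonglongrightarrow> c" "Y \<longlonglongrightarrow> c"
    have "(\<lambda>n. f (X n)) \<longlonglongrightarrow> f c" "(\<lambda>n. g (Y n)) \<longlonglongrightarrow> g c"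
      using cf * unfolding continuous_on_sequentially comp_def by blast+
    moreover have "(\<lambda>n. a k (X n) (Y n)) \<longlonglongrightarrow> a k c c" "(\<lambda>n. b k (X n) (Y n)) \<longlonglongrightarrow> b k c c"
      using ab * unfolding jet_secant_def by blast+
    ultimately show "(\<lambda>n. f (X n) * b k (X n) (Y n) + a k (X n) (Y n) * g (Y n)) \<longlonglongrightarrow> f c * b k c c + a k c c * g c"
      by (intro tendsto_intros)
  qed
next
  case (cong i s f g)
  then show ?case by (auto simp: jet_secant_def)
next
  case (inv i s A C p q)
  have "\<forall>a b. \<exists>w. a \<in> B \<longrightarrow> b \<in> B \<longrightarrow> jet_secant B J j S (A a b) w"
    using inv.IH inv.prems by blast
  then obtain w where w: "\<And>a b. a \<in> B \<Longrightarrow> b \<in> B \<Longrightarrow> jet_secant B J j S (A a b) (w a b)"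
    by metis
  show ?case
    unfolding jet_secant_def
  proof (intro exI[of _ "\<lambda>k x y. - (\<Sum>c\<in>B. \<Sum>e\<in>B. C p c x * w c e k x y * C e q y)"] conjI ballI allI impI)
    fix x y assume xy: "x \<in> S" "y \<in> S"
    let ?D = "\<lambda>k. jet_coord J k x - jet_coord J k y"
    have "C p q x - C p q y = - (\<Sum>c\<in>B. \<Sum>e\<in>B. C p c x * (A c e x - A c e y) * C e q y)"
      by (rule matrix_inverse_diff[where C = "\<lambda>a b. C a b x" and C' = "\<lambda>a b. C a b y" and A = "\<lambda>a b. A a b x" and A' = "\<lambda>a b. A a b y"])
         (use B inv.hyps xy in auto)
    also have "(\<Sum>c\<in>B. \<Sum>e\<in>B. C p c x * (A c e x - A c e y) * C e q y)
        = (\<Sum>c\<in>B. \<Sum>e\<in>B. \<Sum>k\<in>jet_index B j. C p c x * w c e k x y * C e q y * ?D k)"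
    proof (intro sum.cong refl)
      fix c e assume "c \<in> B" "e \<in> B"
      then have "A c e x - A c e y = (\<Sum>k\<in>jet_index B j. w c e k x y * ?D k)"
        using w xy by (auto simp: jet_secant_def)
      then show "C p c x * (A c e x - A c e y) * C e q y = (\<Sum>k\<in>jet_index B j. C p c x * w c e k x y * C e q y * ?D k)"
        by (simp add: sum_distrib_left sum_distrib_right mult_ac)
    qed
    also have "\<dots> = (\<Sum>c\<in>B. \<Sum>k\<in>jet_index B j. \<Sum>e\<in>B. C p c x * w c e k x y * C e q y * ?D k)"
      by (intro sum.cong refl sum.swap)
    also have "\<dots> = (\<Sum>k\<in>jet_index B j. \<Sum>c\<in>B. \<Sum>e\<in>B. C p c x * w c e k x y * C e q y * ?D k)"
      by (rule sum.swap)
    finally show "C p q x - C p q y = (\<Sum>k\<in>jet_index B j. - (\<Sum>c\<in>B. \<Sum>e\<in>B. C p c x * w c e k x y * C e q y) * ?D k)"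
      by (simp add: sum_distrib_right sum_negf)
  next
    fix k c X Y assume *: "k \<in> jet_index B j" "c \<in> S" "\<forall>n::nat. X n \<in> S \<and> Y n \<in> S" "X \<longlonglongrightarrow> c" "Y \<longlonglongrightarrow> c"
    show "(\<lambda>n. - (\<Sum>d\<in>B. \<Sum>e\<in>B. C p d (X n) * w d e k (X n) (Y n) * C e q (Y n))) \<longlonglongrightarrow>
        - (\<Sum>d\<in>B. \<Sum>e\<in>B. C p d c * w d e k c c * C e q c)"
    proof (intro tendsto_intros)
      fix d e assume de: "d \<in> B" "e \<in> B"
      show "(\<lambda>n. C p d (X n)) \<longlonglongrightarrow> C p d c" "(\<lambda>n. C e q (Y n)) \<longlonglongrightarrow> C e q c"
        using inv.hyps(2)[OF inv.hyps(5) de(1)] inv.hyps(2)[OF de(2) inv.hyps(6)] *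
        unfolding continuous_on_sequentially comp_def by blast+
      show "(\<lambda>n. w d e k (X n) (Y n)) \<longlonglongrightarrow> w d e k c c"
        using w[OF de] * unfolding jet_secant_def by blast
    qed
  qed
qed

section \<open>The action of local diffeomorphisms on jets\<close>

text \<open>\<open>N \<inter> U\<close> is parametrised by \<open>F\<close> over
  \<open>span B \<inter> D\<close>, and \<open>C\<close> is a Lipschitz constant. \<open>D\<close>
  is a cylinder over this set, so that functions on it can be treated as functions on an open set of
  the whole space.\<close>

definition graph_patch :: "'e::euclidean_space set \<Rightarrow> 'e set \<Rightarrow> 'e set \<Rightarrow> 'e set \<Rightarrow> ('e \<Rightarrow> 'e) \<Rightarrow> real \<Rightarrow> bool" where
  "graph_patch N B D U F C \<longleftrightarrow> orthonormal B \<and> open D \<and> (\<forall>x. proj B x \<in> D \<longleftrightarrow> x \<in> D) \<and> open U \<and>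
     (\<forall>x\<in>span B \<inter> D. F x \<in> N \<inter> U \<and> proj B (F x) = x) \<and>
     (\<forall>z\<in>N \<inter> U. proj B z \<in> D \<and> F (proj B z) = z) \<and>
     (\<forall>x\<in>span B \<inter> D. \<forall>x'\<in>span B \<inter> D. norm (F x - F x') \<le> C * norm (x - x'))"

definition ck_equiv :: "nat \<Rightarrow> 'e::euclidean_space set \<Rightarrow> 'e set \<Rightarrow> ('e \<Rightarrow> 'e) \<Rightarrow> ('e \<Rightarrow> 'e) \<Rightarrow> bool" where
  "ck_equiv k U U' H H' \<longleftrightarrow> open U \<and> open U' \<and>
     (\<forall>z\<in>U. H z \<in> U' \<and> H' (H z) = z) \<and> (\<forall>z\<in>U'. H' z \<in> U \<and> H (H' z) = z) \<and>
     ck_on k UNIV U H \<and> ck_on k UNIV U' H'"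

definition ck_homog :: "nat \<Rightarrow> 'e::euclidean_space set \<Rightarrow> bool" where
  "ck_homog k N \<longleftrightarrow> (\<forall>a\<in>N. \<forall>b\<in>N. \<exists>U U' H H'. ck_equiv k U U' H H' \<and> a \<in> U \<and> H a = b \<and> H ` (U \<inter> N) = U' \<inter> N)"

lemma ck_equiv_sym: "ck_equiv k U U' H H' \<Longrightarrow> ck_equiv k U' U H' H"
  by (auto simp: ck_equiv_def)

lemma ck_equiv_image_sym:
  assumes "ck_equiv k U U' H H'" "H ` (U \<inter> N) = U' \<inter> N'" shows "H' ` (U' \<inter> N') = U \<inter> N"
proof
  show "H' ` (U' \<inter> N') \<subseteq> U \<inter> N"
    using assms by (auto simp: ck_equiv_def assms(2)[symmetric])
  show "U \<inter> N \<subseteq> H' ` (U' \<inter> N')"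
  proof
    fix z assume z: "z \<in> U \<inter> N"
    then have "H z \<in> U' \<inter> N'" "H' (H z) = z" using assms by (auto simp: ck_equiv_def)
    then show "z \<in> H' ` (U' \<inter> N')" by (metis image_eqI)
  qed
qed

lemma proj_proj: "orthonormal B \<Longrightarrow> proj B (proj B x) = proj B x"
  using proj_span proj_in_span by blast

lemma dual_sum:
  fixes f :: "'e::euclidean_space \<Rightarrow> 'f::real_vector"
  assumes B: "orthonormal B" "b \<in> B" shows "(\<Sum>c\<in>B. (b \<bullet> c) *\<^sub>R f c) = f b"
proof -
  have "(\<Sum>c\<in>B. (b \<bullet> c) *\<^sub>R f c) = (\<Sum>c\<in>B. if b = c then f c else 0)"
    using B by (intro sum.cong) (auto simp: orthonormal_inner)
  also have "\<dots> = f b" using B by (simp add: orthonormal_def)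
  finally show ?thesis .
qed

text \<open>The function agrees near \<open>x\<close> with its composition with
  \<open>proj B\<close>; the chain rule and uniqueness of the derivative compare the partials at the
  two points.\<close>

lemma has_partials_proj:
  fixes w :: "'e::euclidean_space \<Rightarrow> real"
  assumes B: "orthonormal B" and pd: "has_partials B S w w'" and S: "open S"
    and w: "\<And>x. x \<in> S \<Longrightarrow> w (proj B x) = w x" and xS: "x \<in> S" "proj B x \<in> S" and b: "b \<in> B"
  shows "w' b (proj B x) = w' b x"
proof -
  have 1: "(w has_derivative (\<lambda>v. \<Sum>c\<in>B. (v \<bullet> c) *\<^sub>R w' c (proj B x))) (at (proj B x))"
    and 2: "(w has_derivative (\<lambda>v. \<Sum>c\<in>B. (v \<bullet> c) *\<^sub>R w' c x)) (at x)"
    using pd xS by (auto simp: has_partials_def)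
  have "(proj B has_derivative proj B) (at x)" by (rule bounded_linear_imp_has_derivative[OF bounded_linear_proj])
  from diff_chain_at[OF this 1]
  have "((\<lambda>x. w (proj B x)) has_derivative (\<lambda>v. \<Sum>c\<in>B. (proj B v \<bullet> c) *\<^sub>R w' c (proj B x))) (at x)"
    by (simp add: comp_def)
  then have "(w has_derivative (\<lambda>v. \<Sum>c\<in>B. (proj B v \<bullet> c) *\<^sub>R w' c (proj B x))) (at x)"
    by (rule has_derivative_transform_within_open[OF _ S xS(1) w])
  from has_derivative_unique[OF this 2]
  have "(\<Sum>c\<in>B. (proj B b \<bullet> c) *\<^sub>R w' c (proj B x)) = (\<Sum>c\<in>B. (b \<bullet> c) *\<^sub>R w' c x)" by meson
  moreover have "proj B b = b" using proj_span[OF B] b span_base by blast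
  ultimately show ?thesis by (simp only: dual_sum[OF B b])
qed

text \<open>\<open>trans_map B F H\<close> is the local diffeomorphism \<open>H\<close> read in the parametrisation \<open>F\<close> of the
  graph; its natural domain is \<open>trans_dom B D U F U1 H\<close>.\<close>

definition trans_dom where
  "trans_dom B D U F U1 H = {x \<in> D. F (proj B x) \<in> U1 \<and> H (F (proj B x)) \<in> U}"

definition trans_map where
  "trans_map B F H x = proj B (H (F (proj B x)))"

context
  fixes N B D U :: "'e::euclidean_space set" and F C
  assumes patch: "graph_patch N B D U F C"
begin

lemma patch_basis: "orthonormal B" "open D" "open U"
  using patch by (auto simp: graph_patch_def)

lemma patch_proj: "proj B x \<in> D \<longleftrightarrow> x \<in> D"
  using patch by (auto simp: graph_patch_def)

lemma patch_graph: "x \<in> D \<Longrightarrow> F (proj B x) \<in> N \<inter> U" "x \<in> D \<Longrightarrow> proj B (F (proj B x)) = proj B x"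
  using patch proj_in_span[of B x] patch_proj by (auto simp: graph_patch_def)

lemma patch_inverse: "z \<in> N \<Longrightarrow> z \<in> U \<Longrightarrow> proj B z \<in> D" "z \<in> N \<Longrightarrow> z \<in> U \<Longrightarrow> F (proj B z) = z"
  using patch by (auto simp: graph_patch_def)

lemma patch_lipschitz: "x \<in> D \<Longrightarrow> x' \<in> D \<Longrightarrow> norm (F (proj B x) - F (proj B x')) \<le> C * norm (proj B x - proj B x')"
  using patch proj_in_span[of B] patch_proj by (auto simp: graph_patch_def)

lemma patch_continuous: "continuous_on D (\<lambda>x. F (proj B x))"
proof (rule lipschitz_on_continuous_on)
  show "\<bar>C\<bar>-lipschitz_on D (\<lambda>x. F (proj B x))"
  proof (rule lipschitz_onI)
    fix x y assume "x \<in> D" "y \<in> D"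
    then have "norm (F (proj B x) - F (proj B y)) \<le> C * norm (proj B (x - y))"
      using patch_lipschitz[of x y] by (simp add: linear_diff[OF bounded_linear.linear[OF bounded_linear_proj]])
    also have "\<dots> \<le> \<bar>C\<bar> * norm (x - y)"
      by (intro mult_mono norm_proj_le patch_basis) auto
    finally show "dist (F (proj B x)) (F (proj B y)) \<le> \<bar>C\<bar> * dist x y" by (simp add: dist_norm)
  qed simp
qed

text \<open>\<open>H\<close> preserves \<open>N\<close> and \<open>F\<close> inverts
  \<open>proj B\<close> on \<open>N \<inter> U\<close>, so the point of the graph over
  \<open>trans_map B F H x\<close> is the image of the point over \<open>x\<close>. A round trip
  gives \<open>proj B x\<close> instead of \<open>x\<close>, since all maps here factor through the
  projection.\<close>

lemma trans_properties:
  assumes eq: "ck_equiv k U1 U1' H H'" and im: "H ` (U1 \<inter> N) = U1' \<inter> N"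
    and x: "x \<in> trans_dom B D U F U1 H"
  shows "F (proj B (trans_map B F H x)) = H (F (proj B x))"
    "trans_map B F H x \<in> trans_dom B D U F U1' H'"
    "trans_map B F H' (trans_map B F H x) = proj B x"
    "trans_map B F H (proj B x) = trans_map B F H x"
    "proj B x \<in> trans_dom B D U F U1 H"
    "trans_map B F H x \<in> span B"
proof -
  have x': "x \<in> D" "F (proj B x) \<in> U1" "H (F (proj B x)) \<in> U" using x by (auto simp: trans_dom_def)
  have FN: "F (proj B x) \<in> N" using patch_graph[OF x'(1)] by auto
  then have HN: "H (F (proj B x)) \<in> U1'" "H (F (proj B x)) \<in> N" using im x'(2) by blast+
  have pp: "proj B (proj B y) = proj B y" for y by (rule proj_proj[OF patch_basis(1)])
  show 1: "F (proj B (trans_map B F H x)) = H (F (proj B x))"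
    unfolding trans_map_def pp using patch_inverse(2)[OF HN(2) x'(3)] .
  have inv: "H' (H (F (proj B x))) = F (proj B x)" using eq x'(2) by (auto simp: ck_equiv_def)
  show "trans_map B F H x \<in> trans_dom B D U F U1' H'"
    unfolding trans_dom_def mem_Collect_eq 1 inv using HN patch_graph(1)[OF x'(1)] patch_inverse(1)[OF HN(2) x'(3)]
    by (auto simp: trans_map_def)
  show "trans_map B F H' (trans_map B F H x) = proj B x"
    using patch_graph(2)[OF x'(1)] 1 inv by (simp add: trans_map_def)
  show "trans_map B F H (proj B x) = trans_map B F H x" by (simp add: trans_map_def pp)
  show "proj B x \<in> trans_dom B D U F U1 H" using x by (simp add: trans_dom_def pp patch_proj)
  show "trans_map B F H x \<in> span B" by (simp add: trans_map_def proj_in_span)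
qed

lemma trans_dom_open:
  assumes eq: "ck_equiv k U1 U1' H H'"
  shows "open (trans_dom B D U F U1 H)"
proof -
  have U1: "open U1" "continuous_on U1 H"
    using eq ck_on_imp_continuous_on by (auto simp: ck_equiv_def)
  have "open (U1 \<inter> H -` U)"
    by (rule continuous_open_preimage[OF U1(2,1) patch_basis(3)])
  then have "open (D \<inter> (\<lambda>x. F (proj B x)) -` (U1 \<inter> H -` U))"
    by (rule continuous_open_preimage[OF patch_continuous patch_basis(2)])
  moreover have "D \<inter> (\<lambda>x. F (proj B x)) -` (U1 \<inter> H -` U) = trans_dom B D U F U1 H"
    by (auto simp: trans_dom_def)
  ultimately show ?thesis by simp
qed

lemma trans_continuous:
  assumes eq: "ck_equiv k U1 U1' H H'"
  shows "continuous_on (trans_dom B D U F U1 H) (trans_map B F H)"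
proof -
  have "continuous_on U1 H" using eq ck_on_imp_continuous_on by (auto simp: ck_equiv_def)
  then have "continuous_on (trans_dom B D U F U1 H) (\<lambda>x. H (F (proj B x)))"
    by (rule continuous_on_compose2[OF _ continuous_on_subset[OF patch_continuous]]) (auto simp: trans_dom_def)
  then show ?thesis
    unfolding trans_map_def by (intro bounded_linear.continuous_on[OF bounded_linear_proj])
qed

context
  fixes J :: "'e list \<Rightarrow> 'e \<Rightarrow> 'e" and j k :: nat
  assumes jet: "jet_family B D J j" and J0: "\<And>x. x \<in> D \<Longrightarrow> J [] x = F (proj B x)"
    and j: "0 < j" "j < k"
begin

text \<open>The components of \<open>trans_map\<close> are C^k functions of the graph point, which
  is the jet \<open>J []\<close>; one differentiation leads to orders 1 and
  \<open>k - 1\<close>.\<close>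

lemma trans_partials:
  assumes eq: "ck_equiv k U1 U1' H H'"
  obtains G where
    "\<And>a b. a \<in> B \<Longrightarrow> b \<in> B \<Longrightarrow> tame B J (trans_dom B D U F U1 H) 1 (k - 1) (G a b)"
    "\<And>a. a \<in> B \<Longrightarrow> has_partials B (trans_dom B D U F U1 H) (\<lambda>x. trans_map B F H x \<bullet> a) (G a)"
proof -
  let ?S = "trans_dom B D U F U1 H"
  have SD: "?S \<subseteq> D" by (auto simp: trans_dom_def)
  have k: "k = Suc (k - 1)" using j by simp
  have fin: "finite B" using patch_basis by (simp add: orthonormal_def)
  have "\<exists>w'. has_partials B ?S (\<lambda>x. trans_map B F H x \<bullet> a) w' \<and> (\<forall>b\<in>B. tame B J ?S (Suc 0) (k - 1) (w' b))"
    if a: "a \<in> B" for a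
  proof (rule tame_has_partials[OF _ jet fin trans_dom_open[OF eq] SD k j(1)])
    have "ck_on k UNIV U1 (\<lambda>z. H z \<bullet> a)"
      using eq by (auto simp: ck_equiv_def intro: ck_on_bounded_linear[OF bounded_linear_inner_left])
    then have "tame B J ?S 0 k (\<lambda>x. H (J [] x) \<bullet> a)"
      by (rule tame.comp[where \<Phi> = "\<lambda>z. H z \<bullet> a"])
         (use eq J0 in \<open>auto simp: ck_equiv_def trans_dom_def\<close>)
    then show "tame B J ?S 0 k (\<lambda>x. trans_map B F H x \<bullet> a)"
    proof (rule tame.cong)
      fix x assume "x \<in> ?S"
      then show "trans_map B F H x \<bullet> a = H (J [] x) \<bullet> a"
        using J0 SD by (auto simp: trans_map_def proj_inner_basis[OF patch_basis(1) a])
    qed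
  qed
  then obtain G where "\<And>a. a \<in> B \<Longrightarrow> has_partials B ?S (\<lambda>x. trans_map B F H x \<bullet> a) (G a)"
    "\<And>a b. a \<in> B \<Longrightarrow> b \<in> B \<Longrightarrow> tame B J ?S (Suc 0) (k - 1) (G a b)" by metis
  then show ?thesis by (intro that[of G]) simp_all
qed

lemma trans_map_has_derivative:
  assumes "\<And>a. a \<in> B \<Longrightarrow> has_partials B (trans_dom B D U F U1 H) (\<lambda>x. trans_map B F H x \<bullet> a) (G a)"
    and x: "x \<in> trans_dom B D U F U1 H"
  shows "(trans_map B F H has_derivative (\<lambda>v. \<Sum>a\<in>B. (\<Sum>b\<in>B. (v \<bullet> b) *\<^sub>R G a b x) *\<^sub>R a)) (at x)"
proof -
  have "((\<lambda>x. \<Sum>a\<in>B. (trans_map B F H x \<bullet> a) *\<^sub>R a) has_derivative (\<lambda>v. \<Sum>a\<in>B. (\<Sum>b\<in>B. (v \<bullet> b) *\<^sub>R G a b x) *\<^sub>R a)) (at x)"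
    using assms by (intro has_derivative_sum has_derivative_scaleR_left) (auto simp: has_partials_def)
  moreover have "(\<Sum>a\<in>B. (trans_map B F H x \<bullet> a) *\<^sub>R a) = trans_map B F H x" for x
    using proj_proj[OF patch_basis(1)] by (simp add: trans_map_def proj_def[symmetric])
  ultimately show ?thesis by simp
qed

text \<open>The chain rule for the round trip, whose component along \<open>a\<close> is
  \<open>x \<bullet> a\<close>.\<close>

lemma trans_matrix_inverse:
  assumes eq: "ck_equiv k U1 U1' H H'" and im: "H ` (U1 \<inter> N) = U1' \<inter> N"
    and G: "\<And>a. a \<in> B \<Longrightarrow> has_partials B (trans_dom B D U F U1 H) (\<lambda>x. trans_map B F H x \<bullet> a) (G a)"
    and G': "\<And>a. a \<in> B \<Longrightarrow> has_partials B (trans_dom B D U F U1' H') (\<lambda>x. trans_map B F H' x \<bullet> a) (G' a)"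
    and x: "x \<in> trans_dom B D U F U1 H" and ab: "a \<in> B" "b \<in> B"
  shows "(\<Sum>c\<in>B. G' a c (trans_map B F H x) * G c b x) = (if a = b then 1 else 0)"
proof -
  let ?S = "trans_dom B D U F U1 H" and ?g = "trans_map B F H" and ?g' = "trans_map B F H'"
  have on: "orthonormal B" by (rule patch_basis)
  have gx: "?g x \<in> trans_dom B D U F U1' H'" using trans_properties(2)[OF eq im x] .
  have "((\<lambda>y. ?g' y \<bullet> a) has_derivative (\<lambda>v. \<Sum>c\<in>B. (v \<bullet> c) *\<^sub>R G' a c (?g x))) (at (?g x))"
    using G'[OF ab(1)] gx by (auto simp: has_partials_def)
  from diff_chain_at[OF trans_map_has_derivative[OF G x] this]
  have "((\<lambda>x. ?g' (?g x) \<bullet> a) has_derivative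
      (\<lambda>v. \<Sum>c\<in>B. ((\<Sum>a\<in>B. (\<Sum>b\<in>B. (v \<bullet> b) *\<^sub>R G a b x) *\<^sub>R a) \<bullet> c) *\<^sub>R G' a c (?g x))) (at x)"
    by (simp add: comp_def)
  then have 1: "((\<lambda>x. x \<bullet> a) has_derivative
      (\<lambda>v. \<Sum>c\<in>B. ((\<Sum>a\<in>B. (\<Sum>b\<in>B. (v \<bullet> b) *\<^sub>R G a b x) *\<^sub>R a) \<bullet> c) *\<^sub>R G' a c (?g x))) (at x)"
  proof (rule has_derivative_transform_within_open[OF _ trans_dom_open[OF eq] x])
    fix y assume "y \<in> ?S"
    from trans_properties(3)[OF eq im this] show "?g' (?g y) \<bullet> a = y \<bullet> a"
      using proj_inner_basis[OF on ab(1)] by simp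
  qed
  have 2: "((\<lambda>x. x \<bullet> a) has_derivative (\<lambda>v. v \<bullet> a)) (at x)"
    by (rule bounded_linear_imp_has_derivative[OF bounded_linear_inner_left])
  from has_derivative_unique[OF 1 2]
  have "(\<Sum>c\<in>B. ((\<Sum>a\<in>B. (\<Sum>d\<in>B. (b \<bullet> d) *\<^sub>R G a d x) *\<^sub>R a) \<bullet> c) *\<^sub>R G' a c (?g x)) = b \<bullet> a"
    by meson
  moreover have "(\<Sum>d\<in>B. (b \<bullet> d) *\<^sub>R G c d x) = G c b x" for c by (rule dual_sum[OF on ab(2)])
  moreover have "(\<Sum>a\<in>B. f a *\<^sub>R a) \<bullet> c = f c" if "c \<in> B" for f c
  proof -
    have "(\<Sum>a\<in>B. f a *\<^sub>R a) \<bullet> c = (\<Sum>a\<in>B. (c \<bullet> a) *\<^sub>R f a)"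
      by (simp add: inner_sum_left) (simp add: inner_commute mult.commute)
    then show ?thesis using dual_sum[OF on that, of f] by simp
  qed
  ultimately show ?thesis using orthonormal_inner[OF on ab(2,1)] by (simp add: mult.commute)
qed

text \<open>The transformation law of jets. For order 0 the jet at the image point is
  \<open>H\<close> of the jet at \<open>x\<close>. For the step, the partials of
  \<open>J l \<circ> trans_map\<close> are the next jets at the image point times the Jacobian
  matrix, and multiplication by the inverse Jacobian isolates these jets.\<close>

lemma trans_jets_tame:
  assumes eq: "ck_equiv k U1 U1' H H'" and im: "H ` (U1 \<inter> N) = U1' \<inter> N"
    and lB: "l \<in> lists B" and lj: "length l \<le> j" and c: "c \<in> Basis"
  shows "tame B J (trans_dom B D U F U1 H) (length l) (k - length l) (\<lambda>x. J l (trans_map B F H x) \<bullet> c)"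
proof -
  let ?S = "trans_dom B D U F U1 H" and ?g = "trans_map B F H"
  let ?S' = "trans_dom B D U F U1' H'" and ?g' = "trans_map B F H'"
  note eq' = ck_equiv_sym[OF eq] and im' = ck_equiv_image_sym[OF eq im]
  have on: "orthonormal B" by (rule patch_basis)
  have fin: "finite B" using on by (simp add: orthonormal_def)
  have SD: "?S \<subseteq> D" "?S' \<subseteq> D" by (auto simp: trans_dom_def)
  obtain G where G: "\<And>a b. a \<in> B \<Longrightarrow> b \<in> B \<Longrightarrow> tame B J ?S 1 (k - 1) (G a b)"
    "\<And>a. a \<in> B \<Longrightarrow> has_partials B ?S (\<lambda>x. ?g x \<bullet> a) (G a)"
    using trans_partials[OF eq] by blast
  obtain G' where G': "\<And>a b. a \<in> B \<Longrightarrow> b \<in> B \<Longrightarrow> tame B J ?S' 1 (k - 1) (G' a b)"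
    "\<And>a. a \<in> B \<Longrightarrow> has_partials B ?S' (\<lambda>x. ?g' x \<bullet> a) (G' a)"
    using trans_partials[OF eq'] by blast
  define K where "K a b x = G' a b (?g x)" for a b x
  have KG: "(\<Sum>c\<in>B. K a c x * G c b x) = (if a = b then 1 else 0)" if "x \<in> ?S" "a \<in> B" "b \<in> B" for x a b
    unfolding K_def by (rule trans_matrix_inverse[OF eq im G(2) G'(2) that])
  \<comment> \<open>The previous identity with \<open>H\<close> and \<open>H'\<close> exchanged,
    taken at the image point. The round trip ends at \<open>proj B x\<close>, and
    \<open>has_partials_proj\<close> leads back to \<open>x\<close>.\<close>
  have GK: "(\<Sum>c\<in>B. G a c x * K c b x) = (if a = b then 1 else 0)" if x: "x \<in> ?S" and ab: "a \<in> B" "b \<in> B" for x a b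
  proof -
    note tp = trans_properties[OF eq im x]
    have "(\<Sum>c\<in>B. G a c (?g' (?g x)) * G' c b (?g x)) = (if a = b then 1 else 0)"
      by (rule trans_matrix_inverse[OF eq' im' G'(2) G(2) tp(2) ab])
    moreover have "G a c (proj B x) = G a c x" if "c \<in> B" for c
    proof (rule has_partials_proj[OF on G(2)[OF ab(1)] trans_dom_open[OF eq] _ x tp(5) that])
      show "?g (proj B y) \<bullet> a = ?g y \<bullet> a" if "y \<in> ?S" for y
        using trans_properties(4)[OF eq im that] by simp
    qed
    ultimately show ?thesis unfolding tp(3) K_def by simp
  qed
  \<comment> \<open>\<open>K\<close> is defined by composition with \<open>trans_map\<close>, a form
    outside the tame expressions. As the inverse of the tame matrix \<open>G\<close> it is tame once
    it is known to be continuous.\<close>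
  have K: "tame B J ?S 1 (k - 1) (K a b)" if "a \<in> B" "b \<in> B" for a b
  proof (rule tame.inv[where A = G, OF G(1) _ GK KG that])
    fix a b assume "a \<in> B" "b \<in> B"
    then have "continuous_on ?S' (G' a b)"
      using tame_continuous_on[OF G'(1) jet _ SD(2)] j by simp
    then show "continuous_on ?S (K a b)"
      unfolding K_def
      by (rule continuous_on_compose2[OF _ trans_continuous[OF eq]]) (use trans_properties(2)[OF eq im] in auto)
  qed
  show ?thesis
    using lB lj c
  proof (induction rule: lists.induct)
    case Nil
    have "ck_on k UNIV U1 (\<lambda>z. H z \<bullet> c)"
      using eq by (auto simp: ck_equiv_def intro: ck_on_bounded_linear[OF bounded_linear_inner_left])
    then have "tame B J ?S 0 k (\<lambda>x. H (J [] x) \<bullet> c)"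
      by (rule tame.comp[where \<Phi> = "\<lambda>z. H z \<bullet> c"])
         (use eq J0 in \<open>auto simp: ck_equiv_def trans_dom_def\<close>)
    then have "tame B J ?S 0 k (\<lambda>x. J [] (?g x) \<bullet> c)"
    proof (rule tame.cong)
      fix x assume x: "x \<in> ?S"
      have "?g x \<in> D" using trans_properties(2)[OF eq im x] SD by auto
      then show "J [] (?g x) \<bullet> c = H (J [] x) \<bullet> c"
        using J0 SD x trans_properties(1)[OF eq im x] by auto
    qed
    then show ?case by simp
  next
    case (Cons a l)
    let ?w = "\<lambda>x. J l (?g x) \<bullet> c"
    have l: "l \<in> lists B" "length l < j" "a \<in> B"
      using Cons.hyps Cons.prems by auto
    have ks: "k - length l = Suc (k - Suc (length l))" using l j by simp
    have "tame B J ?S (length l) (k - length l) ?w" using Cons l by auto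
    from tame_has_partials[OF this jet fin trans_dom_open[OF eq] SD(1) ks l(2)]
    obtain w' where w': "has_partials B ?S ?w w'" "\<And>b. b \<in> B \<Longrightarrow> tame B J ?S (Suc (length l)) (k - Suc (length l)) (w' b)"
      by blast
    have w'_eq: "w' b x = (\<Sum>d\<in>B. (J (d # l) (?g x) \<bullet> c) * G d b x)" if x: "x \<in> ?S" and b: "b \<in> B" for x b
    proof -
      have gD: "?g x \<in> D" using trans_properties(2)[OF eq im x] SD by auto
      have d1: "((\<lambda>y. J l y \<bullet> c) has_derivative (\<lambda>v. (\<Sum>d\<in>B. (v \<bullet> d) *\<^sub>R J (d # l) (?g x)) \<bullet> c)) (at (?g x))"
        by (rule bounded_linear.has_derivative[OF bounded_linear_inner_left jet_family_has_derivative[OF jet l(1,2) gD]])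
      have "((\<lambda>x. J l (?g x) \<bullet> c) has_derivative
          (\<lambda>v. (\<Sum>d\<in>B. ((\<Sum>a\<in>B. (\<Sum>b\<in>B. (v \<bullet> b) *\<^sub>R G a b x) *\<^sub>R a) \<bullet> d) *\<^sub>R J (d # l) (?g x)) \<bullet> c)) (at x)"
        using diff_chain_at[OF trans_map_has_derivative[OF G(2) x] d1] by (simp add: comp_def)
      moreover have "(?w has_derivative (\<lambda>v. \<Sum>b\<in>B. (v \<bullet> b) *\<^sub>R w' b x)) (at x)"
        using w' x by (auto simp: has_partials_def)
      ultimately have "(\<lambda>v. \<Sum>b\<in>B. (v \<bullet> b) *\<^sub>R w' b x) =
          (\<lambda>v. (\<Sum>d\<in>B. ((\<Sum>a\<in>B. (\<Sum>b\<in>B. (v \<bullet> b) *\<^sub>R G a b x) *\<^sub>R a) \<bullet> d) *\<^sub>R J (d # l) (?g x)) \<bullet> c)"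
        using has_derivative_unique by blast
      from fun_cong[OF this, of b]
      have "w' b x = (\<Sum>d\<in>B. ((\<Sum>a\<in>B. (\<Sum>e\<in>B. (b \<bullet> e) *\<^sub>R G a e x) *\<^sub>R a) \<bullet> d) *\<^sub>R J (d # l) (?g x)) \<bullet> c"
        by (simp only: dual_sum[OF on b])
      also have "\<dots> = (\<Sum>d\<in>B. ((\<Sum>a\<in>B. G a b x *\<^sub>R a) \<bullet> d) *\<^sub>R J (d # l) (?g x)) \<bullet> c"
        by (simp only: dual_sum[OF on b])
      also have "\<dots> = (\<Sum>d\<in>B. G d b x *\<^sub>R J (d # l) (?g x)) \<bullet> c"
      proof -
        have "(\<Sum>a\<in>B. G a b x *\<^sub>R a) \<bullet> d = G d b x" if d: "d \<in> B" for d
        proof -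
          have "(\<Sum>a\<in>B. G a b x *\<^sub>R a) \<bullet> d = (\<Sum>a\<in>B. (d \<bullet> a) *\<^sub>R G a b x)"
            by (simp add: inner_sum_left) (simp add: inner_commute mult.commute)
          then show ?thesis using dual_sum[OF on d, of "\<lambda>a. G a b x"] by simp
        qed
        then show ?thesis by simp
      qed
      finally show ?thesis by (simp add: inner_sum_left mult.commute)
    qed
    \<comment> \<open>Right multiplication by the inverse Jacobian solves \<open>w'_eq\<close> for
      the jet \<open>a # l\<close>.\<close>
    have "tame B J ?S (Suc (length l)) (k - Suc (length l)) (\<lambda>x. \<Sum>b\<in>B. w' b x * K b a x)"
      using l(3) by (intro tame_sum tame.mult w' tame_mono[OF K]) auto
    then have "tame B J ?S (Suc (length l)) (k - Suc (length l)) (\<lambda>x. J (a # l) (?g x) \<bullet> c)"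
    proof (rule tame.cong)
      fix x assume x: "x \<in> ?S"
      have "(\<Sum>b\<in>B. w' b x * K b a x) = (\<Sum>b\<in>B. \<Sum>d\<in>B. (J (d # l) (?g x) \<bullet> c) * (G d b x * K b a x))"
        by (intro sum.cong) (simp_all add: w'_eq[OF x] sum_distrib_right mult.assoc)
      also have "\<dots> = (\<Sum>d\<in>B. (J (d # l) (?g x) \<bullet> c) * (\<Sum>b\<in>B. G d b x * K b a x))"
        by (subst sum.swap) (simp add: sum_distrib_left)
      also have "\<dots> = (\<Sum>d\<in>B. if d = a then J (d # l) (?g x) \<bullet> c else 0)"
        by (intro sum.cong) (simp_all add: GK[OF x _ l(3)])
      also have "\<dots> = J (a # l) (?g x) \<bullet> c" using fin l(3) by simp
      finally show "J (a # l) (?g x) \<bullet> c = (\<Sum>b\<in>B. w' b x * K b a x)" by simp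
    qed
    then show ?case by simp
  qed
qed

end

end

section \<open>Regularity of jets\<close>

text \<open>A finite family with biorthogonal bounded functionals behaves like a basis of a
  Euclidean space. Compactness of the balls holds because the functionals bound the
  coefficients.\<close>

lemma
  fixes e :: "'k \<Rightarrow> 'z::real_normed_vector" and \<xi> :: "'k \<Rightarrow> 'z \<Rightarrow> real"
  assumes fin: "finite I" and lin: "\<And>k. k \<in> I \<Longrightarrow> bounded_linear (\<xi> k)"
    and dual: "\<And>k m. k \<in> I \<Longrightarrow> m \<in> I \<Longrightarrow> \<xi> k (e m) = (if k = m then 1 else 0)"
  shows dual_coord: "k \<in> I \<Longrightarrow> \<xi> k (\<Sum>m\<in>I. f m *\<^sub>R e m) = f k"
    and dual_subspace: "subspace (range (\<lambda>f. \<Sum>m\<in>I. f m *\<^sub>R e m))"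
    and dual_compact_balls: "compact (range (\<lambda>f. \<Sum>m\<in>I. f m *\<^sub>R e m) \<inter> cball 0 r)"
proof -
  show coord: "\<xi> k (\<Sum>m\<in>I. f m *\<^sub>R e m) = f k" if k: "k \<in> I" for k f
  proof -
    have l: "linear (\<xi> k)" using lin[OF k] by (rule bounded_linear.linear)
    have "\<xi> k (\<Sum>m\<in>I. f m *\<^sub>R e m) = (\<Sum>m\<in>I. if k = m then f m else 0)"
      unfolding linear_sum[OF l] linear_scale[OF l] by (intro sum.cong) (auto simp: dual k)
    also have "\<dots> = f k" using fin k by simp
    finally show ?thesis .
  qed
  show "subspace (range (\<lambda>f. \<Sum>m\<in>I. f m *\<^sub>R e m))"
  proof (rule subspaceI)
    show "0 \<in> range (\<lambda>f. \<Sum>m\<in>I. f m *\<^sub>R e m)" by (rule range_eqI[of _ _ "\<lambda>_. 0"]) simp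
    fix x y assume "x \<in> range (\<lambda>f. \<Sum>m\<in>I. f m *\<^sub>R e m)" "y \<in> range (\<lambda>f. \<Sum>m\<in>I. f m *\<^sub>R e m)"
    then obtain f g where "x = (\<Sum>m\<in>I. f m *\<^sub>R e m)" "y = (\<Sum>m\<in>I. g m *\<^sub>R e m)" by auto
    then show "x + y \<in> range (\<lambda>f. \<Sum>m\<in>I. f m *\<^sub>R e m)"
      by (intro range_eqI[of _ _ "\<lambda>m. f m + g m"]) (simp add: scaleR_add_left sum.distrib)
  next
    fix c x assume "x \<in> range (\<lambda>f. \<Sum>m\<in>I. f m *\<^sub>R e m)"
    then obtain f where "x = (\<Sum>m\<in>I. f m *\<^sub>R e m)" by auto
    then show "c *\<^sub>R x \<in> range (\<lambda>f. \<Sum>m\<in>I. f m *\<^sub>R e m)"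
      by (intro range_eqI[of _ _ "\<lambda>m. c * f m"]) (simp add: scaleR_right.sum)
  qed
  \<comment> \<open>Adding one vector at a time, the set is the continuous image of a product with a
    compact interval.\<close>
  have cb: "compact {\<Sum>m\<in>A. f m *\<^sub>R e m |f. \<forall>m\<in>A. \<bar>f m\<bar> \<le> s}" if "finite A" for A s
    using that
  proof (induction A)
    case empty
    then show ?case by simp
  next
    case (insert a A)
    let ?K = "\<lambda>A. {\<Sum>m\<in>A. f m *\<^sub>R e m |f. \<forall>m\<in>A. \<bar>f m\<bar> \<le> s}"
    have "?K (insert a A) = (\<lambda>(z, t). z + t *\<^sub>R e a) ` (?K A \<times> {-s..s})" (is "?L = ?R")
    proof
      show "?L \<subseteq> ?R"
      proof
        fix z assume "z \<in> ?L"
        then obtain f where f: "z = (\<Sum>m\<in>insert a A. f m *\<^sub>R e m)" "\<forall>m\<in>insert a A. \<bar>f m\<bar> \<le> s" by auto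
        then have "z = (\<Sum>m\<in>A. f m *\<^sub>R e m) + f a *\<^sub>R e a" using insert by (simp add: add.commute)
        moreover have "(\<Sum>m\<in>A. f m *\<^sub>R e m) \<in> ?K A" using f by auto
        moreover have "f a \<in> {-s..s}" using f(2) by (auto simp: abs_le_iff)
        ultimately show "z \<in> ?R" by (intro image_eqI[of _ _ "(\<Sum>m\<in>A. f m *\<^sub>R e m, f a)"]) auto
      qed
      show "?R \<subseteq> ?L"
      proof
        fix z assume "z \<in> ?R"
        then obtain f t where f: "z = (\<Sum>m\<in>A. f m *\<^sub>R e m) + t *\<^sub>R e a" "\<forall>m\<in>A. \<bar>f m\<bar> \<le> s" "t \<in> {-s..s}" by auto
        have "(\<Sum>m\<in>A. (f(a := t)) m *\<^sub>R e m) = (\<Sum>m\<in>A. f m *\<^sub>R e m)"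
          using insert by (intro sum.cong) auto
        then have "z = (\<Sum>m\<in>insert a A. (f(a := t)) m *\<^sub>R e m)" using insert f(1) by (simp add: add.commute)
        moreover have "\<forall>m\<in>insert a A. \<bar>(f(a := t)) m\<bar> \<le> s" using f by (auto simp: abs_le_iff)
        ultimately show "z \<in> ?L" by blast
      qed
    qed
    moreover have "compact \<dots>"
      using insert.IH
      by (intro compact_continuous_image compact_Times compact_Icc)
         (auto intro!: continuous_intros simp: case_prod_unfold)
    ultimately show ?case by simp
  qed
  have "\<exists>L>0. \<forall>z. \<bar>\<xi> k z\<bar> \<le> norm z * L" if "k \<in> I" for k
    using bounded_linear.pos_bounded[OF lin[OF that]] by auto
  then obtain L where L: "\<And>k. k \<in> I \<Longrightarrow> L k > 0" "\<And>k z. k \<in> I \<Longrightarrow> \<bar>\<xi> k z\<bar> \<le> norm z * L k" by metis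
  define s where "s = \<bar>r\<bar> * (\<Sum>k\<in>I. L k)"
  have "range (\<lambda>f. \<Sum>m\<in>I. f m *\<^sub>R e m) \<inter> cball 0 r = {\<Sum>m\<in>I. f m *\<^sub>R e m |f. \<forall>m\<in>I. \<bar>f m\<bar> \<le> s} \<inter> cball 0 r"
  proof (intro equalityI subsetI)
    fix z assume z: "z \<in> range (\<lambda>f. \<Sum>m\<in>I. f m *\<^sub>R e m) \<inter> cball 0 r"
    then obtain f where f: "z = (\<Sum>m\<in>I. f m *\<^sub>R e m)" by auto
    have "\<bar>f m\<bar> \<le> s" if m: "m \<in> I" for m
    proof -
      have "\<bar>f m\<bar> \<le> norm z * L m" using L(2)[OF m, of z] coord[OF m, of f] f by simp
      also have "\<dots> \<le> \<bar>r\<bar> * (\<Sum>k\<in>I. L k)"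
        using z L(1) m fin by (intro mult_mono member_le_sum) (auto intro: less_imp_le)
      finally show ?thesis by (simp add: s_def)
    qed
    with f z show "z \<in> {\<Sum>m\<in>I. f m *\<^sub>R e m |f. \<forall>m\<in>I. \<bar>f m\<bar> \<le> s} \<inter> cball 0 r" by auto
  qed auto
  then show "compact (range (\<lambda>f. \<Sum>m\<in>I. f m *\<^sub>R e m) \<inter> cball 0 r)"
    using compact_Int_closed[OF cb[OF fin]] by simp
qed

text \<open>Both points vary, which encodes continuity of the derivative along with its
  existence.\<close>

definition strict_deriv :: "'e::euclidean_space set \<Rightarrow> ('e \<Rightarrow> real) \<Rightarrow> 'e \<Rightarrow> 'e \<Rightarrow> bool" where
  "strict_deriv W f x \<eta> \<longleftrightarrow> (\<forall>e>0. \<exists>d>0. \<forall>x'\<in>W. \<forall>x''\<in>W. dist x' x < d \<longrightarrow> dist x'' x < d \<longrightarrow>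
     \<bar>f x' - f x'' - \<eta> \<bullet> (x' - x'')\<bar> \<le> e * norm (x' - x''))"

context
  fixes N B D U :: "'e::euclidean_space set" and F C
    and J :: "'e list \<Rightarrow> 'e \<Rightarrow> 'e" and j k :: nat
    and e :: "'e list \<times> 'e \<Rightarrow> 'z::real_normed_vector" and \<xi> :: "'e list \<times> 'e \<Rightarrow> 'z \<Rightarrow> real"
  assumes patch: "graph_patch N B D U F C"
    and jet: "jet_family B D J j" and J0: "\<And>x. x \<in> D \<Longrightarrow> J [] x = F (proj B x)"
    and j: "0 < j" "j < k"
    and lin: "\<And>i. i \<in> jet_index B j \<Longrightarrow> bounded_linear (\<xi> i)"
    and dual: "\<And>i m. i \<in> jet_index B j \<Longrightarrow> m \<in> jet_index B j \<Longrightarrow> \<xi> i (e m) = (if i = m then 1 else 0)"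
begin

definition jet_embed :: "'e \<Rightarrow> 'z" where "jet_embed x = (\<Sum>i\<in>(jet_index B j). jet_coord J i x *\<^sub>R e i)"

text \<open>The 0-jet as a linear function of the jet: on \<open>jet_embed x\<close> it is the point
  of the graph over \<open>x\<close>. Vertical vectors are the elements of its kernel.\<close>

definition jet_base :: "'z \<Rightarrow> 'e" where "jet_base z = (\<Sum>c\<in>Basis. \<xi> ([], c) z *\<^sub>R c)"

lemma fin_I: "finite (jet_index B j)"
  using patch_basis(1)[OF patch] by (auto simp: orthonormal_def intro: finite_jet_index)

lemma bounded_linear_jet_base: "bounded_linear jet_base"
  unfolding jet_base_def
  by (intro bounded_linear_sum bounded_linear_scaleR_const lin) (auto simp: jet_index_def)

lemma coord_embed: "i \<in> (jet_index B j) \<Longrightarrow> \<xi> i (jet_embed x) = jet_coord J i x"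
  unfolding jet_embed_def by (rule dual_coord[OF fin_I lin dual])

lemma base_embed: "x \<in> D \<Longrightarrow> jet_base (jet_embed x) = F (proj B x)"
proof -
  assume x: "x \<in> D"
  have "jet_base (jet_embed x) = (\<Sum>c\<in>Basis. (J [] x \<bullet> c) *\<^sub>R c)"
    unfolding jet_base_def
    by (intro sum.cong refl) (subst coord_embed, auto simp: jet_index_def jet_coord_def)
  then show ?thesis using J0[OF x] by (simp add: euclidean_representation)
qed

lemma proj_base_embed: "x \<in> D \<Longrightarrow> proj B (jet_base (jet_embed x)) = proj B x"
  using base_embed patch_graph(2)[OF patch] by simp

lemma embed_tendsto:
  assumes "\<And>n. X n \<in> D" "x \<in> D" "X \<longlonglongrightarrow> x"
  shows "(\<lambda>n. jet_embed (X n)) \<longlonglongrightarrow> jet_embed x"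
  unfolding jet_embed_def jet_coord_def
proof (intro tendsto_intros)
  fix i assume "i \<in> (jet_index B j)"
  then have "continuous_on D (J (fst i))"
    by (auto simp: jet_index_def intro: jet_family_continuous_on[OF jet])
  then show "(\<lambda>n. J (fst i) (X n)) \<longlonglongrightarrow> J (fst i) x"
    using assms unfolding continuous_on_sequentially comp_def by blast
qed

text \<open>The operators are assembled from the coefficients that \<open>tame_jet_secant\<close>
  yields for each transformed coordinate; order \<open>j < k\<close> leaves the derivative it needs.
  The 0-jet is transformed by \<open>H\<close> itself, so a secant operator of \<open>H\<close>
  describes the base component and vertical cone vectors stay vertical.\<close>

lemma trans_secant_map:
  assumes eq: "ck_equiv k U1 U1' H H'" and im: "H ` (U1 \<inter> N) = U1' \<inter> N"
  obtains A where
    "secant_map (\<lambda>z. jet_embed (trans_map B F H (proj B (jet_base z)))) A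
       (jet_embed ` (span B \<inter> trans_dom B D U F U1 H))"
    "\<And>c v. c \<in> jet_embed ` (span B \<inter> trans_dom B D U F U1 H) \<Longrightarrow>
       v \<in> pcone (jet_embed ` (span B \<inter> trans_dom B D U F U1 H)) c \<Longrightarrow> jet_base v = 0 \<Longrightarrow> jet_base (A c c v) = 0"
proof -
  let ?S = "trans_dom B D U F U1 H" and ?g = "trans_map B F H" and ?p = "\<lambda>z. proj B (jet_base z)"
  let ?M = "jet_embed ` (span B \<inter> ?S)" and ?h = "\<lambda>z. jet_embed (trans_map B F H (proj B (jet_base z)))"
  have on: "orthonormal B" by (rule patch_basis[OF patch])
  have fin: "finite B" using on by (simp add: orthonormal_def)
  have SD: "?S \<subseteq> D" by (auto simp: trans_dom_def)
  have "\<exists>a. jet_secant B J j ?S (\<lambda>x. jet_coord J i (?g x)) a" if i: "i \<in> (jet_index B j)" for i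
  proof -
    obtain l c where lc: "i = (l, c)" "l \<in> lists B" "length l \<le> j" "c \<in> Basis" using i by (auto simp: jet_index_def)
    have "tame B J ?S (length l) (k - length l) (\<lambda>x. J l (?g x) \<bullet> c)"
      by (rule trans_jets_tame[OF patch jet J0 j eq im lc(2-4)])
    from tame_jet_secant[OF this jet fin SD lc(3)] lc j show ?thesis by (simp add: jet_coord_def)
  qed
  then obtain a where a: "\<And>i. i \<in> (jet_index B j) \<Longrightarrow> jet_secant B J j ?S (\<lambda>x. jet_coord J i (?g x)) (a i)" by metis
  define A where "A z z' y = (\<Sum>i\<in>(jet_index B j). (\<Sum>m\<in>(jet_index B j). a i m (?p z) (?p z') * \<xi> m y) *\<^sub>R e i)" for z z' y
  have lp: "bounded_linear ?p" by (rule bounded_linear_compose[OF bounded_linear_proj bounded_linear_jet_base])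
  have pM: "?p (jet_embed x) = x" if "x \<in> span B \<inter> ?S" for x
    using that SD proj_span[OF on] proj_base_embed by auto
  have linA: "linear (A z z')" for z z'
    unfolding A_def
    by (intro linear_compose_sum ballI bounded_linear.linear bounded_linear_scaleR_const bounded_linear_sum bounded_linear_const_mult lin)
  have secA: "?h z - ?h z' = A z z' (z - z')" if z: "z \<in> ?M" "z' \<in> ?M" for z z'
  proof -
    obtain x x' where x: "z = jet_embed x" "x \<in> span B \<inter> ?S" "z' = jet_embed x'" "x' \<in> span B \<inter> ?S"
      using z by blast
    have "?h z - ?h z' = jet_embed (?g x) - jet_embed (?g x')"
      unfolding x(1,3) pM[OF x(2)] pM[OF x(4)] ..
    also have "\<dots> = (\<Sum>i\<in>(jet_index B j). (jet_coord J i (?g x) - jet_coord J i (?g x')) *\<^sub>R e i)"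
      by (simp add: jet_embed_def sum_subtractf scaleR_diff_left)
    also have "\<dots> = A z z' (z - z')"
      unfolding A_def
    proof (intro sum.cong refl arg_cong2[of _ _ _ _ scaleR])
      fix i assume i: "i \<in> (jet_index B j)"
      have "jet_coord J i (?g x) - jet_coord J i (?g x') = (\<Sum>m\<in>(jet_index B j). a i m x x' * (jet_coord J m x - jet_coord J m x'))"
        using a[OF i] x by (auto simp: jet_secant_def)
      also have "\<dots> = (\<Sum>m\<in>(jet_index B j). a i m (?p z) (?p z') * \<xi> m (z - z'))"
        unfolding x(1,3) pM[OF x(2)] pM[OF x(4)]
        by (intro sum.cong refl) (simp add: linear_diff[OF bounded_linear.linear[OF lin]] coord_embed)
      finally show "jet_coord J i (?g x) - jet_coord J i (?g x') = (\<Sum>m\<in>(jet_index B j). a i m (?p z) (?p z') * \<xi> m (z - z'))" .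
    qed
    finally show ?thesis .
  qed
  have sm: "secant_map ?h A ?M"
    unfolding secant_map_def
  proof (intro conjI allI ballI impI linA secA)
    fix c X Y V and v :: 'z assume *: "c \<in> ?M" "\<forall>n::nat. X n \<in> ?M \<and> Y n \<in> ?M" "X \<longlonglongrightarrow> c" "Y \<longlonglongrightarrow> c" "V \<longlonglongrightarrow> v"
    have pS: "?p z \<in> ?S" if "z \<in> ?M" for z using that pM by auto
    have X: "(\<lambda>n. ?p (X n)) \<longlonglongrightarrow> ?p c" "(\<lambda>n. ?p (Y n)) \<longlonglongrightarrow> ?p c"
      by (rule bounded_linear.tendsto[OF lp *(3)], rule bounded_linear.tendsto[OF lp *(4)])
    show "(\<lambda>n. A (X n) (Y n) (V n)) \<longlonglongrightarrow> A c c v"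
      unfolding A_def
    proof (intro tendsto_intros)
      fix i m assume im: "i \<in> (jet_index B j)" "m \<in> (jet_index B j)"
      have "\<And>c X Y. c \<in> ?S \<Longrightarrow> (\<forall>n::nat. X n \<in> ?S \<and> Y n \<in> ?S) \<Longrightarrow> X \<longlonglongrightarrow> c \<Longrightarrow> Y \<longlonglongrightarrow> c \<Longrightarrow>
          (\<lambda>n. a i m (X n) (Y n)) \<longlonglongrightarrow> a i m c c"
        using a[OF im(1)] im(2) unfolding jet_secant_def by blast
      from this[OF pS[OF *(1)] _ X] show "(\<lambda>n. a i m (?p (X n)) (?p (Y n))) \<longlonglongrightarrow> a i m (?p c) (?p c)"
        using pS *(2) by simp
      show "(\<lambda>n. \<xi> m (V n)) \<longlonglongrightarrow> \<xi> m v" by (rule bounded_linear.tendsto[OF lin[OF im(2)] *(5)])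
    qed
  qed
  moreover have "jet_base (A c c v) = 0" if c: "c \<in> ?M" and v: "v \<in> pcone ?M c" "jet_base v = 0" for c v
  proof -
    have lb: "linear jet_base" by (rule bounded_linear.linear[OF bounded_linear_jet_base])
    have U1: "open U1" "ck_on (Suc (k - 1)) UNIV U1 H" using eq j by (auto simp: ck_equiv_def)
    obtain AH where AH: "secant_map H AH U1" using C1_secant_map[OF U1] by blast
    obtain X Y t where *: "\<forall>n. X n \<in> ?M \<and> Y n \<in> ?M \<and> 0 < (t n::real)" "X \<longlonglongrightarrow> c" "Y \<longlonglongrightarrow> c"
        "(\<lambda>n. (X n - Y n) /\<^sub>R t n) \<longlonglongrightarrow> v"
      using v(1) by (auto simp: pcone_def)
    \<comment> \<open>The projection to the 0-jet intertwines the action on jets with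
      \<open>H\<close>.\<close>
    have bM: "jet_base z \<in> U1" "jet_base (?h z) = H (jet_base z)" if z: "z \<in> ?M" for z
    proof -
      obtain x where x: "z = jet_embed x" "x \<in> span B" "x \<in> ?S" using z by blast
      have b: "jet_base z = F (proj B x)" using x SD base_embed by auto
      then show "jet_base z \<in> U1" using x by (auto simp: trans_dom_def)
      have "?g x \<in> D" using trans_properties(2)[OF patch eq im x(3)] by (auto simp: trans_dom_def)
      then show "jet_base (?h z) = H (jet_base z)"
        using x pM[of x] b base_embed trans_properties(1)[OF patch eq im x(3)] by auto
    qed
    have 1: "(\<lambda>n. jet_base (A (X n) (Y n) ((X n - Y n) /\<^sub>R t n))) \<longlonglongrightarrow> jet_base (A c c v)"
      by (intro bounded_linear.tendsto[OF bounded_linear_jet_base] secant_map_tendsto[OF sm c] * always_eventually) (use * in auto)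
    have 2: "(\<lambda>n. AH (jet_base (X n)) (jet_base (Y n)) (jet_base ((X n - Y n) /\<^sub>R t n))) \<longlonglongrightarrow>
        AH (jet_base c) (jet_base c) (jet_base v)"
      by (intro secant_map_tendsto[OF AH] bM c bounded_linear.tendsto[OF bounded_linear_jet_base] * always_eventually)
         (use * bM in auto)
    have "jet_base (A (X n) (Y n) ((X n - Y n) /\<^sub>R t n)) =
        AH (jet_base (X n)) (jet_base (Y n)) (jet_base ((X n - Y n) /\<^sub>R t n))" for n
    proof -
      have M: "X n \<in> ?M" "Y n \<in> ?M" using * by auto
      have lAH: "linear (AH x y)" for x y using AH by (simp add: secant_map_def)
      have "jet_base (A (X n) (Y n) (X n - Y n)) = H (jet_base (X n)) - H (jet_base (Y n))"
        unfolding secA[OF M, symmetric] linear_diff[OF lb] bM(2)[OF M(1)] bM(2)[OF M(2)] ..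
      also have "\<dots> = AH (jet_base (X n)) (jet_base (Y n)) (jet_base (X n) - jet_base (Y n))"
        using AH bM(1)[OF M(1)] bM(1)[OF M(2)] unfolding secant_map_def by blast
      finally show ?thesis
        by (simp add: linear_scale[OF linA] linear_scale[OF lb] linear_scale[OF lAH] linear_diff[OF lb])
    qed
    with 1 2 have "jet_base (A c c v) = AH (jet_base c) (jet_base c) (jet_base v)"
      using LIMSEQ_unique by simp
    moreover have "linear (AH (jet_base c) (jet_base c))" using AH by (simp add: secant_map_def)
    ultimately show ?thesis using v(2) linear_0 by metis
  qed
  ultimately show ?thesis by (rule that)
qed

text \<open>The set of jets is parametrised by \<open>span B \<inter> D\<close>, and any two of its
  points are matched by a diffeomorphism that matches the underlying points of the graph.\<close>

lemma jets_secant_homogeneous: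
  assumes hom: "ck_homog k N" and K: "K = UNIV \<or> K = {v. jet_base v = 0}"
  shows "secant_homogeneous (jet_embed ` (span B \<inter> D)) K"
  unfolding secant_homogeneous_def
proof (intro ballI)
  let ?M = "jet_embed ` (span B \<inter> D)" and ?p = "\<lambda>z. proj B (jet_base z)"
  fix z0 z1 assume "z0 \<in> ?M" "z1 \<in> ?M"
  then obtain x0 x1 where x: "z0 = jet_embed x0" "x0 \<in> span B" "x0 \<in> D" "z1 = jet_embed x1" "x1 \<in> span B" "x1 \<in> D" by blast
  have on: "orthonormal B" by (rule patch_basis[OF patch])
  have px: "proj B x0 = x0" "proj B x1 = x1" using x proj_span[OF on] by auto
  have FN: "F x0 \<in> N" "F x0 \<in> U" "F x1 \<in> N" "F x1 \<in> U" "proj B (F x1) = x1"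
    using patch_graph[OF patch x(3)] patch_graph[OF patch x(6)] px by auto
  obtain U1 U1' H H' where eq: "ck_equiv k U1 U1' H H'" and H: "F x0 \<in> U1" "H (F x0) = F x1" and im: "H ` (U1 \<inter> N) = U1' \<inter> N"
    using hom FN unfolding ck_homog_def by blast
  note eq' = ck_equiv_sym[OF eq] and im' = ck_equiv_image_sym[OF eq im]
  let ?S = "trans_dom B D U F U1 H" and ?g = "trans_map B F H"
  let ?S' = "trans_dom B D U F U1' H'" and ?g' = "trans_map B F H'"
  let ?T = "jet_embed ` (span B \<inter> ?S)" and ?T' = "jet_embed ` (span B \<inter> ?S')"
  let ?h = "\<lambda>z. jet_embed (?g (?p z))" and ?h' = "\<lambda>z. jet_embed (?g' (?p z))"
  obtain A where A: "secant_map ?h A ?T" "\<And>c v. c \<in> ?T \<Longrightarrow> v \<in> pcone ?T c \<Longrightarrow> jet_base v = 0 \<Longrightarrow> jet_base (A c c v) = 0"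
    using trans_secant_map[OF eq im] by blast
  obtain A' where A': "secant_map ?h' A' ?T'" "\<And>c v. c \<in> ?T' \<Longrightarrow> v \<in> pcone ?T' c \<Longrightarrow> jet_base v = 0 \<Longrightarrow> jet_base (A' c c v) = 0"
    using trans_secant_map[OF eq' im'] by blast
  have SD: "?S \<subseteq> D" "?S' \<subseteq> D" by (auto simp: trans_dom_def)
  have pe: "?p (jet_embed x) = x" if "x \<in> span B" "x \<in> D" for x
    using that proj_span[OF on] proj_base_embed by auto
  have lp: "continuous_on UNIV ?p"
    by (intro linear_continuous_on bounded_linear_compose[OF bounded_linear_proj bounded_linear_jet_base])
  \<comment> \<open>The projection \<open>?p\<close> is a continuous left inverse of the embedding,
    so relatively open pieces of the base give relatively open pieces of the set of jets.\<close>
  have op: "openin (top_of_set ?M) (jet_embed ` (span B \<inter> T))" if "open T" "T \<subseteq> D" for T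
  proof -
    have "jet_embed ` (span B \<inter> T) = ?M \<inter> ?p -` T" using pe that(2) by auto
    moreover have "open (?p -` T)" using open_vimage[OF that(1) lp] .
    ultimately show ?thesis by (simp add: openin_open_Int)
  qed
  have hh: "?h z \<in> ?T' \<and> ?h' (?h z) = z" if z: "z \<in> ?T" for z
  proof -
    obtain y where y: "z = jet_embed y" "y \<in> span B" "y \<in> ?S" using z by blast
    note tp = trans_properties[OF patch eq im y(3)]
    have "?p z = y" using y pe SD by auto
    moreover have "?p (jet_embed (?g y)) = ?g y" using tp(2,6) pe SD by auto
    ultimately show ?thesis using tp(2,3,6) y proj_span[OF on y(2)] by auto
  qed
  have hh': "?h' z \<in> ?T \<and> ?h (?h' z) = z" if z: "z \<in> ?T'" for z
  proof -
    obtain y where y: "z = jet_embed y" "y \<in> span B" "y \<in> ?S'" using z by blast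
    note tp = trans_properties[OF patch eq' im' y(3)]
    have "?p z = y" using y pe SD by auto
    moreover have "?p (jet_embed (?g' y)) = ?g' y" using tp(2,6) pe SD by auto
    ultimately show ?thesis using tp(2,3,6) y proj_span[OF on y(2)] by auto
  qed
  have x0S: "x0 \<in> ?S" using x px H FN by (auto simp: trans_dom_def)
  have gx0: "?g x0 = x1" by (simp add: trans_map_def px H FN)
  have "secant_equiv ?T ?T' ?h ?h' A A'"
    unfolding secant_equiv_def using hh hh' A(1) A'(1) by blast
  moreover have "openin (top_of_set ?M) ?T" "openin (top_of_set ?M) ?T'"
    by (intro op trans_dom_open[OF patch eq] trans_dom_open[OF patch eq'] SD)+
  moreover have "z0 \<in> ?T" using x x0S by auto
  moreover have "?h z0 = z1" using x pe gx0 by simp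
  moreover have "\<forall>c\<in>?T. \<forall>v\<in>pcone ?T c \<inter> K. A c c v \<in> K" "\<forall>c\<in>?T'. \<forall>v\<in>pcone ?T' c \<inter> K. A' c c v \<in> K"
    using K A(2) A'(2) by auto
  ultimately show "\<exists>S S' h h' A A'. openin (top_of_set ?M) S \<and> openin (top_of_set ?M) S' \<and> z0 \<in> S \<and> h z0 = z1 \<and>
     secant_equiv S S' h h' A A' \<and>
     (\<forall>c\<in>S. \<forall>v\<in>pcone S c \<inter> K. A c c v \<in> K) \<and> (\<forall>c\<in>S'. \<forall>v\<in>pcone S' c \<inter> K. A' c c v \<in> K)"
    by (intro exI[of _ ?T] exI[of _ ?T'] exI[of _ ?h] exI[of _ ?h'] exI[of _ A] exI[of _ A'] conjI)
qed

text \<open>The set of jets is a section over the base whose cones contain no vertical vectors, so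
  \<open>strict_derivative_of_section\<close> applies to each jet coordinate.\<close>

lemma jet_step_strict:
  assumes hom: "ck_homog k N" and x: "x \<in> span B" "x \<in> D"
    and l: "l \<in> lists B" "length l \<le> j" "c \<in> Basis"
  shows "\<exists>\<eta>\<in>span B. strict_deriv (span B \<inter> D) (\<lambda>x. J l x \<bullet> c) x \<eta>"
proof -
  let ?W = "span B \<inter> D" and ?p = "\<lambda>z. proj B (jet_base z)"
  let ?M = "jet_embed ` ?W" and ?Z = "range (\<lambda>f. \<Sum>m\<in>(jet_index B j). f m *\<^sub>R e m)"
  have on: "orthonormal B" by (rule patch_basis[OF patch])
  have lp: "bounded_linear ?p" by (rule bounded_linear_compose[OF bounded_linear_proj bounded_linear_jet_base])
  have pe: "?p (jet_embed x) = x" if "x \<in> span B" "x \<in> D" for x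
    using that proj_span[OF on] proj_base_embed by auto
  have MZ: "?M \<subseteq> ?Z" by (auto simp: jet_embed_def)
  have subZ: "subspace ?Z" by (rule dual_subspace[OF fin_I lin dual])
  have cZ: "compact (?Z \<inter> cball 0 r)" for r by (rule dual_compact_balls[OF fin_I lin dual])
  have ucont: "continuous_on D jet_embed"
    unfolding continuous_on_sequentially comp_def using embed_tendsto by blast
  have D: "open D" by (rule patch_basis[OF patch])
  have lc: "locally_compact_space (top_of_set ?M)"
    unfolding locally_compact_space_def
  proof
    fix z assume "z \<in> topspace (top_of_set ?M)"
    then obtain y where y: "z = jet_embed y" "y \<in> span B" "y \<in> D" by auto
    obtain r where r: "r > 0" "cball y r \<subseteq> D" using D y open_contains_cball by blast
    let ?Q = "?M \<inter> ?p -` ball y r" and ?K = "jet_embed ` (span B \<inter> cball y r)"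
    have "openin (top_of_set ?M) ?Q"
      by (intro openin_open_Int open_vimage linear_continuous_on lp open_ball)
    moreover have "compact ?K"
      using r by (intro compact_continuous_image continuous_on_subset[OF ucont] compact_Int_cball_subspace subspace_span) auto
    then have "compactin (top_of_set ?M) ?K" using r by (auto simp: compactin_subtopology)
    moreover have "z \<in> ?Q" using y r pe by auto
    moreover have "?Q \<subseteq> ?K" using pe by auto
    ultimately show "\<exists>U K. openin (top_of_set ?M) U \<and> compactin (top_of_set ?M) K \<and> z \<in> U \<and> U \<subseteq> K" by blast
  qed
  have PT: "pcone ?M a \<subseteq> tcone ?M a" if "a \<in> ?M" for a
    by (rule secant_homogeneous_cones(1)[OF lc MZ subZ cZ closed_UNIV jets_secant_homogeneous[OF hom] that]) simp
  have lscU: "cone_lsc ?M UNIV a" if "a \<in> ?M" for a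
    by (rule secant_homogeneous_cones(2)[OF lc MZ subZ cZ closed_UNIV jets_secant_homogeneous[OF hom] that]) simp
  have clK: "closed {v. jet_base v = 0}"
    by (intro closed_Collect_eq linear_continuous_on bounded_linear_jet_base continuous_on_const)
  \<comment> \<open>The generic points for the full cone and for its vertical part may differ;
    homogeneity carries both properties to every point.\<close>
  have lscK: "cone_lsc ?M {v. jet_base v = 0} a" if "a \<in> ?M" for a
    by (rule secant_homogeneous_cones(2)[OF lc MZ subZ cZ clK jets_secant_homogeneous[OF hom] that]) simp
  have PZ: "pcone ?M a \<subseteq> ?Z" for a
    by (rule pcone_subset_subspace[OF MZ subZ closed_if_compact_balls[OF cZ]])
  have uM: "jet_embed x \<in> ?M" using x by auto
  have vert: "v = 0" if v: "v \<in> pcone ?M (jet_embed x)" "jet_base v = 0" for v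
  proof -
    have inj: "z = jet_embed x" if z: "z \<in> ?M" "jet_base z = jet_base (jet_embed x)" for z
    proof -
      obtain y where y: "z = jet_embed y" "y \<in> span B" "y \<in> D" using z(1) by blast
      have "?p (jet_embed y) = ?p (jet_embed x)" using z(2) unfolding y(1) by (rule arg_cong)
      then have "y = x" by (simp only: pe[OF y(2,3)] pe[OF x])
      then show ?thesis by (simp only: y(1))
    qed
    have "\<xi> i v = 0" if i: "i \<in> (jet_index B j)" for i
      by (rule no_vertical_vector[OF lc MZ PT bounded_linear_jet_base inj uM lscK[OF uM] lin[OF i] v])
    moreover obtain f where f: "v = (\<Sum>m\<in>(jet_index B j). f m *\<^sub>R e m)" using PZ v(1) by blast
    ultimately have "f i = 0" if "i \<in> (jet_index B j)" for i using dual_coord[OF fin_I lin dual that, of f] that by auto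
    then show "v = 0" unfolding f by simp
  qed
  \<comment> \<open>The Lipschitz bound of the graph function passes to cone vectors in the limit:
    the base component is bounded by its projection to \<open>span B\<close>, so a vector killed by
    \<open>?p\<close> is vertical.\<close>
  have ker: "v = 0" if v: "v \<in> pcone ?M (jet_embed x)" "?p v = 0" for v
  proof (rule vert[OF v(1)])
    obtain X Y t where *: "\<forall>n. X n \<in> ?M \<and> Y n \<in> ?M \<and> 0 < (t n::real)"
        "(\<lambda>n. (X n - Y n) /\<^sub>R t n) \<longlonglongrightarrow> v"
      using v(1) by (auto simp: pcone_def)
    have lb: "linear jet_base" "linear ?p"
      using bounded_linear_jet_base lp by (auto intro: bounded_linear.linear)
    have "norm (jet_base ((X n - Y n) /\<^sub>R t n)) \<le> C * norm (?p ((X n - Y n) /\<^sub>R t n))" for n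
    proof -
      obtain y y' where y: "X n = jet_embed y" "y \<in> span B" "y \<in> D" "Y n = jet_embed y'" "y' \<in> span B" "y' \<in> D"
        using * by blast
      have t: "t n > 0" using * by auto
      have b: "jet_base (X n - Y n) = F (proj B y) - F (proj B y')"
        by (simp add: linear_diff[OF lb(1)] y base_embed)
      have p: "?p (X n - Y n) = proj B y - proj B y'"
        by (simp add: linear_diff[OF lb(2)] y proj_base_embed)
      have "norm (jet_base ((X n - Y n) /\<^sub>R t n)) = inverse (t n) * norm (F (proj B y) - F (proj B y'))"
        unfolding linear_scale[OF lb(1)] b using t by simp
      also have "\<dots> \<le> inverse (t n) * (C * norm (proj B y - proj B y'))"
        using t patch_lipschitz[OF patch y(3,6)] by (intro mult_left_mono) auto
      also have "\<dots> = C * norm (?p ((X n - Y n) /\<^sub>R t n))"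
        unfolding linear_scale[OF lb(2)] p using t by simp
      finally show ?thesis .
    qed
    then have "norm (jet_base v) \<le> C * norm (?p v)"
      by (intro tendsto_le[OF _ tendsto_mult[OF tendsto_const tendsto_norm[OF bounded_linear.tendsto[OF lp *(2)]]]
            tendsto_norm[OF bounded_linear.tendsto[OF bounded_linear_jet_base *(2)]]] always_eventually) auto
    then show "jet_base v = 0" using v(2) by simp
  qed
  have i: "(l, c) \<in> (jet_index B j)" using l by (auto simp: jet_index_def)
  have Wop: "openin (top_of_set (span B)) ?W" using D by (simp add: openin_open_Int)
  have uW: "jet_embed y \<in> ?M \<and> ?p (jet_embed y) = y" if "y \<in> ?W" for y using that pe by auto
  have xW: "x \<in> ?W" using x by simp
  obtain \<eta> where \<eta>: "\<eta> \<in> span B"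
    "\<And>\<epsilon>. \<epsilon> > 0 \<Longrightarrow> \<exists>d>0. \<forall>x'\<in>?W. \<forall>x''\<in>?W. dist x' x < d \<longrightarrow> dist x'' x < d \<longrightarrow>
        \<bar>\<xi> (l, c) (jet_embed x' - jet_embed x'') - \<eta> \<bullet> (x' - x'')\<bar> \<le> \<epsilon> * norm (x' - x'')"
    by (rule strict_derivative_of_section[OF MZ subZ cZ PT lp subspace_span Wop uW openin_subtopology_self xW lscU[OF uM] ker continuous_on_subset[OF ucont] lin[OF i]])
       auto
  have "\<xi> (l, c) (jet_embed x' - jet_embed x'') = J l x' \<bullet> c - J l x'' \<bullet> c" for x' x''
    by (simp add: linear_diff[OF bounded_linear.linear[OF lin[OF i]]] coord_embed[OF i] jet_coord_def)
  then show ?thesis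
    using \<eta> unfolding strict_deriv_def by auto
qed

end

section \<open>The local structure of homogeneous sets\<close>

text \<open>A concrete space for the jets is chosen here: bounded functions on the natural numbers,
  with indicator functions of points as basis vectors and evaluations as dual functionals. It
  contains jet spaces of every dimension.\<close>

lemma jets_strict:
  fixes N B D U :: "'e::euclidean_space set"
  assumes patch: "graph_patch N B D U F C"
    and jet: "jet_family B D J j" and J0: "\<And>x. x \<in> D \<Longrightarrow> J [] x = F (proj B x)"
    and j: "0 < j" "j < k" and hom: "ck_homog k N" and x: "x \<in> span B" "x \<in> D"
    and l: "l \<in> lists B" "length l \<le> j" "c \<in> Basis"
  shows "\<exists>\<eta>\<in>span B. strict_deriv (span B \<inter> D) (\<lambda>x. J l x \<bullet> c) x \<eta>"
proof -
  have "finite (jet_index B j)"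
    using patch_basis(1)[OF patch] by (auto simp: orthonormal_def intro: finite_jet_index)
  then obtain en :: "'e list \<times> 'e \<Rightarrow> nat" where en: "inj_on en (jet_index B j)"
    using finite_imp_inj_to_nat_seg by meson
  define e :: "'e list \<times> 'e \<Rightarrow> nat \<Rightarrow>\<^sub>C real" where "e i = Bcontfun (\<lambda>m. if m = en i then 1 else 0)" for i
  have e: "apply_bcontfun (e i) m = (if m = en i then 1 else 0)" for i m
  proof -
    have "range (\<lambda>m. if m = en i then 1 else 0 :: real) \<subseteq> {0, 1}" by auto
    then have "bounded (range (\<lambda>m. if m = en i then 1 else 0 :: real))"
      by (meson finite.emptyI finite.insertI finite_imp_bounded bounded_subset)
    then have "(\<lambda>m. if m = en i then 1 else 0 :: real) \<in> bcontfun"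
      by (simp add: bcontfun_def continuous_on_discrete)
    then show ?thesis by (simp add: e_def Bcontfun_inverse)
  qed
  define \<xi> :: "'e list \<times> 'e \<Rightarrow> (nat \<Rightarrow>\<^sub>C real) \<Rightarrow> real" where "\<xi> i z = apply_bcontfun z (en i)" for i z
  have lin: "bounded_linear (\<xi> i)" for i
  proof (rule bounded_linear_intro[where K = 1])
    show "norm (\<xi> i z) \<le> norm z * 1" for z using norm_bounded[of z "en i"] by (simp add: \<xi>_def)
  qed (simp_all add: \<xi>_def plus_bcontfun.rep_eq scaleR_bcontfun.rep_eq)
  have dual: "\<xi> i (e m) = (if i = m then 1 else 0)" if "i \<in> jet_index B j" "m \<in> jet_index B j" for i m
    using that en by (auto simp: \<xi>_def e inj_on_def)
  show ?thesis by (rule jet_step_strict[OF patch jet J0 j lin dual hom x l])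
qed

lemma strict_deriv_has_derivative:
  fixes f :: "'e::euclidean_space \<Rightarrow> real"
  assumes B: "orthonormal B" and D: "open D" "\<And>x. proj B x \<in> D \<longleftrightarrow> x \<in> D"
    and f: "\<And>x. x \<in> D \<Longrightarrow> f x = f (proj B x)"
    and \<eta>: "strict_deriv (span B \<inter> D) f (proj B x) \<eta>" "\<eta> \<in> span B" and x: "x \<in> D"
  shows "(f has_derivative (\<lambda>v. \<Sum>b\<in>B. (v \<bullet> b) *\<^sub>R (\<eta> \<bullet> b))) (at x)"
proof -
  have s: "(\<Sum>b\<in>B. (v \<bullet> b) *\<^sub>R (\<eta> \<bullet> b)) = \<eta> \<bullet> v" for v
    using proj_inner[OF B \<eta>(2), of v] by (simp add: proj_def inner_sum_left inner_sum_right inner_commute)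
  have W: "proj B y \<in> span B \<inter> D" if "y \<in> D" for y using that D proj_in_span by auto
  have pd: "proj B y - proj B x = proj B (y - x)" for y
    by (simp add: linear_diff[OF bounded_linear.linear[OF bounded_linear_proj]])
  show ?thesis
    unfolding s has_derivative_at_alt
  proof (intro conjI allI impI)
    show "bounded_linear ((\<bullet>) \<eta>)" by (rule bounded_linear_inner_right)
    fix e :: real assume "e > 0"
    then obtain d where d: "d > 0" "\<And>x' x''. x' \<in> span B \<inter> D \<Longrightarrow> x'' \<in> span B \<inter> D \<Longrightarrow> dist x' (proj B x) < d \<Longrightarrow>
       dist x'' (proj B x) < d \<Longrightarrow> \<bar>f x' - f x'' - \<eta> \<bullet> (x' - x'')\<bar> \<le> e * norm (x' - x'')"
      using \<eta>(1) unfolding strict_deriv_def by metis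
    obtain r where r: "r > 0" "ball x r \<subseteq> D" using D(1) x openE by blast
    show "\<exists>d>0. \<forall>y. norm (y - x) < d \<longrightarrow> norm (f y - f x - \<eta> \<bullet> (y - x)) \<le> e * norm (y - x)"
    proof (intro exI[of _ "min d r"] conjI allI impI)
      fix y assume y: "norm (y - x) < min d r"
      have yD: "y \<in> D" using y r by (auto simp: dist_norm norm_minus_commute subset_iff)
      have n: "norm (proj B (y - x)) \<le> norm (y - x)" by (rule norm_proj_le[OF B])
      have "\<bar>f (proj B y) - f (proj B x) - \<eta> \<bullet> (proj B y - proj B x)\<bar> \<le> e * norm (proj B y - proj B x)"
        using W[OF yD] W[OF x] y n d(1) by (intro d(2)) (auto simp: dist_norm pd)
      also have "\<dots> \<le> e * norm (y - x)" using n \<open>e > 0\<close> by (simp add: pd)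
      finally have "\<bar>f y - f x - \<eta> \<bullet> proj B (y - x)\<bar> \<le> e * norm (y - x)"
        using f[OF yD] f[OF x] by (simp add: pd)
      moreover have "\<eta> \<bullet> proj B (y - x) = \<eta> \<bullet> (y - x)"
        using proj_inner[OF B \<eta>(2), of "y - x"] by (simp add: inner_commute)
      ultimately show "norm (f y - f x - \<eta> \<bullet> (y - x)) \<le> e * norm (y - x)" by simp
    qed (use d r in simp)
  qed
qed

text \<open>Two gradients are tested on one common short secant that starts at \<open>y\<close> and
  points along \<open>b\<close>. It is admissible for the strict estimates at both \<open>x\<close>
  and \<open>y\<close>, and the two errors of \<open>e / 3\<close> add up to less than
  \<open>e\<close>.\<close>

lemma strict_deriv_continuous_on:
  fixes f :: "'e::euclidean_space \<Rightarrow> real"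
  assumes B: "orthonormal B" and D: "open D" and b: "b \<in> B"
    and \<eta>: "\<And>x. x \<in> span B \<inter> D \<Longrightarrow> strict_deriv (span B \<inter> D) f x (\<eta> x)"
  shows "continuous_on (span B \<inter> D) (\<lambda>x. \<eta> x \<bullet> b)"
  unfolding continuous_on_iff
proof (intro ballI allI impI)
  let ?W = "span B \<inter> D"
  fix x and e :: real assume x: "x \<in> ?W" and e: "e > 0"
  have nb: "norm b = 1" using B b by (simp add: orthonormal_def)
  from \<eta>[OF x] e obtain d where d: "d > 0" "\<And>x' x''. x' \<in> ?W \<Longrightarrow> x'' \<in> ?W \<Longrightarrow> dist x' x < d \<Longrightarrow>
       dist x'' x < d \<Longrightarrow> \<bar>f x' - f x'' - \<eta> x \<bullet> (x' - x'')\<bar> \<le> (e / 3) * norm (x' - x'')"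
    unfolding strict_deriv_def by (metis zero_less_divide_iff zero_less_numeral)
  show "\<exists>d>0. \<forall>x'\<in>?W. dist x' x < d \<longrightarrow> dist (\<eta> x' \<bullet> b) (\<eta> x \<bullet> b) < e"
  proof (intro exI[of _ d] conjI ballI impI d)
    fix y assume y: "y \<in> ?W" "dist y x < d"
    from \<eta>[OF y(1)] e obtain d' where d': "d' > 0" "\<And>x' x''. x' \<in> ?W \<Longrightarrow> x'' \<in> ?W \<Longrightarrow> dist x' y < d' \<Longrightarrow>
       dist x'' y < d' \<Longrightarrow> \<bar>f x' - f x'' - \<eta> y \<bullet> (x' - x'')\<bar> \<le> (e / 3) * norm (x' - x'')"
      unfolding strict_deriv_def by (metis zero_less_divide_iff zero_less_numeral)
    obtain r where r: "r > 0" "ball y r \<subseteq> D" using D y openE by blast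
    \<comment> \<open>Half the minimum keeps the end of the secant in \<open>D\<close>, within
      \<open>d'\<close> of \<open>y\<close> and within \<open>d\<close> of \<open>x\<close>.\<close>
    define t where "t = min r (min d' (d - dist y x)) / 2"
    have t: "t > 0" "t < r" "t < d'" "t < d - dist y x" using r d' y by (auto simp: t_def)
    let ?z = "y + t *\<^sub>R b"
    have dz: "dist ?z y = t" using t nb by (simp add: dist_norm)
    have "?z \<in> D" using r(2) dz t by (auto simp: dist_commute subset_iff)
    moreover have "?z \<in> span B" using y span_scale[OF span_base[OF b]] by (intro span_add) auto
    ultimately have z: "?z \<in> ?W" by simp
    have "dist ?z x < d" using dist_triangle[of ?z x y] dz t by simp
    then have 1: "\<bar>f ?z - f y - \<eta> x \<bullet> (?z - y)\<bar> \<le> (e / 3) * norm (?z - y)"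
      using d(2)[OF z y(1)] y by simp
    have 2: "\<bar>f ?z - f y - \<eta> y \<bullet> (?z - y)\<bar> \<le> (e / 3) * norm (?z - y)"
      using d'(2)[OF z y(1)] dz t d'(1) by simp
    have "t * \<bar>\<eta> y \<bullet> b - \<eta> x \<bullet> b\<bar> = \<bar>\<eta> y \<bullet> (?z - y) - \<eta> x \<bullet> (?z - y)\<bar>"
      using t by (simp add: abs_mult right_diff_distrib[symmetric])
    also have "\<dots> \<le> 2 * ((e / 3) * norm (?z - y))" using 1 2 by linarith
    also have "\<dots> = t * (2 * (e / 3))" using t nb by simp
    finally have "\<bar>\<eta> y \<bullet> b - \<eta> x \<bullet> b\<bar> \<le> 2 * (e / 3)" using t(1) by simp
    then show "dist (\<eta> y \<bullet> b) (\<eta> x \<bullet> b) < e" using e by (simp add: dist_real_def)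
  qed
qed

text \<open>The gradients of the top jets supply the jets of the next order. Strictness provides
  their continuity, hence a jet family one order longer.\<close>

lemma jets_extend:
  fixes B D :: "'e::euclidean_space set"
  assumes B: "orthonormal B" and D: "open D" "\<And>x. proj B x \<in> D \<longleftrightarrow> x \<in> D"
    and jet: "jet_family B D J j"
    and str: "\<And>l c x. l \<in> lists B \<Longrightarrow> length l = j \<Longrightarrow> c \<in> Basis \<Longrightarrow> x \<in> span B \<Longrightarrow> x \<in> D \<Longrightarrow>
      \<exists>\<eta>\<in>span B. strict_deriv (span B \<inter> D) (\<lambda>x. J l x \<bullet> c) x \<eta>"
  shows "\<exists>J'. jet_family B D J' (Suc j) \<and> J' [] = J []"
proof -
  have "\<forall>l c x. \<exists>\<eta>. l \<in> lists B \<longrightarrow> length l = j \<longrightarrow> c \<in> Basis \<longrightarrow> x \<in> span B \<longrightarrow> x \<in> D \<longrightarrow>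
      \<eta> \<in> span B \<and> strict_deriv (span B \<inter> D) (\<lambda>x. J l x \<bullet> c) x \<eta>"
    using str by blast
  then obtain \<eta> where \<eta>: "\<And>l c x. l \<in> lists B \<Longrightarrow> length l = j \<Longrightarrow> c \<in> Basis \<Longrightarrow> x \<in> span B \<inter> D \<Longrightarrow>
      \<eta> l c x \<in> span B \<and> strict_deriv (span B \<inter> D) (\<lambda>x. J l x \<bullet> c) x (\<eta> l c x)"
    by (metis IntD1 IntD2)
  have pp: "proj B (proj B x) = proj B x" for x by (rule proj_proj[OF B])
  have W: "proj B y \<in> span B \<inter> D" if "y \<in> D" for y using that D proj_in_span by auto
  \<comment> \<open>The head of the list is the direction of the last differentiation, so the new
    jet is the component along \<open>hd l\<close> of the gradient of the jet
    \<open>tl l\<close>.\<close>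
  define J' where "J' l = (if length l \<le> j then J l
      else (\<lambda>x. \<Sum>c\<in>Basis. (\<eta> (tl l) c (proj B x) \<bullet> hd l) *\<^sub>R c))" for l
  have "jet_family B D J' (Suc j)"
    unfolding jet_family_def
  proof (intro conjI ballI impI)
    fix l assume l: "l \<in> lists B" "length l \<le> Suc j"
    show "continuous_on D (J' l)"
    proof (cases "length l \<le> j")
      case True
      then show ?thesis using jet l by (auto simp: J'_def intro: jet_family_continuous_on)
    next
      case False
      then obtain b l0 where bl: "l = b # l0" "length l0 = j" using l by (cases l) auto
      have "b \<in> B" "l0 \<in> lists B" using l bl by auto
      have "continuous_on D (\<lambda>x. \<eta> l0 c (proj B x) \<bullet> b)" if c: "c \<in> Basis" for c
      proof (rule continuous_on_compose2[where g = "\<lambda>x. \<eta> l0 c x \<bullet> b"])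
        show "continuous_on (span B \<inter> D) (\<lambda>x. \<eta> l0 c x \<bullet> b)"
          using \<eta>[OF \<open>l0 \<in> lists B\<close> bl(2) c] by (intro strict_deriv_continuous_on[OF B D(1) \<open>b \<in> B\<close>]) blast
        show "continuous_on D (proj B)" by (intro linear_continuous_on bounded_linear_proj)
      qed (use W in auto)
      then show ?thesis unfolding J'_def using False bl by (auto intro!: continuous_on_sum continuous_on_scaleR continuous_on_const)
    qed
    fix x assume x: "x \<in> D"
    have "J l x = J l (proj B x)" if "length l \<le> j" using jet l x that unfolding jet_family_def by blast
    then show "J' l x = J' l (proj B x)" by (simp add: J'_def pp)
  next
    fix l assume l: "l \<in> lists B" "length l < Suc j"
    show "has_partials B D (J' l) (\<lambda>b. J' (b # l))"
    proof (cases "length l < j")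
      case True
      then show ?thesis using jet l unfolding jet_family_def by (simp add: J'_def)
    next
      case False
      then have lj: "length l = j" using l by simp
      show ?thesis
        unfolding has_partials_def
      proof
        fix x assume x: "x \<in> D"
        have "((\<lambda>x. J l x \<bullet> i) has_derivative (\<lambda>v. (\<Sum>b\<in>B. (v \<bullet> b) *\<^sub>R J' (b # l) x) \<bullet> i)) (at x)" if i: "i \<in> Basis" for i
        proof -
          have inv: "J l y \<bullet> i = J l (proj B y) \<bullet> i" if "y \<in> D" for y
            using jet l lj that unfolding jet_family_def by (metis order_refl)
          have "((\<lambda>x. J l x \<bullet> i) has_derivative (\<lambda>v. \<Sum>b\<in>B. (v \<bullet> b) *\<^sub>R (\<eta> l i (proj B x) \<bullet> b))) (at x)"
            using \<eta>[OF l(1) lj i W[OF x]] by (intro strict_deriv_has_derivative[where f = "\<lambda>x. J l x \<bullet> i", OF B D inv _ _ x]) auto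
          moreover have "J' (b # l) x \<bullet> i = \<eta> l i (proj B x) \<bullet> b" for b
            using lj i by (simp add: J'_def)
          ultimately show ?thesis by (simp add: inner_sum_left)
        qed
        then have "(J l has_derivative (\<lambda>v. \<Sum>b\<in>B. (v \<bullet> b) *\<^sub>R J' (b # l) x)) (at x)"
          by (subst has_derivative_componentwise_within) blast
        then show "(J' l has_derivative (\<lambda>v. \<Sum>b\<in>B. (v \<bullet> b) *\<^sub>R J' (b # l) x)) (at x)"
          using lj by (simp add: J'_def)
      qed
    qed
  qed
  then show ?thesis by (intro exI[of _ J']) (simp add: J'_def)
qed

lemma jet_family_ck_on:
  assumes "jet_family B D J k" "l \<in> lists B" "length l + m \<le> k"
  shows "ck_on m UNIV D (J l)"
  using assms(2,3)
proof (induction m arbitrary: l)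
  case 0
  then show ?case using assms(1) by (auto intro: jet_family_continuous_on)
next
  case (Suc m)
  show ?case
  proof (rule ck_on_SucI)
    show "(J l has_derivative (\<lambda>v. \<Sum>b\<in>B. (v \<bullet> b) *\<^sub>R J (b # l) x)) (at x within D)" if "x \<in> D" for x
      by (rule has_derivative_at_withinI[OF jet_family_has_derivative[OF assms(1)]]) (use Suc.prems that in auto)
    show "ck_on m UNIV D (\<lambda>x. \<Sum>b\<in>B. (v \<bullet> b) *\<^sub>R J (b # l) x)" for v
      using Suc by (intro ck_on_sum ck_on_bounded_linear[OF bounded_linear_scaleR_right]) auto
  qed
qed

lemma ck_homog_secant_homogeneous:
  fixes N :: "'e::euclidean_space set"
  assumes "ck_homog k N" "k \<ge> 1"
  shows "secant_homogeneous N UNIV"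
  unfolding secant_homogeneous_def
proof (intro ballI)
  fix a b assume ab: "a \<in> N" "b \<in> N"
  then obtain U U' H H' where eq: "ck_equiv k U U' H H'" and H: "a \<in> U" "H a = b" "H ` (U \<inter> N) = U' \<inter> N"
    using assms(1) unfolding ck_homog_def by blast
  have H': "H' ` (U' \<inter> N) = U \<inter> N" by (rule ck_equiv_image_sym[OF eq H(3)])
  obtain m where m: "k = Suc m" using assms(2) by (cases k) auto
  obtain A where A: "secant_map H A U" using C1_secant_map[of U m H] eq m by (auto simp: ck_equiv_def)
  obtain A' where A': "secant_map H' A' U'" using C1_secant_map[of U' m H'] eq m by (auto simp: ck_equiv_def)
  have "secant_equiv (U \<inter> N) (U' \<inter> N) H H' A A'"
    unfolding secant_equiv_def
    using eq H(3) H' secant_map_subset[OF A, of "U \<inter> N"] secant_map_subset[OF A', of "U' \<inter> N"]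
    by (auto simp: ck_equiv_def)
  moreover have "openin (top_of_set N) (U \<inter> N)" "openin (top_of_set N) (U' \<inter> N)"
    using eq by (auto simp: ck_equiv_def openin_open)
  ultimately show "\<exists>S S' h h' A A'. openin (top_of_set N) S \<and> openin (top_of_set N) S' \<and> a \<in> S \<and> h a = b \<and>
     secant_equiv S S' h h' A A' \<and>
     (\<forall>c\<in>S. \<forall>v\<in>pcone S c \<inter> UNIV. A c c v \<in> UNIV) \<and> (\<forall>c\<in>S'. \<forall>v\<in>pcone S' c \<inter> UNIV. A' c c v \<in> UNIV)"
    using ab H by (intro exI[of _ "U \<inter> N"] exI[of _ "U' \<inter> N"] exI[of _ H] exI[of _ H'] exI[of _ A] exI[of _ A']) auto
qed

text \<open>The first derivatives come from the cones of \<open>N\<close> itself; from order 1 on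
  the derivatives come from the set of jets, up to order \<open>k\<close>.\<close>

lemma local_structure:
  fixes N :: "'e::euclidean_space set"
  assumes lc: "locally_compact_space (top_of_set N)" and hom: "ck_homog k N" and k: "k \<ge> 1" and y: "y \<in> N"
  obtains B D U F C where "graph_patch N B D U F C" "y \<in> U" "span B = span (pcone N y)" "card B = dim (span (pcone N y))"
    "ck_on k UNIV D (\<lambda>x. F (proj B x))"
proof -
  have cUNIV: "compact (UNIV \<inter> cball (0::'e) r)" for r by simp
  have shom: "secant_homogeneous N UNIV" by (rule ck_homog_secant_homogeneous[OF hom k])
  have PT: "pcone N a \<subseteq> tcone N a" if "a \<in> N" for a
    by (rule secant_homogeneous_cones(1)[OF lc subset_UNIV subspace_UNIV cUNIV closed_UNIV shom that])
  have lsc: "cone_lsc N UNIV a" if "a \<in> N" for a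
    by (rule secant_homogeneous_cones(2)[OF lc subset_UNIV subspace_UNIV cUNIV closed_UNIV shom that])
  obtain B where B: "orthonormal B" "span B = span (pcone N y)" "card B = dim (span (pcone N y))"
    using orthonormal_basis_obtain[OF subspace_span] by metis
  obtain U \<rho> F C where P: "open U" "y \<in> U" "\<rho> > 0" "C > 0"
    "\<And>x. x \<in> span B \<inter> ball (proj B y) \<rho> \<Longrightarrow> F x \<in> N \<inter> U \<and> proj B (F x) = x"
    "\<And>z. z \<in> N \<inter> U \<Longrightarrow> proj B z \<in> ball (proj B y) \<rho> \<and> F (proj B z) = z"
    "\<And>x x'. x \<in> span B \<inter> ball (proj B y) \<rho> \<Longrightarrow> x' \<in> span B \<inter> ball (proj B y) \<rho> \<Longrightarrow>
       norm (F x - F x') \<le> C * norm (x - x')"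
    using lipschitz_patch[OF lc PT y lsc[OF y] B(1,2)] by metis
  define D where "D = proj B -` ball (proj B y) \<rho>"
  have pp: "proj B (proj B x) = proj B x" for x by (rule proj_proj[OF B(1)])
  have D: "open D" "proj B x \<in> D \<longleftrightarrow> x \<in> D" for x
    by (auto simp: D_def pp intro!: open_vimage linear_continuous_on bounded_linear_proj)
  have W: "span B \<inter> D = span B \<inter> ball (proj B y) \<rho>"
    using proj_span[OF B(1)] by (auto simp: D_def)
  have Dball: "proj B z \<in> ball (proj B y) \<rho> \<Longrightarrow> proj B z \<in> D" for z
    by (simp add: D_def pp)
  have patch: "graph_patch N B D U F C"
    unfolding graph_patch_def W using B(1) D P(1,5-7) Dball by blast
  have FW: "F ` (span B \<inter> D) = N \<inter> U"
  proof
    show "F ` (span B \<inter> D) \<subseteq> N \<inter> U" using P(5) W by auto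
    show "N \<inter> U \<subseteq> F ` (span B \<inter> D)"
    proof
      fix z assume z: "z \<in> N \<inter> U"
      then have "z = F (proj B z)" "proj B z \<in> span B \<inter> D" using P(6) proj_in_span[of B z] Dball by auto
      then show "z \<in> F ` (span B \<inter> D)" by (rule image_eqI)
    qed
  qed
  have strict0: "\<exists>\<eta>\<in>span B. strict_deriv (span B \<inter> D) (\<lambda>x. F (proj B x) \<bullet> c) x \<eta>"
    if x: "x \<in> span B" "x \<in> D" and c: "c \<in> Basis" for c x
  proof -
    let ?W = "span B \<inter> D"
    have xW: "x \<in> ?W" using x by simp
    have u: "F x \<in> N \<and> proj B (F x) = x" if "x \<in> ?W" for x using P(5) that W by auto
    have Wop: "openin (top_of_set (span B)) ?W" using D by (simp add: openin_open_Int)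
    have FWop: "openin (top_of_set N) (F ` ?W)" unfolding FW using P(1) by (rule openin_open_Int)
    have cont: "continuous_on ?W F"
      by (rule continuous_on_cong[THEN iffD1, OF refl _ continuous_on_subset[OF patch_continuous[OF patch]]])
         (auto simp: proj_span[OF B(1)])
    have lb: "linear (proj B)" by (rule bounded_linear.linear[OF bounded_linear_proj])
    \<comment> \<open>\<open>B\<close> was chosen for the cone at \<open>y\<close>. At other points
      of the patch the Lipschitz estimate shows in the limit that the projection is injective on the
      cone.\<close>
    have ker: "v = 0" if v: "v \<in> pcone N (F x)" "proj B v = 0" for v
    proof -
      have "F x \<in> N \<inter> U" using FW xW by blast
      then have "v \<in> pcone (N \<inter> U) (F x)"
        using v(1) pcone_relopen[OF FWop[unfolded FW]] by simp
      then obtain X Y t where *: "\<forall>n. X n \<in> N \<inter> U \<and> Y n \<in> N \<inter> U \<and> 0 < (t n::real)"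
          "(\<lambda>n. (X n - Y n) /\<^sub>R t n) \<longlonglongrightarrow> v"
        by (auto simp: pcone_def)
      have "norm ((X n - Y n) /\<^sub>R t n) \<le> C * norm (proj B ((X n - Y n) /\<^sub>R t n))" for n
      proof -
        have XY: "X n \<in> N" "X n \<in> U" "Y n \<in> N" "Y n \<in> U" and t: "t n > 0" using * by auto
        have "norm (X n - Y n) \<le> C * norm (proj B (X n) - proj B (Y n))"
          using patch_lipschitz[OF patch, of "proj B (X n)" "proj B (Y n)"]
            patch_inverse[OF patch XY(1,2)] patch_inverse[OF patch XY(3,4)] by (simp add: pp)
        then have "inverse (t n) * norm (X n - Y n) \<le> inverse (t n) * (C * norm (proj B (X n) - proj B (Y n)))"
          using t by (intro mult_left_mono) auto
        then show ?thesis using t unfolding linear_scale[OF lb] linear_diff[OF lb] by (simp add: mult.left_commute)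
      qed
      then have "norm v \<le> C * norm (proj B v)"
        by (intro tendsto_le[OF _ tendsto_mult[OF tendsto_const tendsto_norm[OF bounded_linear.tendsto[OF bounded_linear_proj *(2)]]]
              tendsto_norm[OF *(2)]] always_eventually) auto
      then show "v = 0" using v(2) by simp
    qed
    have FN: "F x \<in> N" using u[OF xW] by simp
    obtain \<eta> where \<eta>: "\<eta> \<in> span B"
      "\<And>\<epsilon>. \<epsilon> > 0 \<Longrightarrow> \<exists>d>0. \<forall>x'\<in>?W. \<forall>x''\<in>?W. dist x' x < d \<longrightarrow> dist x'' x < d \<longrightarrow>
          \<bar>(F x' - F x'') \<bullet> c - \<eta> \<bullet> (x' - x'')\<bar> \<le> \<epsilon> * norm (x' - x'')"
      by (rule strict_derivative_of_section[OF subset_UNIV subspace_UNIV cUNIV PT bounded_linear_proj subspace_span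
            Wop u FWop xW lsc[OF FN] ker cont bounded_linear_inner_left[of c]]) auto
    have "strict_deriv ?W (\<lambda>x. F (proj B x) \<bullet> c) x \<eta>"
      unfolding strict_deriv_def
    proof (intro allI impI)
      fix \<epsilon> :: real assume "\<epsilon> > 0"
      from \<eta>(2)[OF this] show "\<exists>d>0. \<forall>x'\<in>?W. \<forall>x''\<in>?W. dist x' x < d \<longrightarrow> dist x'' x < d \<longrightarrow>
          \<bar>F (proj B x') \<bullet> c - F (proj B x'') \<bullet> c - \<eta> \<bullet> (x' - x'')\<bar> \<le> \<epsilon> * norm (x' - x'')"
        using proj_span[OF B(1)] by (simp add: inner_diff_left)
    qed
    with \<eta>(1) show ?thesis by blast
  qed
  have "\<exists>J. jet_family B D J (Suc i) \<and> J [] = (\<lambda>x. F (proj B x))" if "Suc i \<le> k" for i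
    using that
  proof (induction i)
    case 0
    \<comment> \<open>At order 0 only the empty list matters, so a family constant in the list will
      do.\<close>
    let ?J = "\<lambda>l::'e list. \<lambda>x. F (proj B x)"
    have j0: "jet_family B D ?J 0"
      unfolding jet_family_def using patch_continuous[OF patch] by (auto simp: pp)
    have "\<exists>J'. jet_family B D J' (Suc 0) \<and> J' [] = ?J []"
      by (rule jets_extend[OF B(1) D j0]) (rule strict0)
    then show ?case by simp
  next
    case (Suc i)
    then obtain J where J: "jet_family B D J (Suc i)" "J [] = (\<lambda>x. F (proj B x))" by auto
    have "\<exists>\<eta>\<in>span B. strict_deriv (span B \<inter> D) (\<lambda>x. J l x \<bullet> c) x \<eta>"
      if "l \<in> lists B" "length l = Suc i" "c \<in> Basis" "x \<in> span B" "x \<in> D" for l c x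
      by (rule jets_strict[OF patch J(1) _ _ _ hom, of x l c]) (use J(2) Suc.prems that in auto)
    from jets_extend[OF B(1) D J(1) this] show ?case using J(2) by simp
  qed
  from this[of "k - 1"] k obtain J where J: "jet_family B D J k" "J [] = (\<lambda>x. F (proj B x))"
    by fastforce
  have "ck_on k UNIV D (\<lambda>x. F (proj B x))"
    using jet_family_ck_on[OF J(1), of "[]" k] J(2) by simp
  with patch P(2) B(2,3) show ?thesis by (rule that)
qed

section \<open>Straightening charts\<close>

text \<open>Linear maps carry each cone onto the other, and this compares the dimensions of the
  spans. It makes the dimension of the submanifold the same at all points.\<close>

lemma secant_equiv_dim:
  fixes S S' :: "'e::euclidean_space set"
  assumes eq: "secant_equiv S S' h h' A A'" and a: "a \<in> S"
  shows "dim (pcone S a) = dim (pcone S' (h a))"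
proof -
  have sm: "secant_map h A S" "secant_map h' A' S'" using eq by (auto simp: secant_equiv_def)
  have hS: "h ` S \<subseteq> S'" "h' ` S' \<subseteq> S" "h a \<in> S'" "h' (h a) = a" using eq a by (auto simp: secant_equiv_def)
  have l: "linear (A a a)" "linear (A' (h a) (h a))" using sm by (auto simp: secant_map_def)
  have P: "A a a v \<in> pcone S' (h a)" if "v \<in> pcone S a" for v
    by (rule secant_map_pcone[OF sm(1) a hS(1) that])
  have P': "A' (h a) (h a) v \<in> pcone S a" if "v \<in> pcone S' (h a)" for v
    using secant_map_pcone[OF sm(2) hS(3) hS(2) that] hS(4) by simp
  have i: "A' (h a) (h a) (A a a v) = v" if "v \<in> pcone S a" for v
    by (rule secant_equiv_inverse[OF eq a that])
  have i': "A a a (A' (h a) (h a) v) = v" if "v \<in> pcone S' (h a)" for v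
    using secant_equiv_inverse[OF secant_equiv_sym[OF eq] hS(3) that] hS(4) by simp
  have "A a a ` pcone S a = pcone S' (h a)" "A' (h a) (h a) ` pcone S' (h a) = pcone S a"
    using P P' i i' by (force simp: image_iff)+
  then show ?thesis
    using dim_image_le[OF l(1), of "pcone S a"] dim_image_le[OF l(2), of "pcone S' (h a)"] by simp
qed

lemma ck_equiv_dim:
  assumes eq: "ck_equiv k U U' H H'" and k: "k \<ge> 1" and a: "a \<in> U" "a \<in> N" and im: "H ` (U \<inter> N) = U' \<inter> N'"
  shows "dim (pcone N a) = dim (pcone N' (H a))"
proof -
  have H': "H' ` (U' \<inter> N') = U \<inter> N" by (rule ck_equiv_image_sym[OF eq im])
  obtain m where m: "k = Suc m" using k by (cases k) auto
  obtain A where A: "secant_map H A U" using C1_secant_map[of U m H] eq m by (auto simp: ck_equiv_def)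
  obtain A' where A': "secant_map H' A' U'" using C1_secant_map[of U' m H'] eq m by (auto simp: ck_equiv_def)
  have "secant_equiv (U \<inter> N) (U' \<inter> N') H H' A A'"
    unfolding secant_equiv_def
    using eq im H' secant_map_subset[OF A, of "U \<inter> N"] secant_map_subset[OF A', of "U' \<inter> N'"]
    by (auto simp: ck_equiv_def)
  from secant_equiv_dim[OF this, of a] a have "dim (pcone (U \<inter> N) a) = dim (pcone (U' \<inter> N') (H a))" by simp
  moreover have "openin (top_of_set N) (U \<inter> N)" "openin (top_of_set N') (U' \<inter> N')"
    using eq by (auto simp: ck_equiv_def openin_open)
  moreover have "H a \<in> U' \<inter> N'" using a im by blast
  ultimately show ?thesis using a pcone_relopen[of N "U \<inter> N" a] pcone_relopen[of N' "U' \<inter> N'" "H a"] by simp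
qed

section \<open>Transfer between charts and the ambient Euclidean space\<close>

lemma ck_on_compose_subspace:
  fixes f :: "'e::euclidean_space \<Rightarrow> 'e" and g :: "'e \<Rightarrow> 'f::real_normed_vector"
  assumes "subspace E" and f: "ck_on k E U f" and g: "ck_on k E V g" and sub: "f ` U \<subseteq> V" "U \<subseteq> E" "V \<subseteq> E"
  shows "ck_on k E U (\<lambda>x. g (f x))"
proof -
  obtain B where B: "orthonormal B" "span B = E" using orthonormal_basis_obtain[OF assms(1)] by metis
  have pE: "proj B x = x" if "x \<in> E" for x using proj_span[OF B(1)] B(2) that by blast
  have fV: "f x \<in> V" "proj B (f x) = f x" if "x \<in> U" for x using that sub pE by auto
  have "ck_on k UNIV (proj B -` U) (\<lambda>x. g (proj B (f (proj B x))))"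
    by (rule ck_on_compose[OF ck_on_extend[OF B g] ck_on_extend[OF B f]]) (auto simp: fV)
  then have "ck_on k E U (\<lambda>x. g (proj B (f (proj B x))))"
    by (rule ck_on_subset) (use pE sub in auto)
  then show ?thesis
    by (rule ck_on_cong) (use pE sub fV in auto)
qed

lemma is_chart_open:
  assumes "is_chart E X (U, \<phi>)" "openin X S" "S \<subseteq> U"
  shows "openin (top_of_set E) (\<phi> ` S)"
proof -
  have c: "openin X U" "openin (top_of_set E) (\<phi> ` U)" "homeomorphic_map (subtopology X U) (top_of_set (\<phi> ` U)) \<phi>"
    using assms(1) by (auto simp: is_chart_def)
  have "openin (subtopology X U) S" using assms c(1) by (simp add: openin_open_subtopology)
  then have "openin (top_of_set (\<phi> ` U)) (\<phi> ` S)"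
    using homeomorphic_imp_open_map[OF c(3)] by (simp add: open_map_def)
  then show ?thesis using c(2) by (rule openin_trans)
qed

lemma is_chart_inj: "is_chart E X (U, \<phi>) \<Longrightarrow> inj_on \<phi> U"
  unfolding is_chart_def using homeomorphic_imp_injective_map openin_subset
  by (fastforce simp: topspace_subtopology inf.absorb2)

lemma is_chart_subset: "is_chart E X (U, \<phi>) \<Longrightarrow> \<phi> ` U \<subseteq> E"
  by (auto simp: is_chart_def dest: openin_imp_subset)

lemma ck_map_domain_open:
  assumes "openin X W" "continuous_map (subtopology X W) X H" "openin X U" "openin X V"
  shows "openin X {x \<in> W \<inter> U. H x \<in> V}"
proof -
  have "openin (subtopology X W) {x \<in> topspace (subtopology X W). H x \<in> V}"
    by (rule openin_continuous_map_preimage[OF assms(2,4)])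
  then have "openin X {x \<in> topspace (subtopology X W). H x \<in> V}"
    using assms(1) by (simp add: openin_open_subtopology)
  then have "openin X ({x \<in> topspace (subtopology X W). H x \<in> V} \<inter> U)" using assms(3) by (rule openin_Int)
  moreover have "{x \<in> topspace (subtopology X W). H x \<in> V} \<inter> U = {x \<in> W \<inter> U. H x \<in> V}"
    using openin_subset[OF assms(1)] by auto
  ultimately show ?thesis by simp
qed

text \<open>A local diffeomorphism read in charts lives on an open subset of \<open>E\<close>, while
  \<open>ck_equiv\<close> asks for open subsets of the whole space. It is extended by the identity
  in the directions orthogonal to \<open>E\<close>, which keeps it invertible.\<close>

lemma chart_transition:
  fixes E :: "'e::euclidean_space set" and X :: "'a topology"
  assumes E: "subspace E" and chart: "(U0, \<phi>) \<in> A" "(V0, \<psi>) \<in> A" "is_chart E X (U0, \<phi>)" "is_chart E X (V0, \<psi>)"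
    and pq: "p \<in> N" "q \<in> N" "p \<in> U0" "q \<in> V0" and hom: "ck_homogeneous k E X A N"
  obtains U U' H H' where "ck_equiv k U U' H H'" "\<phi> p \<in> U" "H (\<phi> p) = \<psi> q"
    "H ` (U \<inter> \<phi> ` (U0 \<inter> N)) = U' \<inter> \<psi> ` (V0 \<inter> N)"
proof -
  obtain B where B: "orthonormal B" "span B = E" using orthonormal_basis_obtain[OF E] by metis
  have pE: "proj B x = x" if "x \<in> E" for x using proj_span[OF B(1)] B(2) that by blast
  have pinE: "proj B x \<in> E" for x using proj_in_span B(2) by blast
  have padd: "proj B (a + (z - proj B z)) = a" if "a \<in> E" for a z
    using that pE pinE
    by (simp add: linear_add[OF bounded_linear.linear[OF bounded_linear_proj]] linear_diff[OF bounded_linear.linear[OF bounded_linear_proj]])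
  obtain U V G where pU: "p \<in> U" and diff: "ck_diffeo k E X A U V G" and Gp: "G p = q" and GN: "G ` (U \<inter> N) = V \<inter> N"
    using hom pq unfolding ck_homogeneous_def by metis
  define K where "K = inv_into U G"
  have UV: "openin X U" "openin X V" "bij_betw G U V" "ck_map k E X A U G" "ck_map k E X A V K"
    using diff by (auto simp: ck_diffeo_def K_def)
  have KG: "G x \<in> V" "K (G x) = x" if "x \<in> U" for x
    using that UV(3) by (auto simp: K_def bij_betw_def)
  have GK: "K y \<in> U" "G (K y) = y" if "y \<in> V" for y
    using that UV(3) by (auto simp: K_def bij_betw_def inv_into_into f_inv_into_f)
  \<comment> \<open>The part of the domain on which both charts are available; \<open>S'\<close> is
    its image under \<open>G\<close>.\<close>
  define S where "S = {x \<in> U \<inter> U0. G x \<in> V0}"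
  define S' where "S' = {y \<in> V \<inter> V0. K y \<in> U0}"
  have cont: "continuous_map (subtopology X U) X G" "continuous_map (subtopology X V) X K"
    using UV(4,5) by (auto simp: ck_map_def)
  have o: "openin X U0" "openin X V0" using chart(3,4) by (auto simp: is_chart_def)
  have opS: "openin X S" "openin X S'"
    unfolding S_def S'_def
    by (rule ck_map_domain_open[OF UV(1) cont(1) o], rule ck_map_domain_open[OF UV(2) cont(2) o(2,1)])
  have GS: "G x \<in> S'" "K (G x) = x" if "x \<in> S" for x using that KG by (auto simp: S_def S'_def)
  have KS: "K y \<in> S" "G (K y) = y" if "y \<in> S'" for y using that GK by (auto simp: S_def S'_def)
  have sub: "S \<subseteq> U0" "S' \<subseteq> V0" by (auto simp: S_def S'_def)
  note inj = is_chart_inj[OF chart(3)] is_chart_inj[OF chart(4)]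
  define h where "h = \<psi> \<circ> G \<circ> inv_into U0 \<phi>"
  define h' where "h' = \<phi> \<circ> K \<circ> inv_into V0 \<psi>"
  have h: "h (\<phi> x) = \<psi> (G x)" if "x \<in> S" for x using that sub inj by (auto simp: h_def inv_into_f_f)
  have h': "h' (\<psi> y) = \<phi> (K y)" if "y \<in> S'" for y using that sub inj by (auto simp: h'_def inv_into_f_f)
  have ckh: "ck_on k E (\<phi> ` S) h" "ck_on k E (\<psi> ` S') h'"
    using UV(4,5) chart(1,2) unfolding ck_map_def S_def S'_def h_def h'_def by fast+
  have opE: "openin (top_of_set E) (\<phi> ` S)" "openin (top_of_set E) (\<psi> ` S')"
    by (rule is_chart_open[OF chart(3) opS(1) sub(1)], rule is_chart_open[OF chart(4) opS(2) sub(2)])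
  have SE: "\<phi> ` S \<subseteq> E" "\<psi> ` S' \<subseteq> E" using opE by (auto dest: openin_imp_subset)
  have oph: "open (proj B -` T)" if T: "openin (top_of_set E) T" for T
  proof -
    obtain T' where T': "open T'" "T = E \<inter> T'" using T by (auto simp: openin_open)
    then have "proj B -` T = proj B -` T'" using pinE by auto
    then show ?thesis using T'(1) by (simp add: open_vimage linear_continuous_on bounded_linear_proj)
  qed
  define W where "W = proj B -` (\<phi> ` S)"
  define W' where "W' = proj B -` (\<psi> ` S')"
  define H where "H z = h (proj B z) + (z - proj B z)" for z
  define H' where "H' z = h' (proj B z) + (z - proj B z)" for z
  have HW: "proj B (H z) = h (proj B z) \<and> H z \<in> W' \<and> H' (H z) = z" if z: "z \<in> W" for z
  proof -
    obtain x where x: "x \<in> S" "proj B z = \<phi> x" using z by (auto simp: W_def)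
    have hE: "h (proj B z) \<in> E" using x h GS SE by auto
    have 1: "proj B (H z) = h (proj B z)" unfolding H_def by (rule padd[OF hE])
    have "H' (H z) = h' (h (proj B z)) + (H z - h (proj B z))" by (simp add: H'_def 1)
    also have "h' (h (proj B z)) = proj B z" using x h h' GS by simp
    finally have "H' (H z) = z" by (simp add: H_def)
    with 1 show ?thesis using x h GS by (auto simp: W'_def)
  qed
  have HW': "proj B (H' z) = h' (proj B z) \<and> H' z \<in> W \<and> H (H' z) = z" if z: "z \<in> W'" for z
  proof -
    obtain x where x: "x \<in> S'" "proj B z = \<psi> x" using z by (auto simp: W'_def)
    have hE: "h' (proj B z) \<in> E" using x h' KS SE by auto
    have 1: "proj B (H' z) = h' (proj B z)" unfolding H'_def by (rule padd[OF hE])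
    have "H (H' z) = h (h' (proj B z)) + (H' z - h' (proj B z))" by (simp add: H_def 1)
    also have "h (h' (proj B z)) = proj B z" using x h h' KS by simp
    finally have "H (H' z) = z" by (simp add: H'_def)
    with 1 show ?thesis using x h' KS by (auto simp: W_def)
  qed
  have ckH: "ck_on k UNIV W H" "ck_on k UNIV W' H'"
    unfolding H_def H'_def W_def W'_def
    by (intro ck_on_add ck_on_extend[OF B] ckh ck_on_diff ck_on_linear bounded_linear_ident bounded_linear_proj)+
  have oW: "open W" "open W'"
    unfolding W_def W'_def using oph[OF opE(1)] oph[OF opE(2)] by simp_all
  have "ck_equiv k W W' H H'"
    unfolding ck_equiv_def using HW HW' ckH oW by blast
  moreover have pS: "p \<in> S" using pU pq Gp by (auto simp: S_def)
  have HS: "\<phi> x \<in> W" "H (\<phi> x) = \<psi> (G x)" if "x \<in> S" for x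
  proof -
    have "\<phi> x \<in> E" using that SE by auto
    then show "\<phi> x \<in> W" "H (\<phi> x) = \<psi> (G x)" using that pE h by (auto simp: W_def H_def)
  qed
  have "\<phi> p \<in> W" "H (\<phi> p) = \<psi> q" using HS[OF pS] Gp by auto
  moreover have "H ` (W \<inter> \<phi> ` (U0 \<inter> N)) = W' \<inter> \<psi> ` (V0 \<inter> N)"
  proof
    show "H ` (W \<inter> \<phi> ` (U0 \<inter> N)) \<subseteq> W' \<inter> \<psi> ` (V0 \<inter> N)"
    proof
      fix w assume "w \<in> H ` (W \<inter> \<phi> ` (U0 \<inter> N))"
      then obtain x where x: "x \<in> U0" "x \<in> N" "\<phi> x \<in> W" "w = H (\<phi> x)" by auto
      have "\<phi> x \<in> E" using is_chart_subset[OF chart(3)] x by auto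
      then have "\<phi> x \<in> \<phi> ` S" using x(3) pE by (auto simp: W_def)
      then have xS: "x \<in> S" using inj(1) x(1) sub(1) by (auto simp: inj_on_def)
      then have "G x \<in> N" using GN x(2) by (auto simp: S_def)
      then show "w \<in> W' \<inter> \<psi> ` (V0 \<inter> N)"
        using HW[OF x(3)] HS[OF xS] GS[OF xS] sub x(4) by auto
    qed
    show "W' \<inter> \<psi> ` (V0 \<inter> N) \<subseteq> H ` (W \<inter> \<phi> ` (U0 \<inter> N))"
    proof
      fix w assume "w \<in> W' \<inter> \<psi> ` (V0 \<inter> N)"
      then obtain y where y: "y \<in> V0" "y \<in> N" "\<psi> y \<in> W'" "w = \<psi> y" by auto
      have "\<psi> y \<in> E" using is_chart_subset[OF chart(4)] y by auto
      then have "\<psi> y \<in> \<psi> ` S'" using y(3) pE by (auto simp: W'_def)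
      then have yS: "y \<in> S'" using inj(2) y(1) sub(2) by (auto simp: inj_on_def)
      then have KyS: "K y \<in> S" "G (K y) = y" using KS by auto
      have "y \<in> G ` (U \<inter> N)" using GN y(2) yS by (auto simp: S'_def)
      then have KyN: "K y \<in> N" using KG by auto
      show "w \<in> H ` (W \<inter> \<phi> ` (U0 \<inter> N))"
        by (rule image_eqI[of _ _ "\<phi> (K y)"]) (use HS[OF KyS(1)] KyS KyN sub y(4) in auto)
    qed
  qed
  ultimately show ?thesis by (rule that)
qed

lemma chart_image_locally_compact:
  fixes E :: "'e::euclidean_space set"
  assumes "Hausdorff_space X" and lc: "locally_compact_space (subtopology X N)" and c: "is_chart E X (U, \<phi>)"
  shows "locally_compact_space (top_of_set (\<phi> ` (U \<inter> N)))"
proof -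
  have U: "openin X U" "homeomorphic_map (subtopology X U) (top_of_set (\<phi> ` U)) \<phi>"
    using c by (auto simp: is_chart_def)
  have "openin (subtopology X N) (N \<inter> U)" using U(1) by (auto simp: openin_subtopology)
  then have "locally_compact_space (subtopology (subtopology X N) (N \<inter> U))"
    using lc Hausdorff_space_subtopology[OF assms(1)]
    by (intro locally_compact_space_open_subset[of "subtopology X N"]) auto
  then have l: "locally_compact_space (subtopology X (U \<inter> N))"
    by (simp add: subtopology_subtopology Int_commute Int_left_absorb)
  have "homeomorphic_map (subtopology (subtopology X U) (U \<inter> N)) (subtopology (top_of_set (\<phi> ` U)) (\<phi> ` (U \<inter> N))) \<phi>"
    using is_chart_inj[OF c] openin_subset[OF U(1)]
    by (intro homeomorphic_map_subtopologies[OF U(2)]) (auto simp: inj_on_def)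
  moreover have "subtopology (subtopology X U) (U \<inter> N) = subtopology X (U \<inter> N)"
    by (simp add: subtopology_subtopology Int_left_absorb)
  moreover have "subtopology (top_of_set (\<phi> ` U)) (\<phi> ` (U \<inter> N)) = top_of_set (\<phi> ` (U \<inter> N))"
    by (simp add: subtopology_subtopology inf.absorb2 image_mono)
  ultimately have "homeomorphic_map (subtopology X (U \<inter> N)) (top_of_set (\<phi> ` (U \<inter> N))) \<phi>" by simp
  then show ?thesis
    using l homeomorphic_locally_compact_space homeomorphic_map_imp_homeomorphic_space by blast
qed

text \<open>The chart is followed by the shear that subtracts from \<open>z\<close> the offset of
  the graph over \<open>proj B z\<close>. The shear preserves \<open>proj B\<close>, so it is
  inverted by adding the same offset, and it moves the graph into \<open>span B\<close>.\<close>

lemma straightening_chart: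
  fixes E :: "'e::euclidean_space set" and X :: "'a topology"
  assumes E: "subspace E" and c: "(U0, \<phi>) \<in> A" "p \<in> U0"
    and charts: "\<And>d. d \<in> A \<Longrightarrow> is_chart E X d" and comp: "\<And>d d'. d \<in> A \<Longrightarrow> d' \<in> A \<Longrightarrow> ck_compatible k E d d'"
    and patch: "graph_patch (\<phi> ` (U0 \<inter> N)) B D Q F C" and p: "\<phi> p \<in> Q" "p \<in> N" and BE: "span B \<subseteq> E"
    and ck: "ck_on k UNIV D (\<lambda>x. F (proj B x))"
  shows "\<exists>(U, \<psi>) \<in> ck_charts k E X A. p \<in> U \<and> \<psi> ` (U \<inter> N) = \<psi> ` U \<inter> span B"
proof -
  note ch = charts[OF c(1)]
  have B: "orthonormal B" "open D" "open Q" by (rule patch_basis[OF patch])+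
  have lin: "linear (proj B)" by (rule bounded_linear.linear[OF bounded_linear_proj])
  note pp = proj_proj[OF B(1)] and inj = is_chart_inj[OF ch]
  have PE: "\<phi> ` U0 \<subseteq> E" by (rule is_chart_subset[OF ch])
  define \<Theta> where "\<Theta> z = z - (F (proj B z) - proj B z)" for z
  define \<Xi> where "\<Xi> z = z + (F (proj B z) - proj B z)" for z
  \<comment> \<open>The offset lies in \<open>E\<close>, because \<open>E\<close> contains both the
    chart image and \<open>span B\<close>. Hence the shear maps points of \<open>E\<close> to points
    of \<open>E\<close>.\<close>
  have FE: "F (proj B z) - proj B z \<in> E" if "z \<in> D" for z
  proof -
    have "F (proj B z) \<in> E" using patch_graph(1)[OF patch that] PE by auto
    then show ?thesis using E BE proj_in_span[of B z] by (intro subspace_diff) auto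
  qed
  have pT: "proj B (\<Theta> z) = proj B z" "proj B (\<Xi> z) = proj B z" if "z \<in> D" for z
    using patch_graph(2)[OF patch that] by (simp_all add: \<Theta>_def \<Xi>_def linear_diff[OF lin] linear_add[OF lin] pp)
  have TD: "\<Theta> z \<in> D" "\<Xi> z \<in> D" if "z \<in> D" for z
    using patch_proj[OF patch, of "\<Theta> z"] patch_proj[OF patch, of "\<Xi> z"] patch_proj[OF patch, of z] pT[OF that] that by auto
  have TE: "\<Theta> z \<in> E" "\<Xi> z \<in> E" if "z \<in> D" "z \<in> E" for z
    using FE[OF that(1)] that(2) E by (auto simp: \<Theta>_def \<Xi>_def intro: subspace_diff subspace_add)
  have inv: "\<Xi> (\<Theta> z) = z" "\<Theta> (\<Xi> z) = z" if "z \<in> D" for z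
    using pT[OF that] by (simp_all add: \<Theta>_def[of "\<Xi> z"] \<Xi>_def[of "\<Theta> z"]) (simp_all add: \<Theta>_def \<Xi>_def)
  have ckT: "ck_on k UNIV D \<Theta>" "ck_on k UNIV D \<Xi>"
    unfolding \<Theta>_def \<Xi>_def
    by (intro ck_on_diff ck_on_add ck ck_on_linear bounded_linear_ident bounded_linear_proj)+
  have contT: "continuous_on D \<Theta>" "continuous_on D \<Xi>" using ckT by (auto intro: ck_on_imp_continuous_on)
  define U where "U = {x \<in> U0. \<phi> x \<in> D \<inter> Q}"
  define \<psi> where "\<psi> = \<Theta> \<circ> \<phi>"
  have Usub: "U \<subseteq> U0" and UD: "\<And>x. x \<in> U \<Longrightarrow> \<phi> x \<in> D" and UE: "\<And>x. x \<in> U \<Longrightarrow> \<phi> x \<in> E"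
    using PE by (auto simp: U_def)
  have U0: "openin X U0" "openin (top_of_set E) (\<phi> ` U0)" "homeomorphic_map (subtopology X U0) (top_of_set (\<phi> ` U0)) \<phi>"
    using ch by (auto simp: is_chart_def)
  have topU0: "topspace (subtopology X U0) = U0" using openin_subset[OF U0(1)] by auto
  have "openin (subtopology X U0) {x \<in> topspace (subtopology X U0). \<phi> x \<in> \<phi> ` U0 \<inter> (D \<inter> Q)}"
    by (rule openin_continuous_map_preimage[OF homeomorphic_imp_continuous_map[OF U0(3)]])
       (use B in \<open>auto intro!: openin_open_Int\<close>)
  moreover have "{x \<in> topspace (subtopology X U0). \<phi> x \<in> \<phi> ` U0 \<inter> (D \<inter> Q)} = U"
    unfolding topU0 U_def by auto
  ultimately have U: "openin X U" using U0(1) by (simp add: openin_open_subtopology)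
  have injU: "inj_on \<psi> U"
  proof (rule inj_onI)
    fix x y assume xy: "x \<in> U" "y \<in> U" "\<psi> x = \<psi> y"
    then have "\<Xi> (\<Theta> (\<phi> x)) = \<Xi> (\<Theta> (\<phi> y))" by (simp add: \<psi>_def)
    then have "\<phi> x = \<phi> y" using inv(1)[OF UD[OF xy(1)]] inv(1)[OF UD[OF xy(2)]] by simp
    then show "x = y" using inj xy Usub by (auto simp: inj_on_def)
  qed
  \<comment> \<open>Writing the image as a preimage under the inverse shear makes its openness in
    \<open>E\<close> visible.\<close>
  have img: "\<psi> ` U = E \<inter> (D \<inter> \<Xi> -` (T \<inter> Q))" if T: "\<phi> ` U0 = E \<inter> T" for T
  proof
    show "\<psi> ` U \<subseteq> E \<inter> (D \<inter> \<Xi> -` (T \<inter> Q))"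
    proof
      fix w assume "w \<in> \<psi> ` U"
      then obtain x where x: "x \<in> U" "w = \<Theta> (\<phi> x)" by (auto simp: \<psi>_def)
      have "\<phi> x \<in> T" "\<phi> x \<in> Q" using x T by (auto simp: U_def)
      then show "w \<in> E \<inter> (D \<inter> \<Xi> -` (T \<inter> Q))"
        using x TD(1)[OF UD] TE(1)[OF UD UE] inv(1)[OF UD] by auto
    qed
    show "E \<inter> (D \<inter> \<Xi> -` (T \<inter> Q)) \<subseteq> \<psi> ` U"
    proof
      fix w assume w: "w \<in> E \<inter> (D \<inter> \<Xi> -` (T \<inter> Q))"
      then have "\<Xi> w \<in> E \<inter> T" using TE(2) by auto
      then obtain x where x: "x \<in> U0" "\<phi> x = \<Xi> w" using T by (metis imageE)
      then have "x \<in> U" using w TD(2) by (auto simp: U_def)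
      moreover have "\<psi> x = w" using x inv(2) w by (simp add: \<psi>_def)
      ultimately show "w \<in> \<psi> ` U" by auto
    qed
  qed
  obtain T where T: "open T" "\<phi> ` U0 = E \<inter> T" using U0(2) by (auto simp: openin_open)
  have "open (D \<inter> \<Xi> -` (T \<inter> Q))"
    by (rule continuous_open_preimage[OF contT(2) B(2)]) (use T B in auto)
  then have opsi: "openin (top_of_set E) (\<psi> ` U)" unfolding img[OF T(2)] by (rule openin_open_Int)
  have "homeomorphic_map (subtopology (subtopology X U0) U) (subtopology (top_of_set (\<phi> ` U0)) (\<phi> ` U)) \<phi>"
  proof (rule homeomorphic_map_subtopologies[OF U0(3)])
    have "U0 \<inter> U = U" "\<phi> ` U0 \<inter> \<phi> ` U = \<phi> ` U" using Usub by auto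
    then show "\<phi> ` (topspace (subtopology X U0) \<inter> U) = topspace (top_of_set (\<phi> ` U0)) \<inter> \<phi> ` U"
      by (simp only: topU0 topspace_euclidean_subtopology)
  qed
  then have h1: "homeomorphic_map (subtopology X U) (top_of_set (\<phi> ` U)) \<phi>"
    using Usub by (simp add: subtopology_subtopology inf.absorb2 image_mono)
  have "homeomorphism (\<phi> ` U) (\<psi> ` U) \<Theta> \<Xi>"
    unfolding homeomorphism_def
  proof (intro conjI ballI)
    show "continuous_on (\<phi> ` U) \<Theta>" using UD by (intro continuous_on_subset[OF contT(1)]) auto
    show "continuous_on (\<psi> ` U) \<Xi>" using UD TD(1) by (intro continuous_on_subset[OF contT(2)]) (auto simp: \<psi>_def)
    show "\<Theta> ` \<phi> ` U = \<psi> ` U" by (auto simp: \<psi>_def)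
    show "\<Xi> ` \<psi> ` U = \<phi> ` U" using inv(1)[OF UD] by (force simp: \<psi>_def)
  qed (use inv(1)[OF UD] in \<open>auto simp: \<psi>_def\<close>)
  then have "homeomorphic_map (top_of_set (\<phi> ` U)) (top_of_set (\<psi> ` U)) \<Theta>"
    unfolding homeomorphic_map_maps homeomorphic_maps_def homeomorphism_def
    by (intro exI[of _ \<Xi>]) (auto simp: continuous_map_in_subtopology)
  from homeomorphic_map_compose[OF h1 this]
  have "homeomorphic_map (subtopology X U) (top_of_set (\<psi> ` U)) \<psi>" by (simp add: \<psi>_def)
  with U opsi have chart: "is_chart E X (U, \<psi>)" by (simp add: is_chart_def)
  have invpsi: "inv_into U \<psi> (\<psi> x) = x" "inv_into U0 \<phi> (\<Xi> (\<psi> x)) = x" if "x \<in> U" for x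
    using that inv_into_f_f[OF injU that] inv(1)[OF UD[OF that]] inj Usub by (auto simp: \<psi>_def)
  have "ck_compatible k E (U, \<psi>) d" if d: "d \<in> A" for d
  proof -
    obtain V \<omega> where V: "d = (V, \<omega>)" by fastforce
    have chd: "is_chart E X (V, \<omega>)" using charts[OF d] V by simp
    note injV = is_chart_inj[OF chd] and VE = is_chart_subset[OF chd]
    have cc: "ck_on k E (\<phi> ` (U0 \<inter> V)) (\<omega> \<circ> inv_into U0 \<phi>)" "ck_on k E (\<omega> ` (U0 \<inter> V)) (\<phi> \<circ> inv_into V \<omega>)"
      using comp[OF c(1) d] by (auto simp: V ck_compatible_def)
    have "ck_on k E (\<psi> ` (U \<inter> V)) (\<lambda>w. (\<omega> \<circ> inv_into U0 \<phi>) (\<Xi> w))"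
    proof (rule ck_on_compose_subspace[OF E _ cc(1)])
      show "ck_on k E (\<psi> ` (U \<inter> V)) \<Xi>"
        by (rule ck_on_subset[OF ckT(2)]) (use TD(1)[OF UD] in \<open>auto simp: \<psi>_def\<close>)
      show "\<Xi> ` \<psi> ` (U \<inter> V) \<subseteq> \<phi> ` (U0 \<inter> V)" using inv(1)[OF UD] Usub by (auto simp: \<psi>_def)
      show "\<psi> ` (U \<inter> V) \<subseteq> E" using TE(1)[OF UD UE] by (auto simp: \<psi>_def)
    qed (use PE in auto)
    then have 1: "ck_on k E (\<psi> ` (U \<inter> V)) (\<omega> \<circ> inv_into U \<psi>)"
      by (rule ck_on_cong) (auto simp: invpsi)
    have invV: "inv_into V \<omega> (\<omega> x) = x" if "x \<in> V" for x using injV that by simp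
    have "ck_on k E (\<omega> ` (U \<inter> V)) (\<lambda>w. \<Theta> ((\<phi> \<circ> inv_into V \<omega>) w))"
    proof (rule ck_on_compose_subspace[where g = \<Theta> and f = "\<phi> \<circ> inv_into V \<omega>" and V = "\<phi> ` U", OF E])
      show "ck_on k E (\<omega> ` (U \<inter> V)) (\<phi> \<circ> inv_into V \<omega>)"
        by (rule ck_on_subset[OF cc(2)]) (use Usub in auto)
      show "ck_on k E (\<phi> ` U) \<Theta>" by (rule ck_on_subset[OF ckT(1)]) (use UD in auto)
      show "(\<phi> \<circ> inv_into V \<omega>) ` \<omega> ` (U \<inter> V) \<subseteq> \<phi> ` U" by (auto simp: invV)
    qed (use VE UE in auto)
    then have 2: "ck_on k E (\<omega> ` (U \<inter> V)) (\<psi> \<circ> inv_into V \<omega>)"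
      by (rule ck_on_cong) (simp add: \<psi>_def)
    show ?thesis using 1 2 by (simp add: V ck_compatible_def)
  qed
  with chart have "(U, \<psi>) \<in> ck_charts k E X A" by (simp add: ck_charts_def)
  moreover have pU: "p \<in> U"
    using c p patch_inverse(1)[OF patch, of "\<phi> p"] patch_proj[OF patch, of "\<phi> p"] by (auto simp: U_def)
  moreover have "\<psi> ` (U \<inter> N) = \<psi> ` U \<inter> span B"
  proof
    show "\<psi> ` (U \<inter> N) \<subseteq> \<psi> ` U \<inter> span B"
    proof
      fix w assume "w \<in> \<psi> ` (U \<inter> N)"
      then obtain x where x: "x \<in> U" "x \<in> N" "w = \<psi> x" by auto
      have "F (proj B (\<phi> x)) = \<phi> x"
        by (rule patch_inverse(2)[OF patch]) (use x in \<open>auto simp: U_def\<close>)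
      then have "w = proj B (\<phi> x)" using x by (simp add: \<psi>_def \<Theta>_def)
      then have "w \<in> span B" by (simp add: proj_in_span)
      moreover have "w \<in> \<psi> ` U" unfolding x(3) using x(1) by (rule imageI)
      ultimately show "w \<in> \<psi> ` U \<inter> span B" by blast
    qed
    show "\<psi> ` U \<inter> span B \<subseteq> \<psi> ` (U \<inter> N)"
    proof
      fix w assume "w \<in> \<psi> ` U \<inter> span B"
      then obtain x where x: "x \<in> U" "w = \<Theta> (\<phi> x)" "w = \<psi> x" "w \<in> span B" by (auto simp: \<psi>_def)
      have D: "\<phi> x \<in> D" by (rule UD[OF x(1)])
      have "w = proj B (\<phi> x)" using pT(1)[OF D] x(2,4) proj_span[OF B(1), of w] by simp
      then have "F (proj B (\<phi> x)) = \<phi> x" using x(2) by (simp add: \<Theta>_def)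
      then have "\<phi> x \<in> \<phi> ` (U0 \<inter> N)" using patch_graph(1)[OF patch D] by auto
      then have "x \<in> N" using inj x(1) Usub by (auto simp: inj_on_def)
      then show "w \<in> \<psi> ` (U \<inter> N)" unfolding x(3) using x(1) by (intro imageI IntI)
    qed
  qed
  ultimately show ?thesis by blast
qed

theorem corollary1p3:
  fixes k :: nat
    and E :: "'e::euclidean_space set"
    and X :: "'a topology"
    and A :: "('a, 'e) chart set"
    and N :: "'a set"
  assumes "k \<ge> 1"
    and "ck_manifold k E X A"
    and "N \<subseteq> topspace X"
    and "locally_compact_space (subtopology X N)"
    and "ck_homogeneous k E X A N"
  shows "ck_submanifold k E X A N"
proof (cases "N = {}")
  case True
  then show ?thesis by (simp add: ck_submanifold_def)
next
  case False
  have E: "subspace E" and Hd: "Hausdorff_space X" and charts: "\<And>c. c \<in> A \<Longrightarrow> is_chart E X c"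
    and cover: "(\<Union>c\<in>A. fst c) = topspace X"
    and comp: "\<And>c d. c \<in> A \<Longrightarrow> d \<in> A \<Longrightarrow> ck_compatible k E c d"
    using assms(2) by (auto simp: ck_manifold_def)
  have chart_at: "\<exists>U \<phi>. (U, \<phi>) \<in> A \<and> p \<in> U" if p: "p \<in> N" for p
  proof -
    have "p \<in> (\<Union>c\<in>A. fst c)" using p assms(3) cover by blast
    then show ?thesis by force
  qed
  obtain p0 where p0: "p0 \<in> N" using False by blast
  obtain U0 \<phi>0 where c0: "(U0, \<phi>0) \<in> A" "p0 \<in> U0" using chart_at[OF p0] by blast
  \<comment> \<open>The dimension of the cone at one reference point; the reference point is the
    reason why the empty set is treated separately.\<close>
  define m where "m = dim (pcone (\<phi>0 ` (U0 \<inter> N)) (\<phi>0 p0))"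
  have "\<exists>(U, \<psi>) \<in> ck_charts k E X A. \<exists>S. p \<in> U \<and> subspace S \<and> S \<subseteq> E \<and> dim S = m \<and> \<psi> ` (U \<inter> N) = \<psi> ` U \<inter> S"
    if p: "p \<in> N" for p
  proof -
    obtain U \<phi> where c: "(U, \<phi>) \<in> A" "p \<in> U" using chart_at[OF p] by blast
    let ?M = "\<phi> ` (U \<inter> N)"
    have M: "\<phi> p \<in> ?M" using c p by auto
    have hom: "ck_homog k ?M"
      unfolding ck_homog_def
    proof (intro ballI)
      fix a b assume "a \<in> ?M" "b \<in> ?M"
      then obtain x y where xy: "x \<in> U" "x \<in> N" "a = \<phi> x" "y \<in> U" "y \<in> N" "b = \<phi> y" by auto
      obtain V V' H H' where "ck_equiv k V V' H H'" "\<phi> x \<in> V" "H (\<phi> x) = \<phi> y" "H ` (V \<inter> ?M) = V' \<inter> ?M"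
        by (rule chart_transition[OF E c(1) c(1) charts[OF c(1)] charts[OF c(1)] xy(2,5,1,4) assms(5)])
      then show "\<exists>U U' H H'. ck_equiv k U U' H H' \<and> a \<in> U \<and> H a = b \<and> H ` (U \<inter> ?M) = U' \<inter> ?M"
        using xy by blast
    qed
    \<comment> \<open>The transition between two possibly different charts, from the reference point
      to \<open>p\<close>. It identifies the dimension of the cone at \<open>p\<close> with
      \<open>m\<close>.\<close>
    obtain V V' H H' where tr: "ck_equiv k V V' H H'" "\<phi>0 p0 \<in> V" "H (\<phi>0 p0) = \<phi> p"
      "H ` (V \<inter> \<phi>0 ` (U0 \<inter> N)) = V' \<inter> ?M"
      by (rule chart_transition[OF E c0(1) c(1) charts[OF c0(1)] charts[OF c(1)] p0 p c0(2) c(2) assms(5)])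
    have dm: "dim (pcone ?M (\<phi> p)) = m"
      using ck_equiv_dim[OF tr(1) assms(1) tr(2) _ tr(4)] tr(3) p0 c0 by (simp add: m_def)
    obtain B D Q F C where P: "graph_patch ?M B D Q F C" "\<phi> p \<in> Q" "span B = span (pcone ?M (\<phi> p))"
      "ck_on k UNIV D (\<lambda>x. F (proj B x))"
      using local_structure[OF chart_image_locally_compact[OF Hd assms(4) charts[OF c(1)]] hom assms(1) M] by metis
    have "?M \<subseteq> E" using is_chart_subset[OF charts[OF c(1)]] by auto
    then have "pcone ?M (\<phi> p) \<subseteq> E" by (rule pcone_subset_subspace[OF _ E closed_subspace[OF E]])
    then have BE: "span B \<subseteq> E" unfolding P(3) by (rule span_minimal[OF _ E])
    have dB: "dim (span B) = m" using dm by (simp add: P(3))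
    obtain W \<psi> where W: "(W, \<psi>) \<in> ck_charts k E X A" "p \<in> W" "\<psi> ` (W \<inter> N) = \<psi> ` W \<inter> span B"
      using straightening_chart[OF E c charts comp P(1,2) p BE P(4)] by (auto split: prod.splits)
    have "p \<in> W \<and> subspace (span B) \<and> span B \<subseteq> E \<and> dim (span B) = m \<and> \<psi> ` (W \<inter> N) = \<psi> ` W \<inter> span B"
      using W(2,3) BE dB by simp
    then have ex: "\<exists>S. p \<in> W \<and> subspace S \<and> S \<subseteq> E \<and> dim S = m \<and> \<psi> ` (W \<inter> N) = \<psi> ` W \<inter> S"
      by (rule exI)
    show ?thesis
      by (rule bexI[OF _ W(1)]) (unfold prod.case, rule ex)
  qed
  then have "\<forall>p\<in>N. \<exists>(U, \<psi>) \<in> ck_charts k E X A. \<exists>S. p \<in> U \<and> subspace S \<and> S \<subseteq> E \<and> dim S = m \<and> \<psi> ` (U \<inter> N) = \<psi> ` U \<inter> S"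
    by (rule ballI)
  then show ?thesis
    unfolding ck_submanifold_def using assms(3) by (intro conjI exI[of _ m])
qed

end
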